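(* Let $\mathcal{H}_A,\mathcal{H}_B$ be Hilbert spaces of the same finite dimension $d$, let $|\phi\rangle\in\mathcal{H}_A\otimes\mathcal{H}_B$ be a unit vector, let $\rho_A=\operatorname{Tr}_B|\phi\rangle\langle\phi|$, and let $\mathbf p=(p_1,\dots,p_d)$, $p_1\ge p_2\ge\dots\ge p_d$, be the eigenvalues of $\rho_A$ (with multiplicity). Put $\psi(s):=\log\operatorname{Tr}\rho_A^s$. Let $R\ge 0$. (i) If $R\le H(\rho_A)$, then $$\lim_{n\to\infty}\frac{-1}{n}\log\sum_{\mathbf n:\ \dim V_{\mathbf n}\le 2^{nR}}\operatorname{Tr}W_{\mathbf n}\rho_A^{\otimes n}=\inf\{D(\mathbf q\|\mathbf p)\mid H(\mathbf q)\le R\}=\sup_{s\ge 1}\frac{(1-s)R-\psi(s)}{s}.$$ (ii) If $R\ge H(\rho_A)$, then $$\lim_{n\to\infty}\frac{-1}{n}\log\sum_{\mathbf n:\ \dim V_{\mathbf n}\ge 2^{nR}}\operatorname{Tr}W_{\mathbf n}\rho_A^{\otimes n}=\inf\{D(\mathbf q\|\mathbf p)\mid H(\mathbf q)\ge R\}=\sup_{0<s\le 1}\frac{(1-s)R-\psi(s)}{s}.$$ Thus, when $R<H(\rho_A)$, one has $\sup_{s\ge 1}\frac{(1-s)R-\psi(s)}{s}>0$. In both infima, $\mathbf q$ ranges over all probability vectors of length $d$.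
   Context: All logarithms are to base $2$; $-\log 0=+\infty$ and $\inf\emptyset=+\infty$. $H(\rho)=-\operatorname{Tr}\rho\log\rho$ is the von Neumann entropy. For probability vectors, $H(\mathbf q)=-\sum_i q_i\log q_i$ is the Shannon entropy and $D(\mathbf q\|\mathbf p)=\sum_i q_i\log(q_i/p_i)$ is the relative entropy, with $0\log 0=0$ and value $+\infty$ if some $q_i>0=p_i$. $\rho_A^s$ is the $s$-th power of $\rho_A$ on its support (zero eigenvalues contribute $0$ to $\operatorname{Tr}\rho_A^s$). For each $n\ge1$, the index $\mathbf n$ ranges over integer vectors $\mathbf n=(n_1,\dots,n_d)$ with $n_1\ge n_2\ge\dots\ge n_d\ge 0$ and $\sum_i n_i=n$. By Schur–Weyl duality, $\mathcal{H}_A^{\otimes n}=\bigoplus_{\mathbf n}W_{\mathbf n}$ with $W_{\mathbf n}\cong U_{\mathbf n}\otimes V_{\mathbf n}$, where $V_{\mathbf n}$ is the irreducible unitary representation of the symmetric group $S_n$ (acting by permuting tensor factors) labelled by $\mathbf n$, and $U_{\mathbf n}$ is the irreducible unitary representation of $\mathrm{SU}(d)$ labelled by $\mathbf n$. The same symbol $W_{\mathbf n}$ denotes the orthogonal projection onto the subspace $W_{\mathbf n}$. (Interpretation: in the universal entanglement concentration protocol, both parties measure $\{W_{\mathbf n}\}_{\mathbf n}$ on their $n$ systems and discard the factors $U_{\mathbf n}$; outcome $\mathbf n$ occurs with probability $\operatorname{Tr}W_{\mathbf n}\rho_A^{\otimes n}$ and leaves a maximally entangled state of Schmidt rank $\dim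 V_{\mathbf n}$.)
   Formalization: In (ii) the limit is not asserted at R = log r, where r ≥ 2 is the rank of ρ_A: there every n with positive probability has dim V_n < 2^{nR}, so the limit is +∞ while the infimum is finite (e.g. d=2, p=(1/2,1/2), R=1). The identity inf = sup is kept there. *)

theory Defs
  imports
    "HOL-Analysis.Analysis"
    "HOL-Combinatorics.Permutations"
    "HOL-Library.Function_Algebras"
begin

section \<open>Entropies of probability vectors\<close>

text \<open>
  A vector of length \<open>d\<close> is a function on \<open>nat\<close> of which only the values at
  \<open>0, \<dots>, d - 1\<close> are used. Since \<open>log 2 0 = 0\<close> and \<open>x / 0 = 0\<close>, the convention
  \<open>0 log 0 = 0\<close> is automatic below; the infinite values are made explicit.
\<close>

definition prob_vector :: "nat \<Rightarrow> (nat \<Rightarrow> real) \<Rightarrow> bool" where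
  "prob_vector d q \<longleftrightarrow> (\<forall>i<d. 0 \<le> q i) \<and> (\<Sum>i<d. q i) = 1"

definition shannon_entropy :: "nat \<Rightarrow> (nat \<Rightarrow> real) \<Rightarrow> real" where
  "shannon_entropy d q = - (\<Sum>i<d. q i * log 2 (q i))"

definition rel_entropy :: "nat \<Rightarrow> (nat \<Rightarrow> real) \<Rightarrow> (nat \<Rightarrow> real) \<Rightarrow> ereal" where
  "rel_entropy d q p =
     (if \<exists>i<d. q i > 0 \<and> p i = 0 then \<infinity> else ereal (\<Sum>i<d. q i * log 2 (q i / p i)))"

definition neg_log2 :: "real \<Rightarrow> ereal" where
  "neg_log2 x = (if x = 0 then \<infinity> else ereal (- log 2 x))"


section \<open>Orthogonal projections\<close>

text \<open>
  Orthogonal projection onto \<open>S\<close> with respect to the inner product \<open>ip\<close>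
  (well defined for subspaces of finite-dimensional inner product spaces).
\<close>

definition orth_proj :: "('v \<Rightarrow> 'v \<Rightarrow> complex) \<Rightarrow> 'v::minus set \<Rightarrow> 'v \<Rightarrow> 'v" where
  "orth_proj ip S v = (THE u. u \<in> S \<and> (\<forall>s\<in>S. ip s (v - u) = 0))"


section \<open>States on a single system\<close>

definition vec_cinner :: "complex ^ 'a::finite \<Rightarrow> complex ^ 'a \<Rightarrow> complex" where
  "vec_cinner u v = (\<Sum>i\<in>UNIV. cnj (u $ i) * v $ i)"

text \<open>
  A vector of \<open>H\<^sub>A \<otimes> H\<^sub>B\<close> is given by its coordinates in the product basis.
\<close>

definition reduced_state :: "complex ^ ('a::finite \<times> 'b::finite) \<Rightarrow> complex ^ 'a ^ 'a" where
  "reduced_state \<phi> = (\<chi> i i'. \<Sum>j\<in>UNIV. \<phi> $ (i, j) * cnj (\<phi> $ (i', j)))"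

definition eigenspace :: "complex ^ 'a ^ 'a::finite \<Rightarrow> real \<Rightarrow> (complex ^ 'a) set" where
  "eigenspace A x = {v. A *v v = complex_of_real x *s v}"

text \<open>
  The nonincreasing vector of the eigenvalues of a Hermitian matrix, each repeated
  according to its multiplicity.
\<close>

definition eigenvalue_vector :: "complex ^ 'a ^ 'a::finite \<Rightarrow> (nat \<Rightarrow> real) \<Rightarrow> bool" where
  "eigenvalue_vector A p \<longleftrightarrow>
     (\<forall>i j. i \<le> j \<longrightarrow> j < CARD('a) \<longrightarrow> p j \<le> p i) \<and>
     (\<forall>x. card {i. i < CARD('a) \<and> p i = x} = vec.dim (eigenspace A x))"

text \<open>
  Functional calculus \<open>f(A) = \<Sum>x. f(x) P\<^sub>x\<close> of a Hermitian matrix \<open>A\<close>, where \<open>x\<close> runs over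
  the eigenvalues and \<open>P\<^sub>x\<close> is the projection onto the eigenspace of \<open>x\<close>.
\<close>

definition matrix_fun :: "(real \<Rightarrow> real) \<Rightarrow> complex ^ 'a ^ 'a::finite \<Rightarrow> complex ^ 'a ^ 'a" where
  "matrix_fun f A =
     (\<Sum>x | eigenspace A x \<noteq> {0}. f x *\<^sub>R matrix (orth_proj vec_cinner (eigenspace A x)))"

definition vn_entropy :: "complex ^ 'a ^ 'a::finite \<Rightarrow> real" where
  "vn_entropy \<rho> = - Re (trace (\<rho> ** matrix_fun (log 2) \<rho>))"

text \<open>
  Since \<open>0 powr s = 0\<close>, the power is taken on the support of \<open>\<rho>\<close>.
\<close>

definition log_trace_power :: "complex ^ 'a ^ 'a::finite \<Rightarrow> real \<Rightarrow> real" where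
  "log_trace_power \<rho> s = log 2 (Re (trace (matrix_fun (\<lambda>x. x powr s) \<rho>)))"


section \<open>Tensor powers\<close>

text \<open>
  The \<open>n\<close>-fold tensor power of \<open>\<complex>\<^sup>X\<close> has the product basis indexed by the words of length \<open>n\<close>
  over \<open>X\<close>. Its elements are represented as functions on words which vanish on the words of
  any other length.
\<close>

definition cscale :: "complex \<Rightarrow> ('w \<Rightarrow> complex) \<Rightarrow> ('w \<Rightarrow> complex)" where
  "cscale c v = (\<lambda>w. c * v w)"

global_interpretation cfun: vector_space cscale
  by unfold_locales (auto simp: cscale_def fun_eq_iff algebra_simps)

definition words :: "nat \<Rightarrow> 'a list set" where
  "words n = {w. length w = n}"

definition tensor_space :: "nat \<Rightarrow> ('a list \<Rightarrow> complex) set" where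
  "tensor_space n = {v. \<forall>w. w \<notin> words n \<longrightarrow> v w = 0}"

definition basis_vec :: "'a list \<Rightarrow> 'a list \<Rightarrow> complex" where
  "basis_vec w = (\<lambda>w'. if w' = w then 1 else 0)"

definition tensor_cinner :: "nat \<Rightarrow> ('a::finite list \<Rightarrow> complex) \<Rightarrow> ('a list \<Rightarrow> complex) \<Rightarrow> complex" where
  "tensor_cinner n u v = (\<Sum>w\<in>words n. cnj (u w) * v w)"

definition tensor_trace :: "nat \<Rightarrow> (('a::finite list \<Rightarrow> complex) \<Rightarrow> ('a list \<Rightarrow> complex)) \<Rightarrow> complex" where
  "tensor_trace n T = (\<Sum>w\<in>words n. T (basis_vec w) w)"

definition tensor_power ::
    "nat \<Rightarrow> complex ^ 'a ^ 'a::finite \<Rightarrow> ('a list \<Rightarrow> complex) \<Rightarrow> ('a list \<Rightarrow> complex)" where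
  "tensor_power n A v =
     (\<lambda>w. if w \<in> words n then \<Sum>w'\<in>words n. (\<Prod>k<n. A $ (w ! k) $ (w' ! k)) * v w' else 0)"

text \<open>
  The left action of the symmetric group by permutation of the tensor factors: it sends the
  basis vector of the word \<open>w\<close> to that of \<open>w \<circ> \<pi>\<^sup>-\<^sup>1\<close>.
\<close>

definition perm_act :: "(nat \<Rightarrow> nat) \<Rightarrow> ('a list \<Rightarrow> complex) \<Rightarrow> ('a list \<Rightarrow> complex)" where
  "perm_act \<pi> v = (\<lambda>w. v (permute_list \<pi> w))"

definition perm_submodule :: "nat \<Rightarrow> ('a list \<Rightarrow> complex) set \<Rightarrow> bool" where
  "perm_submodule n U \<longleftrightarrow>
     cfun.subspace U \<and> U \<subseteq> tensor_space n \<and>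
     (\<forall>\<pi> v. \<pi> permutes {..<n} \<longrightarrow> v \<in> U \<longrightarrow> perm_act \<pi> v \<in> U)"

definition perm_isomorphic ::
    "nat \<Rightarrow> ('b list \<Rightarrow> complex) set \<Rightarrow> ('a list \<Rightarrow> complex) set \<Rightarrow> bool" where
  "perm_isomorphic n V U \<longleftrightarrow>
     (\<exists>f. bij_betw f V U \<and>
          (\<forall>u\<in>V. \<forall>v\<in>V. f (u + v) = f u + f v) \<and>
          (\<forall>c. \<forall>v\<in>V. f (cscale c v) = cscale c (f v)) \<and>
          (\<forall>\<pi>. \<pi> permutes {..<n} \<longrightarrow> (\<forall>v\<in>V. f (perm_act \<pi> v) = perm_act \<pi> (f v))))"


section \<open>Irreducible representations of the symmetric group and Schur--Weyl duality\<close>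

definition young_indices :: "nat \<Rightarrow> nat \<Rightarrow> nat list set" where
  "young_indices d n = {ns. length ns = d \<and> sorted_wrt (\<ge>) ns \<and> sum_list ns = n}"

text \<open>
  \<open>V\<^sub>n\<close> is the Specht module: the span of the polytabloids of the Young tableaux of the given shape.
  A tableau assigns to each of the points \<open>0, \<dots>, n - 1\<close> its cell, and its tabloid (the rows as
  unordered sets) is the word of length \<open>n\<close> listing the row of each point. Thus the permutation
  module on tabloids lies in a tensor power, where \<^const>\<open>perm_act\<close> is the action of the
  symmetric group on tabloids. The one-row shape gives the trivial representation.
\<close>

definition young_cells :: "nat list \<Rightarrow> (nat \<times> nat) set" where
  "young_cells ns = {(i, j). i < length ns \<and> j < ns ! i}"

definition tableaux :: "nat list \<Rightarrow> (nat \<Rightarrow> nat \<times> nat) set" where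
  "tableaux ns = {t. bij_betw t {..<sum_list ns} (young_cells ns)}"

definition tabloid :: "nat \<Rightarrow> (nat \<Rightarrow> nat \<times> nat) \<Rightarrow> nat list" where
  "tabloid n t = map (\<lambda>k. fst (t k)) [0..<n]"

definition column_group :: "nat \<Rightarrow> (nat \<Rightarrow> nat \<times> nat) \<Rightarrow> (nat \<Rightarrow> nat) set" where
  "column_group n t = {\<pi>. \<pi> permutes {..<n} \<and> (\<forall>k<n. snd (t (\<pi> k)) = snd (t k))}"

definition polytabloid :: "nat \<Rightarrow> (nat \<Rightarrow> nat \<times> nat) \<Rightarrow> nat list \<Rightarrow> complex" where
  "polytabloid n t =
     (\<Sum>\<pi>\<in>column_group n t. cscale (of_int (sign \<pi>)) (perm_act \<pi> (basis_vec (tabloid n t))))"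

definition specht_module :: "nat list \<Rightarrow> (nat list \<Rightarrow> complex) set" where
  "specht_module ns = cfun.span (polytabloid (sum_list ns) ` tableaux ns)"

text \<open>
  \<open>W\<^sub>n\<close>, the summand \<open>U\<^sub>n \<otimes> V\<^sub>n\<close> of the tensor power, is the isotypic component of \<open>V\<^sub>n\<close>: the sum of
  all submodules isomorphic to it. The multiplicity space \<open>U\<^sub>n\<close> plays no further role.
\<close>

definition schur_weyl_space :: "nat list \<Rightarrow> ('a list \<Rightarrow> complex) set" where
  "schur_weyl_space ns =
     cfun.span (\<Union>{U. perm_submodule (sum_list ns) U \<and>
                      perm_isomorphic (sum_list ns) (specht_module ns) U})"

definition schur_weyl_proj ::
    "nat list \<Rightarrow> ('a::finite list \<Rightarrow> complex) \<Rightarrow> ('a list \<Rightarrow> complex)" where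
  "schur_weyl_proj ns = orth_proj (tensor_cinner (sum_list ns)) (schur_weyl_space ns)"

definition schur_weyl_prob :: "complex ^ 'a ^ 'a::finite \<Rightarrow> nat list \<Rightarrow> real" where
  "schur_weyl_prob \<rho> ns =
     Re (tensor_trace (sum_list ns) (schur_weyl_proj ns \<circ> tensor_power (sum_list ns) \<rho>))"

text \<open>
  If \<open>\<rho>\<close> has rank \<open>r\<close>, only shapes with at most \<open>r\<close> nonzero rows have nonzero probability, and for
  these the dimension of the Specht module is at most a single multinomial coefficient, hence less
  than \<open>r ^ n\<close> when \<open>r \<ge> 2\<close> and \<open>n \<ge> 1\<close>. At the rate \<open>R = log r > 0\<close> the probability of the event
  \<open>dim V\<^sub>n \<ge> 2 powr (n * R)\<close> is therefore exactly \<open>0\<close> for every \<open>n \<ge> 1\<close>, so its exponent is infinite,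
  although the relative entropy of the uniform distribution on the support is finite. The limit of
  this exponent has to be stated with that single rate excluded.
\<close>

end

theory Submission
  imports Defs "HOL-Combinatorics.Multiset_Permutations" "HOL-Real_Asymp.Real_Asymp"
begin

text \<open>
  Write \<open>f\<close> for the dimension of the Specht module of the shape \<open>n\<close> and \<open>p\<^sup>n\<close> for \<open>\<Prod>i. p\<^sub>i ^ n\<^sub>i\<close>. The
  probability of the outcome \<open>n\<close> equals \<open>f p\<^sup>n\<close> up to a factor polynomial in the number of systems.
  From below, the Specht module embeds into the tensor power through the words in an eigenbasis, and
  the state acts on this copy as \<open>p\<^sup>n\<close>. From above, column antisymmetry makes every eigenword occurring
  in the isotypic component majorized by the shape, and homomorphisms into the tensor power are
  determined by a kernel that depends only on the joint type of two words. Neither irreducibility nor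
  completeness of the Specht modules is needed.

  Since \<open>f\<close> is at most a multinomial coefficient, \<open>f p\<^sup>n = f\<^bsup>(s-1)/s\<^esup> (f (p\<^sup>n)\<^sup>s)\<^bsup>1/s\<^esup>\<close> together with the
  multinomial theorem bounds the exponents from below by the Legendre-type suprema. They are attained
  by shapes close to the tilted distributions \<open>p\<^sub>i\<^sup>s / \<Sum>\<^sub>j p\<^sub>j\<^sup>s\<close> (and, for rates below the logarithm of the
  multiplicity of the largest eigenvalue, to distributions on its eigenspace), because
  \<open>D(q\<parallel>p) - ((1 - s) H(q) - \<psi>(s)) / s\<close> is \<open>1/s\<close> times the divergence of \<open>q\<close> from the tilted
  distribution. For these shapes \<open>f\<close> is bounded below by counting ballot sequences made of freely
  permuted blocks.
\<close>

text \<open>The events are cut out by the exact dimension \<open>f\<close>, not by an entropy. Upper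
  bounds on the probability therefore never convert \<open>f\<close> into an entropy: membership in
  the event bounds \<open>f^((s-1)/s)\<close> by \<open>2^(nR(s-1)/s)\<close>, with s \<ge> 1 for
  \<open>f \<le> 2^(nR)\<close> and s \<le> 1 for \<open>f \<ge> 2^(nR)\<close>. Lower bounds need a
  shape on the correct side of the threshold, while the dimension of an approximating shape is known
  only up to a factor \<open>2^(n\<delta>)\<close>. The optimal distribution is therefore moved
  strictly inside the event, by aiming at a smaller entropy or by mixing with the uniform
  distribution on the support. The first move fails at R = 0, where the one-row shape, of dimension
  exactly 1, takes over. The second fails at R = log r, r being the rank: this is the excluded rate,
  unless r = 1, when the threshold is 1 and every shape qualifies. The suprema need not be attained
  (s may have to tend to infinity or to 0), so optimal distributions come with a slack \<epsilon> in
  the comparison with \<open>rate\<close>.\<close>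

section \<open>Complex inner product spaces\<close>

text \<open>The carrier \<open>C\<close> is kept apart from the type because functions on words of
  all lengths form an infinite-dimensional space, on which the form for length \<open>n\<close> is
  only semidefinite. With definiteness asked on \<open>C\<close>, one Gram-Schmidt argument serves
  single-system vectors, tensor powers and permutation modules.\<close>

locale complex_inner_space = vector_space scale
  for scale :: "complex \<Rightarrow> 'v::ab_group_add \<Rightarrow> 'v" (infixr "*c" 75) +
  fixes C :: "'v set" and ip :: "'v \<Rightarrow> 'v \<Rightarrow> complex"
  assumes subspace_carrier: "subspace C"
    and ip_add_right: "ip u (v + w) = ip u v + ip u w"
    and ip_scale_right: "ip u (c *c v) = c * ip u v"
    and ip_cnj: "ip v u = cnj (ip u v)"
    and ip_self_nonneg: "0 \<le> Re (ip v v)"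
    and ip_definite: "v \<in> C \<Longrightarrow> ip v v = 0 \<Longrightarrow> v = 0"
begin

definition orthonormal :: "'v set \<Rightarrow> bool" where
  "orthonormal E \<longleftrightarrow> (\<forall>e\<in>E. \<forall>e'\<in>E. ip e e' = (if e = e' then 1 else 0))"

lemma ip_zero_right [simp]: "ip u 0 = 0"
  using ip_add_right[of u 0 0] by simp

lemma ip_minus_right: "ip u (v - w) = ip u v - ip u w"
  using ip_add_right[of u "v - w" w] by simp

lemma ip_scale_left: "ip (c *c u) w = cnj c * ip u w"
  by (metis ip_cnj ip_scale_right complex_cnj_mult)

lemma ip_sum_right: "ip u (\<Sum>i\<in>I. g i) = (\<Sum>i\<in>I. ip u (g i))"
  by (induction I rule: infinite_finite_induct) (auto simp: ip_add_right)

lemma ip_self_real: "ip v v = of_real (Re (ip v v))"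
  by (metis ip_cnj Reals_cnj_iff of_real_Re)

lemma orthonormalD:
  "orthonormal E \<Longrightarrow> e \<in> E \<Longrightarrow> e' \<in> E \<Longrightarrow> ip e e' = (if e = e' then 1 else 0)"
  by (auto simp: orthonormal_def)

lemma orthonormal_subset: "orthonormal E \<Longrightarrow> F \<subseteq> E \<Longrightarrow> orthonormal F"
  unfolding orthonormal_def by blast

lemma ip_orthonormal_sum:
  assumes "finite E" "orthonormal E" "e \<in> E"
  shows "ip e (\<Sum>e'\<in>E. f e' *c e') = f e"
proof -
  have "ip e (\<Sum>e'\<in>E. f e' *c e') = (\<Sum>e'\<in>E. if e' = e then f e else 0)"
    unfolding ip_sum_right ip_scale_right
    by (rule sum.cong) (use assms in \<open>auto simp: orthonormalD\<close>)
  then show ?thesis using assms by simp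
qed

lemma orthonormal_expansion:
  assumes "finite E" "orthonormal E" "v \<in> span E"
  shows "v = (\<Sum>e\<in>E. ip e v *c e)"
proof -
  obtain f where f: "v = (\<Sum>e\<in>E. f e *c e)"
    using assms(3) unfolding span_finite[OF assms(1)] by auto
  have "ip e v = f e" if "e \<in> E" for e
    unfolding f by (rule ip_orthonormal_sum[OF assms(1,2) that])
  then show ?thesis using f by simp
qed

lemma orthonormal_independent:
  assumes "finite E" "orthonormal E"
  shows "independent E"
proof (subst independent_explicit_finite_subsets, intro allI impI ballI)
  fix A u v
  assume A: "A \<subseteq> E" "finite A" and 0: "(\<Sum>v\<in>A. u v *c v) = 0" and v: "v \<in> A"
  have "ip v (\<Sum>v\<in>A. u v *c v) = u v"
    by (rule ip_orthonormal_sum[OF A(2) orthonormal_subset[OF assms(2) A(1)] v])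
  then show "u v = 0" using 0 by simp
qed

text \<open>Gram-Schmidt with a prescribed start: \<open>E\<close> survives in the new basis, so
  that an orthonormal basis of one Specht copy can later be continued to the whole isotypic
  component.\<close>

lemma gram_schmidt_extend:
  assumes "finite B" "B \<subseteq> C" "finite E" "E \<subseteq> C" "orthonormal E"
  shows "\<exists>F. finite F \<and> E \<subseteq> F \<and> F \<subseteq> C \<and> orthonormal F \<and> span F = span (E \<union> B)"
  using assms(1,2)
proof (induction B rule: finite_induct)
  case empty
  then show ?case using assms by auto
next
  case (insert b B)
  then obtain F where F: "finite F" "E \<subseteq> F" "F \<subseteq> C" "orthonormal F" "span F = span (E \<union> B)"
    by auto
  define g where "g = (\<Sum>e\<in>F. ip e b *c e)"
  define r where "r = b - g"
  have gspan: "g \<in> span F" unfolding g_def by (intro span_sum span_scale span_base)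
  have gC: "g \<in> C" unfolding g_def using F(3)
    by (intro subspace_sum[OF subspace_carrier] subspace_scale[OF subspace_carrier]) auto
  have rC: "r \<in> C" unfolding r_def using insert.prems gC
    by (intro subspace_diff[OF subspace_carrier]) auto
  have orth: "ip e r = 0" if "e \<in> F" for e
    unfolding r_def g_def ip_minus_right ip_orthonormal_sum[OF F(1,4) that] by simp
  have sp: "span (E \<union> insert b B) = span (insert b F)"
    by (metis F(5) Un_insert_right span_insert)
  show ?case
  proof (cases "r = 0")
    case True
    then have "b \<in> span F" using gspan by (simp add: r_def)
    then have "span F = span (E \<union> insert b B)" unfolding sp by (simp add: span_redundant)
    then show ?thesis using F by blast
  next
    case False
    define k where "k = complex_of_real (sqrt (Re (ip r r)))"
    have ne: "ip r r \<noteq> 0" using ip_definite[OF rC] False by blast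
    have k2: "k * k = ip r r"
      unfolding k_def using ip_self_nonneg[of r] ip_self_real[of r]
      by (metis of_real_mult real_sqrt_mult_self abs_of_nonneg)
    have k0: "k \<noteq> 0" using k2 ne by auto
    have kr: "cnj k = k" by (simp add: k_def)
    define e' where "e' = inverse k *c r"
    have e'C: "e' \<in> C" unfolding e'_def by (rule subspace_scale[OF subspace_carrier rC])
    have e'1: "ip e' e' = 1"
      unfolding e'_def ip_scale_left ip_scale_right using k0 kr k2 ne
      by (simp add: field_simps)
    have e'0: "ip e e' = 0" if "e \<in> F" for e
      unfolding e'_def ip_scale_right using orth[OF that] by simp
    have e'0': "ip e' e = 0" if "e \<in> F" for e using e'0[OF that] ip_cnj[of e' e] by simp
    have on: "orthonormal (insert e' F)"
      unfolding orthonormal_def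
    proof (intro ballI)
      fix a c assume "a \<in> insert e' F" "c \<in> insert e' F"
      then show "ip a c = (if a = c then 1 else 0)"
        using e'1 e'0 e'0' orthonormalD[OF F(4)] by (cases "a = e'"; cases "c = e'") force+
    qed
    have b: "b = k *c e' + g" using k0 by (simp add: e'_def r_def)
    have "b \<in> span (insert e' F)"
      unfolding b using gspan span_mono[of F "insert e' F"]
      by (intro span_add span_scale) (auto intro: span_base)
    moreover have "e' \<in> span (insert b F)"
      unfolding e'_def r_def using gspan span_mono[of F "insert b F"]
      by (intro span_diff span_scale) (auto intro: span_base)
    ultimately have "span (insert e' F) = span (insert b F)"
      by (intro span_eq[THEN iffD2] conjI insert_subsetI) (auto intro: span_base)
    then show ?thesis
      using F on e'C sp by (intro exI[of _ "insert e' F"]) auto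
  qed
qed

lemma span_subset_carrier: "B \<subseteq> C \<Longrightarrow> span B \<subseteq> C"
  using subspace_carrier span_minimal by blast

lemma orthonormal_basis_extend:
  assumes S: "subspace S" "S \<subseteq> span B" "finite B" "B \<subseteq> C"
    and E: "E \<subseteq> S" "finite E" "orthonormal E"
  obtains F where "finite F" "E \<subseteq> F" "F \<subseteq> C" "orthonormal F" "span F = S" "card F = dim S"
proof -
  obtain B' where B': "B' \<subseteq> S" "independent B'" "S \<subseteq> span B'"
    using basis_exists[of S] by metis
  have "finite B'" using independent_span_bound[OF S(3) B'(2)] B'(1) S(2) by auto
  moreover have SC: "S \<subseteq> C" using S span_subset_carrier by blast
  ultimately obtain F where F: "finite F" "E \<subseteq> F" "F \<subseteq> C" "orthonormal F" "span F = span (E \<union> B')"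
    using gram_schmidt_extend[of B' E] B' E by blast
  have "span F = S"
    unfolding F(5) using B' E S(1)
    using span_minimal[OF _ S(1), of "E \<union> B'"] span_mono[of B' "E \<union> B'"] B' E by blast
  moreover from this have "card F = dim S"
    using orthonormal_independent[OF F(1,4)] dim_span_eq_card_independent by metis
  ultimately show ?thesis using F that by blast
qed

text \<open>\<open>orth_proj\<close> is a definite description, so uniqueness must be supplied: the
  difference of two candidates lies in \<open>S\<close> and is orthogonal to itself, hence zero by
  definiteness on \<open>C\<close>.\<close>

lemma orth_proj_eqI:
  assumes S: "subspace S" "S \<subseteq> C" and u: "u \<in> S" "\<And>s. s \<in> S \<Longrightarrow> ip s (v - u) = 0"
  shows "orth_proj ip S v = u"
  unfolding orth_proj_def
proof (rule the_equality)
  show "u \<in> S \<and> (\<forall>s\<in>S. ip s (v - u) = 0)" using u by blast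
  fix u' assume u': "u' \<in> S \<and> (\<forall>s\<in>S. ip s (v - u') = 0)"
  have uS: "u' - u \<in> S" using u u' subspace_diff[OF S(1)] by blast
  then have "ip (u' - u) (v - u) = 0" "ip (u' - u) (v - u') = 0" using u u' by blast+
  then have "ip (u' - u) (u' - u) = 0"
    using ip_minus_right[of "u' - u" "v - u" "v - u'"] by simp
  then have "u' - u = 0" using ip_definite uS S(2) by blast
  then show "u' = u" by simp
qed

lemma ip_residual_orthonormal:
  assumes "finite F" "orthonormal F" "s \<in> span F"
  shows "ip s (v - (\<Sum>e\<in>F. ip e v *c e)) = 0"
proof -
  let ?g = "\<Sum>e\<in>F. ip e v *c e"
  have F: "ip e (v - ?g) = 0" if "e \<in> F" for e
    unfolding ip_minus_right ip_orthonormal_sum[OF assms(1,2) that] by simp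
  have "ip (v - ?g) s = 0"
    using assms(3)
  proof (induction rule: span_induct_alt)
    case base
    then show ?case by simp
  next
    case (step c x y)
    then show ?case using F[of x] ip_cnj[of "v - ?g" x]
      by (simp add: ip_add_right ip_scale_right)
  qed
  then show ?thesis using ip_cnj[of s "v - ?g"] by simp
qed

lemma orth_proj_orthonormal:
  assumes "finite F" "orthonormal F" "F \<subseteq> C" "span F = S"
  shows "orth_proj ip S v = (\<Sum>e\<in>F. ip e v *c e)"
proof (rule orth_proj_eqI)
  show "subspace S" using assms(4) by auto
  show "S \<subseteq> C" using assms(3,4) span_subset_carrier by blast
  show "(\<Sum>e\<in>F. ip e v *c e) \<in> S"
    unfolding assms(4)[symmetric] by (intro span_sum span_scale span_base)
  show "ip s (v - (\<Sum>e\<in>F. ip e v *c e)) = 0" if "s \<in> S" for s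
    using ip_residual_orthonormal[OF assms(1,2)] that assms(4) by blast
qed

lemma orth_proj_linear_combination:
  assumes "finite F" "orthonormal F" "F \<subseteq> C" "span F = S"
  shows "orth_proj ip S (\<Sum>i\<in>I. a i *c v i) = (\<Sum>i\<in>I. a i *c orth_proj ip S (v i))"
proof -
  have "orth_proj ip S (\<Sum>i\<in>I. a i *c v i) = (\<Sum>e\<in>F. \<Sum>i\<in>I. (a i * ip e (v i)) *c e)"
    unfolding orth_proj_orthonormal[OF assms] ip_sum_right ip_scale_right scale_sum_left ..
  also have "\<dots> = (\<Sum>i\<in>I. \<Sum>e\<in>F. (a i * ip e (v i)) *c e)" by (rule sum.swap)
  also have "\<dots> = (\<Sum>i\<in>I. a i *c orth_proj ip S (v i))"
    unfolding orth_proj_orthonormal[OF assms] by (simp add: scale_sum_right)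
  finally show ?thesis .
qed

end

text \<open>With \<open>X\<close> the words of length \<open>n\<close> this is
  \<open>tensor_cinner\<close>; with \<open>X\<close> the words of a fixed content it is the inner
  product of the permutation module that contains the Specht module.\<close>

definition fun_cinner :: "'w set \<Rightarrow> ('w \<Rightarrow> complex) \<Rightarrow> ('w \<Rightarrow> complex) \<Rightarrow> complex" where
  "fun_cinner X u v = (\<Sum>w\<in>X. cnj (u w) * v w)"

definition funs_on :: "'w set \<Rightarrow> ('w \<Rightarrow> complex) set" where
  "funs_on X = {v. \<forall>w. w \<notin> X \<longrightarrow> v w = 0}"

lemma fun_cinner_inner_space:
  assumes "finite X"
  shows "complex_inner_space cscale (funs_on X) (fun_cinner X)"
proof
  show "cfun.subspace (funs_on X)"
    by (auto simp: cfun.subspace_def funs_on_def cscale_def)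
  show "fun_cinner X u (v + w) = fun_cinner X u v + fun_cinner X u w" for u v w
    by (simp add: fun_cinner_def algebra_simps sum.distrib)
  show "fun_cinner X u (cscale c v) = c * fun_cinner X u v" for u v c
    by (simp add: fun_cinner_def cscale_def sum_distrib_left algebra_simps)
  show "fun_cinner X v u = cnj (fun_cinner X u v)" for u v
    by (simp add: fun_cinner_def algebra_simps)
  have sq: "fun_cinner X v v = of_real (\<Sum>w\<in>X. (cmod (v w))\<^sup>2)" for v
    unfolding fun_cinner_def of_real_sum
    by (rule sum.cong) (simp_all only: mult.commute[of "cnj _"] complex_norm_square)
  show "0 \<le> Re (fun_cinner X v v)" for v
    unfolding sq by (simp add: sum_nonneg)
  show "v = 0" if "v \<in> funs_on X" "fun_cinner X v v = 0" for v
  proof -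
    have "(\<Sum>w\<in>X. (cmod (v w))\<^sup>2) = 0" using that(2) unfolding sq by (simp only: of_real_eq_0_iff)
    then have "\<forall>w\<in>X. v w = 0" using assms by (subst (asm) sum_nonneg_eq_0_iff) auto
    then show ?thesis using that(1) by (auto simp: funs_on_def fun_eq_iff)
  qed
qed

global_interpretation vec_inner: complex_inner_space "(*s)" UNIV "vec_cinner :: complex ^ 'a::finite \<Rightarrow> _"
proof
  interpret f: complex_inner_space cscale "funs_on UNIV" "fun_cinner (UNIV :: 'a set)"
    by (rule fun_cinner_inner_space) simp
  have eq: "vec_cinner u v = fun_cinner UNIV (($) u) (($) v)" for u v :: "complex ^ 'a"
    by (simp add: vec_cinner_def fun_cinner_def)
  show "vec.subspace (UNIV :: (complex ^ 'a) set)" by simp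
  show "vec_cinner u (v + w) = vec_cinner u v + vec_cinner u w" for u v w :: "complex ^ 'a"
    by (simp add: vec_cinner_def algebra_simps sum.distrib)
  show "vec_cinner u (c *s v) = c * vec_cinner u v" for u v :: "complex ^ 'a" and c
    by (simp add: vec_cinner_def algebra_simps sum_distrib_left)
  show "vec_cinner v u = cnj (vec_cinner u v)" for u v :: "complex ^ 'a"
    unfolding eq by (rule f.ip_cnj)
  show "0 \<le> Re (vec_cinner v v)" for v :: "complex ^ 'a"
    unfolding eq by (rule f.ip_self_nonneg)
  show "v = 0" if "vec_cinner v v = 0" for v :: "complex ^ 'a"
    using f.ip_definite[of "($) v"] that unfolding eq
    by (auto simp: funs_on_def fun_eq_iff vec_eq_iff)
qed

section \<open>Spectral data of the reduced state\<close>

definition hermitian :: "complex ^ 'a ^ 'a::finite \<Rightarrow> bool" where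
  "hermitian A \<longleftrightarrow> (\<forall>a b. A $ a $ b = cnj (A $ b $ a))"

lemma hermitian_cinner:
  assumes "hermitian A"
  shows "vec_cinner (A *v u) v = vec_cinner u (A *v v)"
proof -
  have h: "cnj (A $ i $ j) = A $ j $ i" for i j
    using assms unfolding hermitian_def by (metis complex_cnj_cnj)
  have "vec_cinner (A *v u) v = (\<Sum>i\<in>UNIV. \<Sum>j\<in>UNIV. cnj (A $ i $ j) * cnj (u $ j) * v $ i)"
    by (simp add: vec_cinner_def matrix_vector_mult_def sum_distrib_right)
  also have "\<dots> = (\<Sum>j\<in>UNIV. \<Sum>i\<in>UNIV. cnj (A $ i $ j) * cnj (u $ j) * v $ i)"
    by (rule sum.swap)
  also have "\<dots> = vec_cinner u (A *v v)"
    unfolding vec_cinner_def matrix_vector_mult_def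
    by (auto simp: h sum_distrib_left algebra_simps intro!: sum.cong)
  finally show ?thesis .
qed

lemma subspace_eigenspace: "vec.subspace (eigenspace A x)"
  unfolding vec.subspace_def eigenspace_def
  by (auto simp: matrix_vector_right_distrib vec.scale vec.scale_right_distrib mult.commute
      vector_smult_assoc)

lemma eigenspace_orthonormal_basis:
  obtains F where "finite F" "vec_inner.orthonormal F" "vec.span F = eigenspace A x"
    "card F = vec.dim (eigenspace A x)" "F \<subseteq> eigenspace A x"
proof -
  obtain F where F: "finite F" "vec_inner.orthonormal F" "vec.span F = eigenspace A x"
    "card F = vec.dim (eigenspace A x)"
    using vec_inner.orthonormal_basis_extend[OF subspace_eigenspace, of A x cart_basis "{}"]
    by (auto simp: finite_cart_basis vec_inner.orthonormal_def)
  moreover have "F \<subseteq> eigenspace A x" using F(3) vec.span_superset by blast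
  ultimately show ?thesis using that by blast
qed

text \<open>\<open>eigenvalue_vector\<close> already forces the eigenspace dimensions to add up to
  \<open>CARD('a)\<close>. Orthonormal bases of the eigenspaces, distributed over the indices
  carrying each value, thus give a full family, and hermiticity makes different eigenspaces
  orthogonal.\<close>

lemma hermitian_eigenbasis:
  fixes A :: "complex ^ 'a ^ 'a::finite"
  assumes p: "eigenvalue_vector A p" and A: "hermitian A"
  obtains u where
    "\<And>i j. i < CARD('a) \<Longrightarrow> j < CARD('a) \<Longrightarrow> vec_cinner (u i) (u j) = (if i = j then 1 else 0)"
    "\<And>i. i < CARD('a) \<Longrightarrow> A *v u i = complex_of_real (p i) *s u i"
proof -
  let ?I = "\<lambda>x. {i. i < CARD('a) \<and> p i = x}"
  have "\<forall>x. \<exists>F. finite F \<and> vec_inner.orthonormal F \<and> F \<subseteq> eigenspace A x \<and>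
      card F = vec.dim (eigenspace A x)"
    using eigenspace_orthonormal_basis by metis
  then obtain F where F: "\<And>x. finite (F x)" "\<And>x. vec_inner.orthonormal (F x)"
    "\<And>x. F x \<subseteq> eigenspace A x" "\<And>x. card (F x) = vec.dim (eigenspace A x)"
    by metis
  have "\<forall>x. \<exists>h. bij_betw h (?I x) (F x)"
    using p F unfolding eigenvalue_vector_def by (auto intro!: finite_same_card_bij)
  then obtain h where h: "\<And>x. bij_betw (h x) (?I x) (F x)" by metis
  define u where "u i = h (p i) i" for i
  have uF: "u i \<in> F (p i)" if "i < CARD('a)" for i
    using h[of "p i"] that unfolding u_def bij_betw_def by auto
  have eig: "A *v u i = complex_of_real (p i) *s u i" if "i < CARD('a)" for i
    using uF[OF that] F(3) unfolding eigenspace_def by blast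
  have "vec_cinner (u i) (u j) = (if i = j then 1 else 0)"
    if ij: "i < CARD('a)" "j < CARD('a)" for i j
  proof (cases "p i = p j")
    case True
    then have "u i = u j \<longleftrightarrow> i = j"
      using h[of "p i"] ij unfolding u_def bij_betw_def by (auto dest: inj_onD)
    then show ?thesis
      using vec_inner.orthonormalD[OF F(2), of "u i" "p i" "u j"] uF[OF ij(1)] uF[OF ij(2)] True by auto
  next
    case False
    have "complex_of_real (p i) * vec_cinner (u i) (u j) = vec_cinner (A *v u i) (u j)"
      using eig ij by (simp add: vec_inner.ip_scale_left)
    also have "\<dots> = complex_of_real (p j) * vec_cinner (u i) (u j)"
      unfolding hermitian_cinner[OF A] using eig ij by (simp add: vec_inner.ip_scale_right)
    finally show ?thesis using False by auto
  qed
  then show ?thesis using eig that by blast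
qed

lemma orthonormal_family_complete:
  fixes u :: "nat \<Rightarrow> complex ^ 'a::finite"
  assumes "\<And>i j. i < CARD('a) \<Longrightarrow> j < CARD('a) \<Longrightarrow> vec_cinner (u i) (u j) = (if i = j then 1 else 0)"
  shows "v = (\<Sum>i<CARD('a). vec_cinner (u i) v *s u i)"
proof -
  let ?E = "u ` {..<CARD('a)}"
  have inj: "inj_on u {..<CARD('a)}"
    using assms by (intro inj_onI) (metis lessThan_iff zero_neq_one)
  have on: "vec_inner.orthonormal ?E"
    using assms inj unfolding vec_inner.orthonormal_def by (auto dest: inj_onD)
  have "card ?E = CARD('a)" using inj by (simp add: card_image)
  moreover have "vec.dim (UNIV :: (complex ^ 'a) set) = CARD('a)" by (rule vec_dim_card)
  ultimately have "UNIV \<subseteq> vec.span ?E"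
    using vec_inner.orthonormal_independent[OF _ on]
    by (intro vec.card_ge_dim_independent) (auto simp del: vec_dim_card)
  then have "v = (\<Sum>e\<in>?E. vec_cinner e v *s e)"
    by (intro vec_inner.orthonormal_expansion[OF _ on]) auto
  then show ?thesis using inj by (simp add: sum.reindex)
qed

lemma trace_matrix_orth_proj:
  assumes "finite F" "vec_inner.orthonormal F" "vec.span F = S"
  shows "trace (matrix (orth_proj vec_cinner S)) = of_nat (card F)"
proof -
  have "trace (matrix (orth_proj vec_cinner S)) =
      (\<Sum>a\<in>UNIV. \<Sum>e\<in>F. cnj (e $ a) * e $ a)"
    unfolding trace_def matrix_def vec_inner.orth_proj_orthonormal[OF assms(1,2) subset_UNIV assms(3)]
    by (simp add: vec_cinner_def axis_def if_distrib cong: if_cong)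
  also have "\<dots> = (\<Sum>e\<in>F. \<Sum>a\<in>UNIV. cnj (e $ a) * e $ a)" by (rule sum.swap)
  also have "\<dots> = (\<Sum>e\<in>F. 1)"
    by (rule sum.cong) (use vec_inner.orthonormalD[OF assms(2)] in \<open>auto simp: vec_cinner_def\<close>)
  finally show ?thesis by simp
qed

lemma eigenspace_nontrivial:
  fixes A :: "complex ^ 'a ^ 'a::finite"
  assumes "eigenvalue_vector A p"
  shows "{x. eigenspace A x \<noteq> {0}} = p ` {..<CARD('a)}"
proof -
  have "eigenspace A x \<noteq> {0} \<longleftrightarrow> x \<in> p ` {..<CARD('a)}" for x
  proof -
    have "0 \<in> eigenspace A x" using subspace_eigenspace vec.subspace_0 by blast
    then have "eigenspace A x \<noteq> {0} \<longleftrightarrow> vec.dim (eigenspace A x) \<noteq> 0"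
      by (subst vec.dim_eq_0) auto
    also have "\<dots> \<longleftrightarrow> {i. i < CARD('a) \<and> p i = x} \<noteq> {}"
    proof -
      have "vec.dim (eigenspace A x) = card {i. i < CARD('a) \<and> p i = x}"
        using assms unfolding eigenvalue_vector_def by simp
      then show ?thesis by simp
    qed
    finally show ?thesis by auto
  qed
  then show ?thesis by blast
qed

text \<open>Bridge between the functional calculus, which runs over distinct eigenvalues, and sums
  over the list \<open>p\<close>, which repeats them.\<close>

lemma sum_over_values:
  fixes f :: "real \<Rightarrow> 'b::comm_semiring_1" and p :: "nat \<Rightarrow> real"
  shows "(\<Sum>x\<in>p ` {..<d}. f x * of_nat (card {i. i < d \<and> p i = x})) = (\<Sum>i<d. f (p i))"
proof -
  have "(\<Sum>i<d. f (p i)) = (\<Sum>x\<in>p ` {..<d}. \<Sum>i | i \<in> {..<d} \<and> p i = x. f (p i))"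
    by (rule sum.image_gen) simp
  also have "\<dots> = (\<Sum>x\<in>p ` {..<d}. f x * of_nat (card {i. i < d \<and> p i = x}))"
    by (rule sum.cong) (simp_all add: mult.commute)
  finally show ?thesis by simp
qed

lemma trace_eigenspace_proj:
  fixes A :: "complex ^ 'a ^ 'a::finite"
  assumes "eigenvalue_vector A p"
  shows "trace (matrix (orth_proj vec_cinner (eigenspace A x))) =
    of_nat (card {i. i < CARD('a) \<and> p i = x})"
proof -
  obtain F where F: "finite F" "vec_inner.orthonormal F" "vec.span F = eigenspace A x"
    "card F = vec.dim (eigenspace A x)"
    by (rule eigenspace_orthonormal_basis)
  then show ?thesis
    using assms unfolding trace_matrix_orth_proj[OF F(1-3)] F(4) eigenvalue_vector_def by simp
qed

lemma trace_scaleR: "trace (c *\<^sub>R M) = c *\<^sub>R trace M" for M :: "complex ^ 'a ^ 'a::finite"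
  by (simp add: trace_def scaleR_sum_right)

lemma trace_sum: "trace (\<Sum>i\<in>I. M i) = (\<Sum>i\<in>I. trace (M i))" for M :: "_ \<Rightarrow> complex ^ 'a ^ 'a::finite"
  by (induction I rule: infinite_finite_induct) (auto simp: trace_def sum.distrib)

lemma trace_matrix_fun:
  fixes A :: "complex ^ 'a ^ 'a::finite"
  assumes "eigenvalue_vector A p"
  shows "trace (matrix_fun f A) = of_real (\<Sum>i<CARD('a). f (p i))"
proof -
  have "trace (matrix_fun f A) =
      (\<Sum>x\<in>p ` {..<CARD('a)}. of_real (f x) * of_nat (card {i. i < CARD('a) \<and> p i = x}))"
    unfolding matrix_fun_def trace_sum trace_scaleR eigenspace_nontrivial[OF assms]
      trace_eigenspace_proj[OF assms] by (simp add: scaleR_conv_of_real)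
  then show ?thesis by (simp add: sum_over_values)
qed

lemma trace_mult_matrix_fun:
  fixes A :: "complex ^ 'a ^ 'a::finite"
  assumes "eigenvalue_vector A p"
  shows "trace (A ** matrix_fun f A) = of_real (\<Sum>i<CARD('a). p i * f (p i))"
proof -
  have proj: "trace (A ** matrix (orth_proj vec_cinner (eigenspace A x))) =
      of_real x * trace (matrix (orth_proj vec_cinner (eigenspace A x)))" for x
  proof -
    obtain F where F: "finite F" "vec_inner.orthonormal F" "vec.span F = eigenspace A x"
      by (rule eigenspace_orthonormal_basis)
    let ?P = "orth_proj vec_cinner (eigenspace A x)"
    have "?P v \<in> eigenspace A x" for v
      unfolding vec_inner.orth_proj_orthonormal[OF F(1,2) subset_UNIV F(3)]
      unfolding F(3)[symmetric] by (intro vec.span_sum vec.span_scale vec.span_base)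
    then have *: "A *v ?P v = of_real x *s ?P v" for v
      by (simp add: eigenspace_def)
    have "trace (A ** matrix ?P) = (\<Sum>a\<in>UNIV. (A *v ?P (axis a 1)) $ a)"
      by (simp add: trace_def matrix_matrix_mult_def matrix_def matrix_vector_mult_def)
    also have "\<dots> = of_real x * trace (matrix ?P)"
      unfolding * by (simp add: trace_def matrix_def sum_distrib_left)
    finally show ?thesis .
  qed
  have lin: "A ** (\<Sum>i\<in>I. g i *\<^sub>R M i) = (\<Sum>i\<in>I. g i *\<^sub>R (A ** M i))"
    for I and g :: "real \<Rightarrow> real" and M :: "real \<Rightarrow> complex ^ 'a ^ 'a"
  proof -
    have "(A ** (\<Sum>i\<in>I. g i *\<^sub>R M i)) $ a $ b =
        (\<Sum>k\<in>UNIV. \<Sum>i\<in>I. g i *\<^sub>R (A $ a $ k * M i $ k $ b))" for a b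
      by (simp add: matrix_matrix_mult_def sum_distrib_left)
    also have "\<dots> a b = (\<Sum>i\<in>I. g i *\<^sub>R (A ** M i)) $ a $ b" for a b
      by (subst sum.swap) (simp add: matrix_matrix_mult_def scaleR_sum_right)
    finally show ?thesis by (simp add: vec_eq_iff)
  qed
  have "trace (A ** matrix_fun f A) =
      (\<Sum>x\<in>p ` {..<CARD('a)}. of_real (x * f x) * of_nat (card {i. i < CARD('a) \<and> p i = x}))"
    unfolding matrix_fun_def lin trace_sum trace_scaleR eigenspace_nontrivial[OF assms] proj
      trace_eigenspace_proj[OF assms] by (simp add: scaleR_conv_of_real mult.assoc mult.left_commute)
  then show ?thesis by (simp add: sum_over_values)
qed

lemma vn_entropy_eq_shannon:
  "eigenvalue_vector \<rho> p \<Longrightarrow> vn_entropy \<rho> = shannon_entropy CARD('a) p"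
  for \<rho> :: "complex ^ 'a ^ 'a::finite"
  by (simp add: vn_entropy_def shannon_entropy_def trace_mult_matrix_fun)

lemma log_trace_power_eq:
  "eigenvalue_vector \<rho> p \<Longrightarrow> log_trace_power \<rho> s = log 2 (\<Sum>i<CARD('a). p i powr s)"
  for \<rho> :: "complex ^ 'a ^ 'a::finite"
  by (simp add: log_trace_power_def trace_matrix_fun)

lemma hermitian_reduced_state: "hermitian (reduced_state \<phi>)"
  by (simp add: hermitian_def reduced_state_def mult.commute)

lemma reduced_state_cinner_nonneg: "0 \<le> Re (vec_cinner v (reduced_state \<phi> *v v))"
proof -
  have "vec_cinner v (reduced_state \<phi> *v v) =
      (\<Sum>i\<in>UNIV. \<Sum>i'\<in>UNIV. \<Sum>j\<in>UNIV. cnj (v $ i) * \<phi> $ (i, j) * (cnj (\<phi> $ (i', j)) * v $ i'))"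
    by (simp add: vec_cinner_def matrix_vector_mult_def reduced_state_def sum_distrib_left
        sum_distrib_right algebra_simps)
  also have "\<dots> = (\<Sum>i\<in>UNIV. \<Sum>j\<in>UNIV. \<Sum>i'\<in>UNIV. cnj (v $ i) * \<phi> $ (i, j) * (cnj (\<phi> $ (i', j)) * v $ i'))"
    by (rule sum.cong[OF refl], rule sum.swap)
  also have "\<dots> = (\<Sum>j\<in>UNIV. \<Sum>i\<in>UNIV. \<Sum>i'\<in>UNIV. cnj (v $ i) * \<phi> $ (i, j) * (cnj (\<phi> $ (i', j)) * v $ i'))"
    by (rule sum.swap)
  also have "\<dots> = (\<Sum>j\<in>UNIV. (\<Sum>i\<in>UNIV. cnj (v $ i) * \<phi> $ (i, j)) * cnj (\<Sum>i\<in>UNIV. cnj (v $ i) * \<phi> $ (i, j)))"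
    by (simp add: sum_product mult.commute) (rule sum.cong[OF refl], rule sum.swap)
  also have "\<dots> = of_real (\<Sum>j\<in>UNIV. (cmod (\<Sum>i\<in>UNIV. cnj (v $ i) * \<phi> $ (i, j)))\<^sup>2)"
    by (simp only: complex_norm_square of_real_sum)
  finally show ?thesis by (simp add: sum_nonneg)
qed

lemma trace_reduced_state: "trace (reduced_state \<phi>) = of_real ((norm \<phi>)\<^sup>2)"
proof -
  have "trace (reduced_state \<phi>) = (\<Sum>i\<in>UNIV. \<Sum>j\<in>UNIV. \<phi> $ (i, j) * cnj (\<phi> $ (i, j)))"
    by (simp add: trace_def reduced_state_def)
  also have "\<dots> = (\<Sum>x\<in>UNIV. \<phi> $ x * cnj (\<phi> $ x))"
    by (simp add: sum.cartesian_product)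
  also have "\<dots> = of_real (\<Sum>x\<in>UNIV. (cmod (\<phi> $ x))\<^sup>2)"
    by (simp only: complex_norm_square of_real_sum)
  also have "(\<Sum>x\<in>UNIV. (cmod (\<phi> $ x))\<^sup>2) = (norm \<phi>)\<^sup>2"
    by (simp add: norm_vec_def L2_set_def sum_nonneg)
  finally show ?thesis .
qed

text \<open>The first two conclusions are the assumptions of \<open>unitary_frame\<close>; the third
  is the form in which the state enters the kernel of its tensor power.\<close>

lemma spectral_decomposition:
  fixes \<rho> :: "complex ^ 'a ^ 'a::finite"
  assumes p: "eigenvalue_vector \<rho> p" and h: "hermitian \<rho>"
  obtains u :: "nat \<Rightarrow> complex ^ 'a" where
    "\<And>i j. i < CARD('a) \<Longrightarrow> j < CARD('a) \<Longrightarrow> (\<Sum>a\<in>UNIV. cnj (u i $ a) * u j $ a) = (if i = j then 1 else 0)"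
    "\<And>a b. (\<Sum>i<CARD('a). u i $ a * cnj (u i $ b)) = (if a = b then 1 else 0)"
    "\<And>a b. (\<Sum>i<CARD('a). of_real (p i) * (u i $ a * cnj (u i $ b))) = \<rho> $ a $ b"
    "\<And>i. i < CARD('a) \<Longrightarrow> \<rho> *v u i = complex_of_real (p i) *s u i"
proof -
  obtain u where u:
    "\<And>i j. i < CARD('a) \<Longrightarrow> j < CARD('a) \<Longrightarrow> vec_cinner (u i) (u j) = (if i = j then 1 else 0)"
    "\<And>i. i < CARD('a) \<Longrightarrow> \<rho> *v u i = complex_of_real (p i) *s u i"
    by (rule hermitian_eigenbasis[OF p h]) blast
  have ip: "vec_cinner (u i) (axis b 1) = cnj (u i $ b)" for i b
    by (simp add: vec_cinner_def axis_def if_distrib cong: if_cong)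
  have ax: "axis b 1 = (\<Sum>i<CARD('a). cnj (u i $ b) *s u i)" for b
    using orthonormal_family_complete[of u "axis b 1"] u(1) unfolding ip by blast
  have 2: "(\<Sum>i<CARD('a). u i $ a * cnj (u i $ b)) = (if a = b then 1 else 0)" for a b
    using arg_cong[OF ax[of b], of "\<lambda>v. v $ a"] by (simp add: axis_def mult.commute)
  have *: "\<rho> *v axis b 1 = (\<Sum>i<CARD('a). (cnj (u i $ b) * of_real (p i)) *s u i)" for b
    by (subst ax) (simp add: vec.sum vec.scale u(2) vector_smult_assoc)
  have 3: "(\<Sum>i<CARD('a). of_real (p i) * (u i $ a * cnj (u i $ b))) = \<rho> $ a $ b" for a b
  proof -
    have "\<rho> $ a $ b = (\<rho> *v axis b 1) $ a"
      by (simp add: matrix_vector_mult_def axis_def if_distrib cong: if_cong)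
    then show ?thesis using * [of b] by (simp add: algebra_simps)
  qed
  show ?thesis using that[of u] u(1) 2 3 u(2) unfolding vec_cinner_def by blast
qed

lemma prob_vector_eigenvalues:
  fixes \<phi> :: "complex ^ ('a::finite \<times> 'b::finite)"
  assumes p: "eigenvalue_vector (reduced_state \<phi>) p" and n: "norm \<phi> = 1"
  shows "prob_vector CARD('a) p"
proof -
  let ?\<rho> = "reduced_state \<phi>"
  obtain u where u:
    "\<And>i j. i < CARD('a) \<Longrightarrow> j < CARD('a) \<Longrightarrow> (\<Sum>a\<in>UNIV. cnj (u i $ a) * u j $ a) = (if i = j then 1 else 0)"
    "\<And>a b. (\<Sum>i<CARD('a). u i $ a * cnj (u i $ b)) = (if a = b then 1 else 0)"
    "\<And>a b. (\<Sum>i<CARD('a). of_real (p i) * (u i $ a * cnj (u i $ b))) = ?\<rho> $ a $ b"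
    "\<And>i. i < CARD('a) \<Longrightarrow> ?\<rho> *v u i = complex_of_real (p i) *s u i"
    by (rule spectral_decomposition[OF p hermitian_reduced_state]) blast
  have "0 \<le> p i" if "i < CARD('a)" for i
  proof -
    have "vec_cinner (u i) (?\<rho> *v u i) = of_real (p i)"
      using u(1)[OF that that] unfolding u(4)[OF that] vec_inner.ip_scale_right
      by (simp add: vec_cinner_def)
    then show ?thesis using reduced_state_cinner_nonneg[of "u i" \<phi>] by simp
  qed
  moreover have "(\<Sum>i<CARD('a). p i) = 1"
  proof -
    have "complex_of_real (\<Sum>i<CARD('a). p i) = (\<Sum>i<CARD('a). of_real (p i) * (\<Sum>a\<in>UNIV. cnj (u i $ a) * u i $ a))"
      using u(1) by simp
    also have "\<dots> = (\<Sum>a\<in>UNIV. \<Sum>i<CARD('a). of_real (p i) * (u i $ a * cnj (u i $ a)))"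
      by (subst sum.swap) (simp add: sum_distrib_left mult.commute)
    also have "\<dots> = trace ?\<rho>" unfolding u(3) by (simp add: trace_def)
    finally show ?thesis using n unfolding trace_reduced_state by (metis of_real_eq_iff one_power2)
  qed
  ultimately show ?thesis by (simp add: prob_vector_def)
qed

text \<open>The excluded rate is stated through \<open>rank\<close>, while the entropy analysis
  counts positive eigenvalues; this identifies the two numbers.\<close>

lemma rank_eq_card_nonzero:
  fixes \<rho> :: "complex ^ 'a ^ 'a::finite"
  assumes p: "eigenvalue_vector \<rho> p" and h: "hermitian \<rho>"
  shows "rank \<rho> = card {i. i < CARD('a) \<and> p i \<noteq> 0}"
proof -
  obtain u where u:
    "\<And>i j. i < CARD('a) \<Longrightarrow> j < CARD('a) \<Longrightarrow> (\<Sum>a\<in>UNIV. cnj (u i $ a) * u j $ a) = (if i = j then 1 else 0)"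
    "\<And>a b. (\<Sum>i<CARD('a). u i $ a * cnj (u i $ b)) = (if a = b then 1 else 0)"
    "\<And>a b. (\<Sum>i<CARD('a). of_real (p i) * (u i $ a * cnj (u i $ b))) = \<rho> $ a $ b"
    "\<And>i. i < CARD('a) \<Longrightarrow> \<rho> *v u i = complex_of_real (p i) *s u i"
    by (rule spectral_decomposition[OF p h]) blast
  let ?I = "{i. i < CARD('a) \<and> p i \<noteq> 0}"
  \<comment> \<open>Row \<open>a\<close> of \<rho> is the sum of \<open>p i * u i $ a\<close> times
    the conjugate of \<open>u i\<close>, so the row space is spanned by the conjugated eigenvectors
    with nonzero eigenvalue.\<close>
  define v :: "nat \<Rightarrow> complex ^ 'a" where "v i = (\<chi> b. cnj (u i $ b))" for i
  have vip: "vec_cinner (v i) (v j) = (if i = j then 1 else 0)" if "i \<in> ?I" "j \<in> ?I" for i j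
    using u(1)[of j i] that by (auto simp: vec_cinner_def v_def mult.commute)
  have inj: "inj_on v ?I"
  proof (intro inj_onI, rule ccontr)
    fix i j assume "i \<in> ?I" "j \<in> ?I" "v i = v j" "i \<noteq> j"
    then show False using vip[of i j] vip[of i i] by simp
  qed
  have on: "vec_inner.orthonormal (v ` ?I)"
    unfolding vec_inner.orthonormal_def using vip inj by (auto dest: inj_onD)
  have row: "row a \<rho> = (\<Sum>i\<in>?I. (of_real (p i) * u i $ a) *s v i)" for a
  proof -
    have "row a \<rho> $ b = (\<Sum>i\<in>?I. (of_real (p i) * u i $ a) *s v i) $ b" for b
      unfolding row_def u(3)[symmetric]
      by (simp add: v_def mult.assoc) (rule sum.mono_neutral_right, auto)
    then show ?thesis by (simp add: vec_eq_iff)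
  qed
  have v: "of_real (p i) *s v i = (\<Sum>a\<in>UNIV. cnj (u i $ a) *s row a \<rho>)" if i: "i < CARD('a)" for i
  proof -
    have "(\<Sum>a\<in>UNIV. cnj (u i $ a) *s row a \<rho>) $ b =
        (\<Sum>j<CARD('a). of_real (p j) * cnj (u j $ b) * (\<Sum>a\<in>UNIV. cnj (u i $ a) * u j $ a))" for b
      unfolding row_def
      by (simp add: u(3)[symmetric] sum_distrib_left) (subst sum.swap, simp add: algebra_simps)
    also have "\<dots> b = of_real (p i) * cnj (u i $ b)" for b
      using i by (simp add: u(1) if_distrib cong: if_cong sum.cong_simp)
    finally show ?thesis by (simp add: vec_eq_iff v_def)
  qed
  have "row a \<rho> \<in> vec.span (v ` ?I)" for a
    unfolding row by (intro vec.span_sum vec.span_scale vec.span_base imageI)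
  then have "rows \<rho> \<subseteq> vec.span (v ` ?I)"
    unfolding rows_def by blast
  moreover have "v i \<in> vec.span (rows \<rho>)" if "i \<in> ?I" for i
  proof -
    have "(\<Sum>a\<in>UNIV. cnj (u i $ a) *s row a \<rho>) \<in> vec.span (rows \<rho>)"
      unfolding rows_def by (intro vec.span_sum vec.span_scale vec.span_base) auto
    then have "complex_of_real (p i) *s v i \<in> vec.span (rows \<rho>)"
      using v[of i] that by simp
    from vec.span_scale[OF this, of "inverse (complex_of_real (p i))"]
    show ?thesis using that by (simp add: vector_smult_assoc)
  qed
  ultimately have "vec.span (rows \<rho>) = vec.span (v ` ?I)"
    by (intro vec.span_eq[THEN iffD2]) auto
  then have "vec.dim (rows \<rho>) = vec.dim (v ` ?I)" using vec.span_eq_dim by blast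
  also have "\<dots> = card (v ` ?I)"
    using vec_inner.orthonormal_independent[OF _ on] by (simp add: vec.dim_eq_card_independent)
  also have "\<dots> = card ?I" using inj by (rule card_image)
  finally show ?thesis by (simp add: row_rank_def_gen)
qed

section \<open>Words of prescribed content\<close>

definition shape_content :: "nat list \<Rightarrow> nat multiset" where
  "shape_content ns = (\<Sum>i<length ns. replicate_mset (ns ! i) i)"

lemma count_shape_content: "count (shape_content ns) i = (if i < length ns then ns ! i else 0)"
  by (auto simp: shape_content_def count_sum)

lemma set_shape_content: "set_mset (shape_content ns) \<subseteq> {..<length ns}"
proof
  fix i assume "i \<in># shape_content ns"
  then have "count (shape_content ns) i > 0" by simp
  then show "i \<in> {..<length ns}" by (auto simp: count_shape_content split: if_splits)
qed

lemma size_shape_content: "size (shape_content ns) = sum_list ns"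
proof -
  have "size (\<Sum>i\<in>I. f i) = (\<Sum>i\<in>I. size (f i))" for I and f :: "nat \<Rightarrow> nat multiset"
    by (induction I rule: infinite_finite_induct) auto
  then show ?thesis
    by (simp add: shape_content_def sum_list_sum_nth atLeast0LessThan)
qed

text \<open>Read as tabloids, these words carry the permutation module around the Specht module.
  Read as index words of an eigenbasis, they name the eigenvectors of the tensor power with
  eigenvalue \<open>\<Prod>i. p i ^ (ns ! i)\<close>. The embedding of the Specht module rests on
  this double reading.\<close>

abbreviation shape_words :: "nat list \<Rightarrow> nat list set" where
  "shape_words ns \<equiv> permutations_of_multiset (shape_content ns)"

lemma shape_words_iff: "w \<in> shape_words ns \<longleftrightarrow> mset w = shape_content ns"
  by (simp add: permutations_of_multiset_def)

lemma length_shape_word: "w \<in> shape_words ns \<Longrightarrow> length w = sum_list ns"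
  by (metis shape_words_iff size_mset size_shape_content)

lemma count_shape_word:
  "w \<in> shape_words ns \<Longrightarrow> count_list w i = (if i < length ns then ns ! i else 0)"
  by (metis count_mset count_shape_content shape_words_iff)

lemma set_shape_word: "w \<in> shape_words ns \<Longrightarrow> set w \<subseteq> {..<length ns}"
  by (metis shape_words_iff set_mset_mset set_shape_content)

lemma tensor_space_eq_funs_on: "tensor_space n = funs_on (words n)"
  by (simp add: tensor_space_def funs_on_def)

lemma funs_on_mono: "X \<subseteq> Y \<Longrightarrow> funs_on X \<subseteq> funs_on Y"
  by (auto simp: funs_on_def)

lemma subspace_funs_on: "cfun.subspace (funs_on X)"
  by (auto simp: cfun.subspace_def funs_on_def cscale_def)

lemma shape_funs_tensor_space: "funs_on (shape_words ns) \<subseteq> tensor_space (sum_list ns)"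
  unfolding tensor_space_eq_funs_on by (rule funs_on_mono) (auto simp: words_def length_shape_word)

lemma funs_on_expansion:
  assumes "finite X" "v \<in> funs_on X"
  shows "v = (\<Sum>x\<in>X. cscale (v x) (basis_vec x))"
proof
  fix w
  have "(\<Sum>x\<in>X. cscale (v x) (basis_vec x)) w = (\<Sum>x\<in>X. v x * basis_vec x w)"
    by (induction X rule: infinite_finite_induct) (auto simp: cscale_def)
  also have "\<dots> = (\<Sum>x\<in>X. if w = x then v w else 0)"
    by (rule sum.cong) (auto simp: basis_vec_def)
  also have "\<dots> = v w" using assms by (auto simp: funs_on_def)
  finally show "v w = (\<Sum>x\<in>X. cscale (v x) (basis_vec x)) w" by simp
qed

lemma funs_on_span: "finite X \<Longrightarrow> funs_on X \<subseteq> cfun.span (basis_vec ` X)"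
proof
  fix v assume X: "finite X" "v \<in> funs_on X"
  show "v \<in> cfun.span (basis_vec ` X)"
    by (subst funs_on_expansion[OF X]) (intro cfun.span_sum cfun.span_scale cfun.span_base imageI)
qed

lemma basis_vec_funs_on: "w \<in> X \<Longrightarrow> basis_vec w \<in> funs_on X"
  by (auto simp: basis_vec_def funs_on_def)

section \<open>The permutation action on words and polytabloids\<close>

lemma perm_act_add: "perm_act \<pi> (u + v) = perm_act \<pi> u + perm_act \<pi> v"
  by (simp add: perm_act_def fun_eq_iff)

lemma perm_act_cscale: "perm_act \<pi> (cscale c v) = cscale c (perm_act \<pi> v)"
  by (simp add: perm_act_def cscale_def)

lemma perm_act_zero: "perm_act \<pi> 0 = 0"
  by (simp add: perm_act_def fun_eq_iff)

lemma perm_act_sum: "perm_act \<pi> (\<Sum>i\<in>I. g i) = (\<Sum>i\<in>I. perm_act \<pi> (g i))"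
  by (induction I rule: infinite_finite_induct)
    (simp_all only: sum.infinite sum.empty sum.insert perm_act_add perm_act_zero not_False_eq_True)

lemma perm_act_id: "perm_act id v = v"
  by (simp add: perm_act_def)

text \<open>\<open>permute_list\<close> composes correctly only for permutations of the positions of
  the word at hand; for words of any other length both sides vanish because \<open>v\<close>
  does.\<close>

lemma perm_act_compose:
  assumes "v \<in> tensor_space n" "\<sigma> permutes {..<n}"
  shows "perm_act \<pi> (perm_act \<sigma> v) = perm_act (\<pi> \<circ> \<sigma>) v"
proof
  fix w :: "'a list"
  show "perm_act \<pi> (perm_act \<sigma> v) w = perm_act (\<pi> \<circ> \<sigma>) v w"
  proof (cases "length w = n")
    case True
    then show ?thesis
      unfolding perm_act_def using permute_list_compose[of \<sigma> w \<pi>] assms(2) by simp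
  next
    case False
    then show ?thesis using assms(1) by (simp add: perm_act_def tensor_space_def words_def)
  qed
qed

lemma permute_list_inv:
  assumes "\<pi> permutes {..<length w}"
  shows "permute_list (inv \<pi>) (permute_list \<pi> w) = w" "permute_list \<pi> (permute_list (inv \<pi>) w) = w"
proof -
  have i: "inv \<pi> permutes {..<length w}" using assms by (rule permutes_inv)
  show "permute_list (inv \<pi>) (permute_list \<pi> w) = w"
    using permute_list_compose[OF i, of \<pi>] permutes_inv_o(1)[OF assms] by simp
  show "permute_list \<pi> (permute_list (inv \<pi>) w) = w"
    using permute_list_compose[OF assms, of "inv \<pi>"] permutes_inv_o(2)[OF assms] by simp
qed

lemma perm_act_basis_vec:
  assumes "\<pi> permutes {..<length w}"
  shows "perm_act \<pi> (basis_vec w) = basis_vec (permute_list (inv \<pi>) w)"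
proof
  fix w' :: "'a list"
  show "perm_act \<pi> (basis_vec w) w' = basis_vec (permute_list (inv \<pi>) w) w'"
    unfolding perm_act_def basis_vec_def
    using permute_list_inv[of \<pi> w] permute_list_inv[of \<pi> w'] assms
    by (metis length_permute_list)
qed

lemma perm_act_funs_on_mset:
  assumes "\<pi> permutes {..<sum_list ns}" "v \<in> funs_on (shape_words ns)"
  shows "perm_act \<pi> v \<in> funs_on (shape_words ns)"
  unfolding funs_on_def perm_act_def
proof (safe)
  fix w assume w: "w \<notin> shape_words ns"
  have "permute_list \<pi> w \<notin> shape_words ns"
    using w assms(1) mset_permute_list[of \<pi> w] length_shape_word[of "permute_list \<pi> w" ns]
    by (auto simp: shape_words_iff)
  then show "v (permute_list \<pi> w) = 0" using assms(2) by (auto simp: funs_on_def)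
qed

lemma column_group_compose:
  assumes "\<pi> \<in> column_group n t" "\<sigma> \<in> column_group n t"
  shows "\<pi> \<circ> \<sigma> \<in> column_group n t"
  using assms permutes_in_image[of \<sigma> "{..<n}"]
  by (auto simp: column_group_def permutes_compose)

lemma column_group_inv:
  assumes "\<pi> \<in> column_group n t"
  shows "inv \<pi> \<in> column_group n t"
proof -
  have p: "\<pi> permutes {..<n}" using assms by (simp add: column_group_def)
  have "snd (t (inv \<pi> k)) = snd (t k)" if "k < n" for k
  proof -
    have "inv \<pi> k < n" using permutes_in_image[OF permutes_inv[OF p]] that by auto
    then have "snd (t (\<pi> (inv \<pi> k))) = snd (t (inv \<pi> k))"
      using assms by (simp add: column_group_def)
    then show ?thesis using permutes_inverses(1)[OF p] by simp
  qed
  then show ?thesis using permutes_inv[OF p] by (simp add: column_group_def)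
qed

lemma finite_column_group: "finite (column_group n t)"
  by (rule finite_subset[OF _ finite_permutations[of "{..<n}"]]) (auto simp: column_group_def)

lemma length_tabloid [simp]: "length (tabloid n t) = n"
  by (simp add: tabloid_def)

lemma tabloid_tensor_space: "basis_vec (tabloid n t) \<in> tensor_space n"
  by (auto simp: tensor_space_def basis_vec_def words_def)

lemma sign_permutes_compose:
  "\<pi> permutes {..<n} \<Longrightarrow> \<sigma> permutes {..<n} \<Longrightarrow> sign (\<pi> \<circ> \<sigma>) = sign \<pi> * sign \<sigma>"
  for n :: nat
  by (rule sign_compose) (auto simp: permutation_permutes)

lemma sign_permutes_inv: "\<pi> permutes {..<n} \<Longrightarrow> sign (inv \<pi>) = sign \<pi>" for n :: nat
  by (rule sign_inverse) (auto simp: permutation_permutes)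

text \<open>Left translation by \<pi> permutes the column group and multiplies every sign by
  \<open>sign \<pi>\<close>. This property passes through any equivariant linear map, so it
  constrains all copies of the Specht module in the tensor power.\<close>

lemma polytabloid_column_antisymmetric:
  assumes "\<pi> \<in> column_group n t"
  shows "perm_act \<pi> (polytabloid n t) = cscale (of_int (sign \<pi>)) (polytabloid n t)"
proof -
  let ?b = "basis_vec (tabloid n t) :: nat list \<Rightarrow> complex"
  have p: "\<pi> permutes {..<n}" using assms by (simp add: column_group_def)
  have bij: "bij_betw ((\<circ>) \<pi>) (column_group n t) (column_group n t)"
  proof (rule bij_betw_byWitness[where f' = "(\<circ>) (inv \<pi>)"])
    show "\<forall>\<sigma>\<in>column_group n t. inv \<pi> \<circ> (\<pi> \<circ> \<sigma>) = \<sigma>"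
      using permutes_inv_o[OF p] by (simp add: o_assoc)
    show "\<forall>\<sigma>\<in>column_group n t. \<pi> \<circ> (inv \<pi> \<circ> \<sigma>) = \<sigma>"
      using permutes_inv_o[OF p] by (simp add: o_assoc)
    show "(\<circ>) \<pi> ` column_group n t \<subseteq> column_group n t"
      using column_group_compose[OF assms] by blast
    show "(\<circ>) (inv \<pi>) ` column_group n t \<subseteq> column_group n t"
      using column_group_compose[OF column_group_inv[OF assms]] by blast
  qed
  have "perm_act \<pi> (polytabloid n t) =
      (\<Sum>\<sigma>\<in>column_group n t. cscale (of_int (sign \<sigma>)) (perm_act (\<pi> \<circ> \<sigma>) ?b))"
    unfolding polytabloid_def perm_act_sum perm_act_cscale
    by (intro sum.cong refl arg_cong2[of _ _ _ _ cscale] perm_act_compose[OF tabloid_tensor_space])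
      (simp add: column_group_def)
  also have "\<dots> = (\<Sum>\<sigma>\<in>column_group n t.
      cscale (of_int (sign \<pi>) * of_int (sign (\<pi> \<circ> \<sigma>))) (perm_act (\<pi> \<circ> \<sigma>) ?b))"
  proof (intro sum.cong refl arg_cong2[of _ _ _ _ cscale])
    fix \<sigma> assume "\<sigma> \<in> column_group n t"
    then have "sign (\<pi> \<circ> \<sigma>) = sign \<pi> * sign \<sigma>"
      by (intro sign_permutes_compose[OF p]) (simp add: column_group_def)
    \<comment> \<open>Signs are their own inverses, so the factor \<open>sign \<pi>\<close> can
      change sides.\<close>
    then have "sign \<sigma> = sign \<pi> * sign (\<pi> \<circ> \<sigma>)" by simp
    then show "(of_int (sign \<sigma>) :: complex) = of_int (sign \<pi>) * of_int (sign (\<pi> \<circ> \<sigma>))"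
      by (metis of_int_mult)
  qed
  also have "\<dots> = (\<Sum>\<tau>\<in>column_group n t.
      cscale (of_int (sign \<pi>) * of_int (sign \<tau>)) (perm_act \<tau> ?b))"
    by (rule sum.reindex_bij_betw[OF bij])
  also have "\<dots> = cscale (of_int (sign \<pi>)) (polytabloid n t)"
    by (simp add: polytabloid_def cfun.scale_sum_right)
  finally show ?thesis .
qed

lemma tabloid_permute:
  assumes "\<sigma> permutes {..<n}"
  shows "permute_list (inv \<sigma>) (tabloid n t) = tabloid n (t \<circ> inv \<sigma>)"
proof (rule nth_equalityI)
  fix i assume "i < length (permute_list (inv \<sigma>) (tabloid n t))"
  then have i: "i < n" by simp
  have "inv \<sigma> i < n" using permutes_in_image[OF permutes_inv[OF assms]] i by auto
  then show "permute_list (inv \<sigma>) (tabloid n t) ! i = tabloid n (t \<circ> inv \<sigma>) ! i"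
    using i permutes_inv[OF assms] by (simp add: permute_list_nth tabloid_def)
qed simp

lemma column_group_conj:
  assumes s: "\<sigma> permutes {..<n}" and "\<pi> \<in> column_group n t"
  shows "\<sigma> \<circ> \<pi> \<circ> inv \<sigma> \<in> column_group n (t \<circ> inv \<sigma>)"
proof -
  have p: "\<pi> permutes {..<n}" "\<And>k. k < n \<Longrightarrow> snd (t (\<pi> k)) = snd (t k)"
    using assms(2) by (auto simp: column_group_def)
  have "inv \<sigma> k < n" if "k < n" for k
    using permutes_in_image[OF permutes_inv[OF s]] that by auto
  then show ?thesis
    using p permutes_inverses[OF s] by (auto simp: column_group_def permutes_compose permutes_inv s)
qed

text \<open>Relabelling the points conjugates the column group and preserves signs. Hence the
  polytabloids are permuted among themselves and their span is invariant.\<close>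

lemma perm_act_polytabloid:
  assumes s: "\<sigma> permutes {..<n}"
  shows "perm_act \<sigma> (polytabloid n t) = polytabloid n (t \<circ> inv \<sigma>)"
proof -
  let ?b = "basis_vec (tabloid n t) :: nat list \<Rightarrow> complex"
  let ?h = "\<lambda>\<pi>. \<sigma> \<circ> \<pi> \<circ> inv \<sigma>"
  have inv: "inv (inv \<sigma>) = \<sigma>" by (rule permutes_inv_inv[OF s])
  have o: "\<sigma> \<circ> inv \<sigma> = id" "inv \<sigma> \<circ> \<sigma> = id" using permutes_inv_o[OF s] by auto
  have a: "inv \<sigma> \<circ> (\<sigma> \<circ> \<pi> \<circ> inv \<sigma>) \<circ> \<sigma> = \<pi>" for \<pi>
    unfolding comp_assoc o(2) unfolding comp_assoc[symmetric] o(2) by simp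
  have b: "\<sigma> \<circ> (inv \<sigma> \<circ> \<pi> \<circ> \<sigma>) \<circ> inv \<sigma> = \<pi>" for \<pi>
    unfolding comp_assoc o(1) unfolding comp_assoc[symmetric] o(1) by simp
  have bij: "bij_betw ?h (column_group n t) (column_group n (t \<circ> inv \<sigma>))"
  proof (rule bij_betw_byWitness[where f' = "\<lambda>\<pi>. inv \<sigma> \<circ> \<pi> \<circ> \<sigma>"])
    show "\<forall>\<pi>\<in>column_group n t. inv \<sigma> \<circ> (\<sigma> \<circ> \<pi> \<circ> inv \<sigma>) \<circ> \<sigma> = \<pi>" using a by blast
    show "\<forall>\<pi>\<in>column_group n (t \<circ> inv \<sigma>). \<sigma> \<circ> (inv \<sigma> \<circ> \<pi> \<circ> \<sigma>) \<circ> inv \<sigma> = \<pi>" using b by blast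
    show "?h ` column_group n t \<subseteq> column_group n (t \<circ> inv \<sigma>)"
      using column_group_conj[OF s] by blast
    show "(\<lambda>\<pi>. inv \<sigma> \<circ> \<pi> \<circ> \<sigma>) ` column_group n (t \<circ> inv \<sigma>) \<subseteq> column_group n t"
      using column_group_conj[OF permutes_inv[OF s], of _ "t \<circ> inv \<sigma>"]
      by (auto simp: inv comp_assoc o(2))
  qed
  have "polytabloid n (t \<circ> inv \<sigma>) = (\<Sum>\<pi>\<in>column_group n t.
      cscale (of_int (sign (?h \<pi>))) (perm_act (?h \<pi>) (basis_vec (tabloid n (t \<circ> inv \<sigma>)))))"
    unfolding polytabloid_def by (rule sum.reindex_bij_betw[OF bij, symmetric])
  also have "\<dots> = (\<Sum>\<pi>\<in>column_group n t. cscale (of_int (sign \<pi>)) (perm_act \<sigma> (perm_act \<pi> ?b)))"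
  proof (intro sum.cong refl arg_cong2[of _ _ _ _ cscale])
    fix \<pi> assume "\<pi> \<in> column_group n t"
    then have p: "\<pi> permutes {..<n}" by (simp add: column_group_def)
    have "sign (?h \<pi>) = sign \<sigma> * sign \<pi> * sign \<sigma>"
      using s p by (simp add: sign_permutes_compose[of _ n] permutes_compose permutes_inv sign_permutes_inv[of _ n])
    then have "sign (?h \<pi>) = sign \<pi>" by (simp add: mult.commute mult.left_commute)
    then show "(of_int (sign (?h \<pi>)) :: complex) = of_int (sign \<pi>)" by simp
    have "basis_vec (tabloid n (t \<circ> inv \<sigma>)) = perm_act \<sigma> ?b"
      using perm_act_basis_vec[of \<sigma> "tabloid n t"] s by (simp add: tabloid_permute)
    then have "perm_act (?h \<pi>) (basis_vec (tabloid n (t \<circ> inv \<sigma>))) = perm_act (?h \<pi> \<circ> \<sigma>) ?b"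
      using perm_act_compose[OF tabloid_tensor_space s] by simp
    also have "?h \<pi> \<circ> \<sigma> = \<sigma> \<circ> \<pi>" by (simp add: comp_assoc o)
    also have "perm_act (\<sigma> \<circ> \<pi>) ?b = perm_act \<sigma> (perm_act \<pi> ?b)"
      by (rule perm_act_compose[OF tabloid_tensor_space p, symmetric])
    finally show "perm_act (?h \<pi>) (basis_vec (tabloid n (t \<circ> inv \<sigma>))) = perm_act \<sigma> (perm_act \<pi> ?b)" .
  qed
  also have "\<dots> = perm_act \<sigma> (polytabloid n t)"
    by (simp add: polytabloid_def perm_act_sum perm_act_cscale)
  finally show ?thesis by simp
qed

lemma tableau_permute:
  assumes "t \<in> tableaux ns" "\<sigma> permutes {..<sum_list ns}"
  shows "t \<circ> \<sigma> \<in> tableaux ns"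
  using assms bij_betw_trans[OF permutes_imp_bij] by (auto simp: tableaux_def)

lemma finite_young_cells: "finite (young_cells ns)"
  and card_young_cells: "card (young_cells ns) = sum_list ns"
proof -
  have eq: "young_cells ns = (SIGMA i:{..<length ns}. {..<ns ! i})"
    by (auto simp: young_cells_def)
  show "finite (young_cells ns)" unfolding eq by auto
  show "card (young_cells ns) = sum_list ns"
    unfolding eq by (simp add: sum_list_sum_nth atLeast0LessThan)
qed

lemma tabloid_shape_word:
  assumes "t \<in> tableaux ns"
  shows "tabloid (sum_list ns) t \<in> shape_words ns"
proof -
  let ?n = "sum_list ns"
  have t: "bij_betw t {..<?n} (young_cells ns)" using assms by (simp add: tableaux_def)
  have "count (mset (tabloid ?n t)) i = count (shape_content ns) i" for i
  proof -
    have "mset (tabloid ?n t) = image_mset (fst \<circ> t) (mset_set {..<?n})"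
      by (simp add: tabloid_def comp_def atLeast0LessThan)
    then have "count (mset (tabloid ?n t)) i = card {k\<in>{..<?n}. fst (t k) = i}"
      by (simp add: count_image_mset vimage_def Int_def conj_commute)
    also have "\<dots> = card (t ` {k\<in>{..<?n}. fst (t k) = i})"
      using t by (intro card_image[symmetric] inj_on_subset[OF bij_betw_imp_inj_on]) auto
    also have "t ` {k\<in>{..<?n}. fst (t k) = i} = {c\<in>young_cells ns. fst c = i}"
    proof -
      have "young_cells ns = t ` {..<?n}" using t by (simp add: bij_betw_def)
      then show ?thesis by auto
    qed
    also have "\<dots> = (if i < length ns then Pair i ` {..<ns ! i} else {})"
      by (auto simp: young_cells_def)
    also have "card \<dots> = count (shape_content ns) i"
      by (auto simp: count_shape_content card_image inj_on_def)
    finally show ?thesis .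
  qed
  then show ?thesis by (simp add: shape_words_iff multiset_eq_iff)
qed

lemma polytabloid_shape_funs:
  assumes "t \<in> tableaux ns"
  shows "polytabloid (sum_list ns) t \<in> funs_on (shape_words ns)"
  unfolding polytabloid_def
proof (intro cfun.subspace_sum[OF subspace_funs_on] cfun.subspace_scale[OF subspace_funs_on])
  fix \<pi> assume "\<pi> \<in> column_group (sum_list ns) t"
  then show "perm_act \<pi> (basis_vec (tabloid (sum_list ns) t)) \<in> funs_on (shape_words ns)"
    by (intro perm_act_funs_on_mset basis_vec_funs_on tabloid_shape_word assms)
      (simp add: column_group_def)
qed

lemma specht_module_shape_funs: "specht_module ns \<subseteq> funs_on (shape_words ns)"
  unfolding specht_module_def
  using polytabloid_shape_funs by (intro cfun.span_minimal subspace_funs_on) auto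

lemma subspace_specht_module: "cfun.subspace (specht_module ns)"
  by (simp add: specht_module_def)

lemma perm_act_specht_module:
  assumes "\<sigma> permutes {..<sum_list ns}" "v \<in> specht_module ns"
  shows "perm_act \<sigma> v \<in> specht_module ns"
  using assms(2) unfolding specht_module_def
proof (induction rule: cfun.span_induct_alt)
  case base
  then show ?case by (simp only: perm_act_zero cfun.span_zero)
next
  case (step c x y)
  then obtain t where t: "t \<in> tableaux ns" "x = polytabloid (sum_list ns) t" by auto
  have "perm_act \<sigma> x \<in> polytabloid (sum_list ns) ` tableaux ns"
    unfolding t(2) perm_act_polytabloid[OF assms(1)]
    using tableau_permute[OF t(1) permutes_inv[OF assms(1)]] by blast
  then show ?case unfolding perm_act_add perm_act_cscale
    by (rule cfun.span_add[OF cfun.span_scale[OF cfun.span_base] step(2)])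
qed

lemma dim_specht_le: "cfun.dim (specht_module ns) \<le> card (shape_words ns)"
proof -
  have "specht_module ns \<subseteq> cfun.span (basis_vec ` shape_words ns)"
    using specht_module_shape_funs funs_on_span[of "shape_words ns"] by auto
  then have "cfun.dim (specht_module ns) \<le> card (basis_vec ` shape_words ns :: (nat list \<Rightarrow> complex) set)"
    by (intro cfun.dim_le_card) auto
  also have "\<dots> \<le> card (shape_words ns)" by (rule card_image_le) simp
  finally show ?thesis .
qed

section \<open>Standard polytabloids\<close>

text \<open>Ballot (Yamanouchi) words encode standard Young tableaux: letter \<open>k\<close> is the
  row of entry \<open>k\<close>, and the prefix condition says that the cells filled so far always
  form a Young diagram.\<close>

definition ballot :: "nat list \<Rightarrow> bool" where
  "ballot w \<longleftrightarrow> (\<forall>k i. count_list (take k w) (Suc i) \<le> count_list (take k w) i)"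

text \<open>Rows are filled in order of position, so they increase by construction; the ballot
  condition is what makes the columns increase as well.\<close>

definition word_tableau :: "nat list \<Rightarrow> nat \<Rightarrow> nat \<times> nat" where
  "word_tableau w k = (w ! k, count_list (take k w) (w ! k))"

lemma ballot_chain:
  assumes "ballot w" "i \<le> j"
  shows "count_list (take k w) j \<le> count_list (take k w) i"
  using assms(2) by (induction rule: dec_induct) (use assms(1) in \<open>auto simp: ballot_def intro: order_trans\<close>)

lemma count_take_mono: "a \<le> b \<Longrightarrow> count_list (take a w) i \<le> count_list (take b w) i"
  by (metis count_list_append le_add1 take_add le_add_diff_inverse)

lemma count_take_le: "count_list (take a w) i \<le> count_list w i"
  by (metis append_take_drop_id count_list_append le_add1)

lemma count_take_Suc_nth: "k < length w \<Longrightarrow> count_list (take (Suc k) w) (w ! k) = Suc (count_list (take k w) (w ! k))"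
  by (simp add: take_Suc_conv_app_nth)

text \<open>Let \<open>c\<close> be the common column. Once \<open>b\<close> is placed, the prefix
  contains \<open>c + 1\<close> letters \<open>w ! b\<close>, hence at least \<open>c + 1\<close>
  letters \<open>w ! a\<close> of the higher row. But before position \<open>a\<close> there are
  only \<open>c\<close> of them, so \<open>a\<close> must come first.\<close>

lemma word_tableau_column_increasing:
  assumes "ballot w" "a < length w" "b < length w"
    and "snd (word_tableau w a) = snd (word_tableau w b)" "w ! a < w ! b"
  shows "a < b"
proof (rule ccontr)
  assume "\<not> a < b"
  then have "Suc b \<le> a" using assms(5) by (cases "a = b") auto
  have "Suc (snd (word_tableau w b)) = count_list (take (Suc b) w) (w ! b)"
    using assms(3) by (simp add: word_tableau_def count_take_Suc_nth)
  also have "\<dots> \<le> count_list (take (Suc b) w) (w ! a)"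
    using ballot_chain[OF assms(1)] assms(5) by simp
  also have "\<dots> \<le> count_list (take a w) (w ! a)" by (rule count_take_mono) fact
  finally show False using assms(4) by (simp add: word_tableau_def)
qed

lemma inj_word_tableau: "inj_on (word_tableau w) {..<length w}"
proof (rule inj_onI)
  have *: False if "a < b" "b < length w" "word_tableau w a = word_tableau w b" for a b
  proof -
    have "count_list (take a w) (w ! a) < count_list (take (Suc a) w) (w ! a)"
      using that by (simp add: count_take_Suc_nth)
    also have "\<dots> \<le> count_list (take b w) (w ! a)" using that by (intro count_take_mono) simp
    finally show False using that(3) unfolding word_tableau_def prod.inject by (metis less_irrefl)
  qed
  fix a b assume "a \<in> {..<length w}" "b \<in> {..<length w}" "word_tableau w a = word_tableau w b"
  then show "a = b" using *[of a b] *[of b a] by (metis lessThan_iff linorder_neqE_nat)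
qed

lemma word_tableau_tableaux:
  assumes "w \<in> shape_words ns"
  shows "word_tableau w \<in> tableaux ns"
proof -
  have l: "length w = sum_list ns" by (rule length_shape_word[OF assms])
  have "word_tableau w ` {..<length w} \<subseteq> young_cells ns"
  proof
    fix c assume "c \<in> word_tableau w ` {..<length w}"
    then obtain k where k: "k < length w" "c = word_tableau w k" by auto
    have "Suc (count_list (take k w) (w ! k)) \<le> count_list w (w ! k)"
      using count_take_Suc_nth[OF k(1)] count_take_le by metis
    moreover have "w ! k < length ns" using set_shape_word[OF assms] k(1) nth_mem by blast
    ultimately show "c \<in> young_cells ns"
      using count_shape_word[OF assms] k(2) by (auto simp: young_cells_def word_tableau_def)
  qed
  moreover have "card (word_tableau w ` {..<length w}) = card (young_cells ns)"
    using card_image[OF inj_word_tableau, of w] card_young_cells[of ns] l by simp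
  ultimately have "word_tableau w ` {..<length w} = young_cells ns"
    using finite_young_cells card_subset_eq by blast
  then show ?thesis using inj_word_tableau[of w] l by (auto simp: tableaux_def bij_betw_def)
qed

lemma tabloid_word_tableau: "tabloid (length w) (word_tableau w) = w"
  by (rule nth_equalityI) (auto simp: tabloid_def word_tableau_def)

lemma polytabloid_apply:
  "polytabloid n t w = (\<Sum>\<pi>\<in>column_group n t. of_int (sign \<pi>) * (if permute_list \<pi> w = tabloid n t then 1 else 0))"
proof -
  have "(\<Sum>i\<in>I. g i) w = (\<Sum>i\<in>I. g i w)" for I and g :: "_ \<Rightarrow> nat list \<Rightarrow> complex"
    by (induction I rule: infinite_finite_induct) auto
  then show ?thesis
    by (simp add: polytabloid_def cscale_def perm_act_def basis_vec_def)
qed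

text \<open>
  Since the entries of \<^term>\<open>word_tableau w\<close> increase down the columns, the least point moved by a
  column permutation moves to a lower row, so \<open>w\<close> is the lexicographically least word in its
  polytabloid. Hence these polytabloids are linearly independent.
\<close>

lemma column_permutation_lex:
  assumes w: "ballot w" and p: "\<pi> \<in> column_group (length w) (word_tableau w)" "\<pi> \<noteq> id"
    and w': "permute_list \<pi> w' = w"
  shows "(w, w') \<in> lex less_than"
proof -
  let ?n = "length w" and ?t = "word_tableau w"
  define \<tau> where "\<tau> = inv \<pi>"
  have pp: "\<pi> permutes {..<?n}" using p by (simp add: column_group_def)
  have tau: "\<tau> \<in> column_group ?n ?t" unfolding \<tau>_def by (rule column_group_inv[OF p(1)])
  have tp: "\<tau> permutes {..<?n}" using tau by (simp add: column_group_def)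
  have l: "length w' = ?n" using w' by auto
  have w'n: "w' ! k = w ! \<tau> k" if "k < ?n" for k
  proof -
    have "w' = permute_list \<tau> w" using permute_list_inv(1)[of \<pi> w'] pp l w' by (simp add: \<tau>_def)
    then show ?thesis using permute_list_nth[OF tp that] by simp
  qed
  have "\<tau> \<noteq> id"
  proof
    assume "\<tau> = id"
    then have "\<pi> = id" unfolding \<tau>_def using permutes_inv_inv[OF pp] by (metis inv_id)
    then show False using p(2) by simp
  qed
  then have ex: "\<exists>k. \<tau> k \<noteq> k" by (auto simp: fun_eq_iff)
  define k where "k = (LEAST k. \<tau> k \<noteq> k)"
  have k: "\<tau> k \<noteq> k" unfolding k_def by (rule LeastI_ex[OF ex])
  have least: "\<tau> j = j" if "j < k" for j using not_less_Least[OF that[unfolded k_def]] by blast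
  have kn: "k < ?n" using k tp by (meson lessThan_iff permutes_not_in)
  have tk: "\<tau> k < ?n" using permutes_in_image[OF tp] kn by auto
  \<comment> \<open>A smaller image would be a fixed point of \<tau>, contradicting
    injectivity.\<close>
  have "k < \<tau> k"
  proof (rule ccontr)
    assume "\<not> k < \<tau> k"
    then have "\<tau> (\<tau> k) = \<tau> k" using least k by simp
    then show False using permutes_inj[OF tp] k by (auto dest: injD)
  qed
  have col: "snd (?t (\<tau> k)) = snd (?t k)" using tau kn by (simp add: column_group_def)
  have "w ! k \<noteq> w ! \<tau> k"
  proof
    assume "w ! k = w ! \<tau> k"
    then have "?t (\<tau> k) = ?t k" using col by (simp add: word_tableau_def)
    then show False using inj_word_tableau[of w] kn tk k by (auto dest: inj_onD)
  qed
  moreover have "\<not> w ! \<tau> k < w ! k"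
    using word_tableau_column_increasing[OF w tk kn col] \<open>k < \<tau> k\<close> by auto
  ultimately have lt: "w ! k < w' ! k" using w'n[OF kn] by simp
  have "take k w = take k w'"
    by (rule nth_equalityI) (use l kn w'n least in auto)
  then have "w = take k w @ w ! k # drop (Suc k) w" "w' = take k w @ w' ! k # drop (Suc k) w'"
    using id_take_nth_drop kn l by metis+
  then show ?thesis unfolding lex_conv using lt l by auto
qed

text \<open>The matrix \<open>e w w'\<close> over ballot words is unitriangular for the
  lexicographic order: the diagonal is 1 because only the identity keeps \<open>w\<close> in place,
  and other entries can be nonzero only for larger \<open>w'\<close>.\<close>

lemma card_ballot_le_dim_specht:
  "card {w \<in> shape_words ns. ballot w} \<le> cfun.dim (specht_module ns)"
proof -
  let ?n = "sum_list ns"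
  let ?S = "{w \<in> shape_words ns. ballot w}"
  define e where "e w = polytabloid ?n (word_tableau w)" for w
  have len: "length w = ?n" if "w \<in> ?S" for w using that length_shape_word by blast
  have id: "id \<in> column_group ?n t" for t by (simp add: column_group_def permutes_id)
  have lex: "e w w' \<noteq> 0 \<Longrightarrow> w' = w \<or> (w, w') \<in> lex less_than" if w: "w \<in> ?S" for w w'
  proof -
    assume "e w w' \<noteq> 0"
    then obtain \<pi> where "\<pi> \<in> column_group ?n (word_tableau w)"
      "of_int (sign \<pi>) * (if permute_list \<pi> w' = tabloid ?n (word_tableau w) then 1 else 0) \<noteq> (0 :: complex)"
      unfolding e_def polytabloid_apply by (rule sum.not_neutral_contains_not_neutral)
    then have \<pi>: "\<pi> \<in> column_group ?n (word_tableau w)" "permute_list \<pi> w' = w"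
      using tabloid_word_tableau[of w] len[OF w] by (auto split: if_splits)
    then show ?thesis
      using column_permutation_lex[of w \<pi> w'] w len[OF w] by (cases "\<pi> = id") auto
  qed
  have diag: "e w w = 1" if w: "w \<in> ?S" for w
  proof -
    have "e w w = (\<Sum>\<pi>\<in>{id}. of_int (sign \<pi>) * (if permute_list \<pi> w = tabloid ?n (word_tableau w) then 1 else 0))"
      unfolding e_def polytabloid_apply
    proof (intro sum.mono_neutral_right finite_column_group ballI)
      show "{id} \<subseteq> column_group ?n (word_tableau w)" using id by blast
      fix \<pi> assume "\<pi> \<in> column_group ?n (word_tableau w) - {id}"
      then have "permute_list \<pi> w \<noteq> w"
        using column_permutation_lex[of w \<pi> w] w len[OF w] wf_irrefl[OF wf_lex[OF wf_less_than]]
        by auto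
      then show "of_int (sign \<pi>) * (if permute_list \<pi> w = tabloid ?n (word_tableau w) then 1 else 0) = (0 :: complex)"
        using tabloid_word_tableau[of w] len[OF w] by simp
    qed
    then show ?thesis using tabloid_word_tableau[of w] len[OF w] by simp
  qed
  have ne: "e w \<noteq> e w'" if "w \<in> ?S" "w' \<in> ?S" "w \<noteq> w'" for w w'
  proof
    assume eq: "e w = e w'"
    then have "(w, w') \<in> lex less_than" "(w', w) \<in> lex less_than"
      using lex[OF that(1), of w'] lex[OF that(2), of w] diag[OF that(1)] diag[OF that(2)] that(3)
      by auto
    then show False using wf_not_sym[OF wf_lex[OF wf_less_than]] by blast
  qed
  then have inj: "inj_on e ?S" by (intro inj_onI) blast
  have ind: "cfun.independent (e ` ?S)"
  proof (subst cfun.independent_explicit_finite_subsets, intro allI impI ballI)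
    fix A c v
    assume A: "A \<subseteq> e ` ?S" "finite A" and 0: "(\<Sum>v\<in>A. cscale (c v) v) = 0" and v: "v \<in> A"
    show "c v = 0"
    proof (rule ccontr)
      assume cv: "c v \<noteq> 0"
      define B where "B = {w \<in> ?S. e w \<in> A \<and> c (e w) \<noteq> 0}"
      have "B \<noteq> {}" using A v cv unfolding B_def by blast
      \<comment> \<open>Evaluation at the least word with nonzero coefficient kills every other
        term, since a polytabloid that does not vanish there belongs to a smaller word.\<close>
      then obtain w where w: "w \<in> B" and min: "\<And>y. (y, w) \<in> lex less_than \<Longrightarrow> y \<notin> B"
        using wf_eq_minimal[of "lex less_than"] wf_lex[OF wf_less_than] by (metis ex_in_conv)
      have "0 = (\<Sum>v\<in>A. cscale (c v) v) w" using 0 by simp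
      also have "\<dots> = (\<Sum>v\<in>A. c v * v w)"
        using A(2) by (induction A rule: finite_induct) (auto simp: cscale_def)
      also have "\<dots> = (\<Sum>v\<in>{e w}. c v * v w)"
      proof (intro sum.mono_neutral_right A ballI)
        show "{e w} \<subseteq> A" using w by (auto simp: B_def)
        fix v assume v: "v \<in> A - {e w}"
        then obtain w' where w': "w' \<in> ?S" "v = e w'" "w' \<noteq> w" using A by blast
        show "c v * v w = 0"
        proof (rule ccontr)
          assume "c v * v w \<noteq> 0"
          then have "(w', w) \<in> lex less_than" "w' \<in> B"
            using lex[OF w'(1), of w] w' v by (auto simp: B_def)
          then show False using min by blast
        qed
      qed
      also have "\<dots> = c (e w)" using diag w by (simp add: B_def)
      finally show False using w by (simp add: B_def)
    qed
  qed
  have sub: "e ` ?S \<subseteq> specht_module ns"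
    unfolding e_def specht_module_def using word_tableau_tableaux by (auto intro!: cfun.span_base)
  obtain B where B: "B \<subseteq> specht_module ns" "cfun.independent B" "specht_module ns \<subseteq> cfun.span B"
    "card B = cfun.dim (specht_module ns)"
    using cfun.basis_exists by blast
  have "finite B"
    using cfun.independent_span_bound[OF _ B(2), of "basis_vec ` shape_words ns"]
      B(1) specht_module_shape_funs funs_on_span[of "shape_words ns"] by auto
  then have "card (e ` ?S) \<le> card B"
    using cfun.independent_span_bound[OF _ ind, of B] sub B(3) by auto
  then show ?thesis using B(4) card_image[OF inj] by simp
qed

section \<open>Counting words and standard tableaux\<close>

text \<open>Distributivity written over words. It gives the multinomial theorem, the orthonormality
  of product vectors and the spectral form of the tensor power.\<close>

lemma sum_words_prod:
  fixes g :: "nat \<Rightarrow> 'a \<Rightarrow> 'b::comm_semiring_1"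
  assumes "finite A"
  shows "(\<Sum>w | set w \<subseteq> A \<and> length w = n. \<Prod>k<n. g k (w ! k)) = (\<Prod>k<n. \<Sum>a\<in>A. g k a)"
proof (induction n arbitrary: g)
  case 0
  have "{w. set w \<subseteq> A \<and> length w = 0} = {[]}" by auto
  then show ?case by simp
next
  case (Suc n)
  let ?W = "{w. set w \<subseteq> A \<and> length w = n}"
  have inj: "inj_on (\<lambda>(w, a). a # w) (?W \<times> A)" by (auto simp: inj_on_def)
  have "(\<Sum>w | set w \<subseteq> A \<and> length w = Suc n. \<Prod>k<Suc n. g k (w ! k)) =
      (\<Sum>(w, a)\<in>?W \<times> A. \<Prod>k<Suc n. g k ((a # w) ! k))"
    unfolding lists_length_Suc_eq sum.reindex[OF inj]
    by (rule sum.cong) (auto simp del: prod.lessThan_Suc)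
  also have "\<dots> = (\<Sum>(w, a)\<in>?W \<times> A. (\<Prod>k<n. g (Suc k) (w ! k)) * g 0 a)"
    by (rule sum.cong) (auto simp: prod.lessThan_Suc_shift mult.commute simp del: prod.lessThan_Suc)
  also have "\<dots> = (\<Sum>w\<in>?W. \<Prod>k<n. g (Suc k) (w ! k)) * (\<Sum>a\<in>A. g 0 a)"
    by (simp add: sum_product sum.cartesian_product)
  also have "\<dots> = (\<Prod>k<Suc n. \<Sum>a\<in>A. g k a)"
    unfolding Suc.IH[of "\<lambda>k. g (Suc k)"] by (simp add: prod.lessThan_Suc_shift mult.commute del: prod.lessThan_Suc)
  finally show ?case .
qed

lemma prod_letters_eq_prod_counts:
  fixes x :: "nat \<Rightarrow> 'b::comm_semiring_1"
  assumes "set w \<subseteq> {..<d}"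
  shows "(\<Prod>k<length w. x (w ! k)) = (\<Prod>i<d. x i ^ count_list w i)"
  using assms
proof (induction w)
  case (Cons a w)
  have "(\<Prod>i<d. x i ^ count_list (a # w) i) = (\<Prod>i<d. (if i = a then x a else 1) * x i ^ count_list w i)"
    by (rule prod.cong) auto
  also have "\<dots> = x a * (\<Prod>i<d. x i ^ count_list w i)"
    using Cons.prems by (simp add: prod.distrib)
  finally show ?case using Cons by (simp add: prod.lessThan_Suc_shift del: prod.lessThan_Suc)
qed simp

lemma prod_letters_shape_word:
  fixes x :: "nat \<Rightarrow> 'b::comm_semiring_1"
  assumes "w \<in> shape_words ns"
  shows "(\<Prod>k<sum_list ns. x (w ! k)) = (\<Prod>i<length ns. x i ^ (ns ! i))"
  using prod_letters_eq_prod_counts[OF set_shape_word[OF assms], of x] count_shape_word[OF assms]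
    length_shape_word[OF assms] by simp

lemma shape_words_subset_words:
  "shape_words ns \<subseteq> {w. set w \<subseteq> {..<length ns} \<and> length w = sum_list ns}"
  using set_shape_word length_shape_word by blast

text \<open>One term of the multinomial theorem. With \<open>x i = p i powr s\<close> it yields the
  bound by \<open>psi s\<close>; with a probability vector it bounds the number of words by an
  entropy; with an indicator it shows that a one-row shape has a single word.\<close>

lemma card_shape_words_le:
  fixes x :: "nat \<Rightarrow> real"
  assumes "\<And>i. i < length ns \<Longrightarrow> 0 \<le> x i"
  shows "card (shape_words ns) * (\<Prod>i<length ns. x i ^ (ns ! i)) \<le> (\<Sum>i<length ns. x i) ^ sum_list ns"
proof -
  let ?W = "{w. set w \<subseteq> {..<length ns} \<and> length w = sum_list ns}"
  have "card (shape_words ns) * (\<Prod>i<length ns. x i ^ (ns ! i)) =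
      (\<Sum>w\<in>shape_words ns. \<Prod>k<sum_list ns. x (w ! k))"
    by (simp add: prod_letters_shape_word)
  also have "\<dots> \<le> (\<Sum>w\<in>?W. \<Prod>k<sum_list ns. x (w ! k))"
  proof (rule sum_mono2[OF _ shape_words_subset_words])
    show "finite ?W" by (rule finite_lists_length_eq) simp
    fix w assume w: "w \<in> ?W - shape_words ns"
    show "0 \<le> (\<Prod>k<sum_list ns. x (w ! k))"
    proof (intro prod_nonneg ballI assms)
      fix k assume "k \<in> {..<sum_list ns}"
      then have "w ! k \<in> set w" using w by simp
      then show "w ! k < length ns" using w by blast
    qed
  qed
  also have "\<dots> = (\<Sum>i<length ns. x i) ^ sum_list ns"
    by (subst sum_words_prod) simp_all
  finally show ?thesis .
qed

text \<open>Induction through \<open>(1 + 1/k)^k \<le> e\<close>. With the next lemma this is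
  Stirling's formula up to polynomial factors, which the exponents cannot see.\<close>

lemma fact_lower: "real k ^ k \<le> exp (real k) * fact k"
proof (induction k)
  case (Suc k)
  have "real (Suc k) ^ k \<le> exp 1 * real k ^ k"
  proof (cases "k = 0")
    case False
    have "real (Suc k) ^ k = real k ^ k * (1 + 1 / real k) ^ k"
      using False by (simp add: field_simps flip: power_mult_distrib)
    also have "\<dots> \<le> real k ^ k * exp (1 / real k) ^ k"
      by (intro mult_left_mono power_mono exp_ge_add_one_self) auto
    also have "exp (1 / real k) ^ k = exp 1" using False by (simp flip: exp_of_nat_mult)
    finally show ?thesis by (simp add: mult.commute)
  qed simp
  also have "\<dots> \<le> exp 1 * (exp (real k) * fact k)" using Suc by simp
  finally have "real (Suc k) ^ k * real (Suc k) \<le> exp 1 * (exp (real k) * fact k) * real (Suc k)"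
    by (rule mult_right_mono) simp
  then show ?case by (simp add: exp_add algebra_simps)
qed simp

text \<open>Induction through \<open>1 - 1/(k+1) \<le> exp (-1/(k+1))\<close>, with the factor
  \<open>k\<close> from \<open>k = 1\<close> on. The weaker factor \<open>k + 1\<close> covers
  \<open>k = 0\<close>, that is, empty rows.\<close>

lemma fact_upper: "exp (real k) * fact k \<le> exp 1 * (real k + 1) * real k ^ k"
proof (cases "k = 0")
  case False
  then have "1 \<le> k" by simp
  then have "exp (real k) * fact k \<le> exp 1 * real k * real k ^ k"
  proof (induction k rule: dec_induct)
    case (step k)
    have "exp 1 * real k ^ Suc k \<le> real (Suc k) ^ Suc k"
    proof -
      have "real k = real (Suc k) * (1 + - (1 / real (Suc k)))" by (simp add: field_simps)
      also have "\<dots> \<le> real (Suc k) * exp (- (1 / real (Suc k)))"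
        by (intro mult_left_mono exp_ge_add_one_self) auto
      finally have "real k ^ Suc k \<le> (real (Suc k) * exp (- (1 / real (Suc k)))) ^ Suc k"
        by (rule power_mono) simp
      also have "\<dots> = real (Suc k) ^ Suc k * exp (- 1)"
        unfolding power_mult_distrib exp_of_nat_mult[symmetric] by simp
      finally show ?thesis by (simp add: exp_minus field_simps)
    qed
    then have k: "exp 1 * real k * real k ^ k \<le> real (Suc k) ^ Suc k" by simp
    have "exp (real (Suc k)) * fact (Suc k) = exp 1 * real (Suc k) * (exp (real k) * fact k)"
      by (simp add: exp_add algebra_simps)
    also have "\<dots> \<le> exp 1 * real (Suc k) * real (Suc k) ^ Suc k"
      using step.IH k by (intro mult_left_mono) auto
    finally show ?case .
  qed simp
  also have "\<dots> \<le> exp 1 * (real k + 1) * real k ^ k"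
    by (intro mult_right_mono mult_left_mono) auto
  finally show ?thesis .
qed simp

text \<open>Stirling applied to the multinomial coefficient: each row factorial costs one factor
  \<open>exp 1 * (n + 1)\<close>, and the number of rows is fixed, so the loss is polynomial in
  \<open>n\<close>.\<close>

lemma card_shape_words_ge:
  fixes ns :: "nat list"
  defines "n \<equiv> sum_list ns"
  shows "real n ^ n \<le> card (shape_words ns) * (\<Prod>i<length ns. real (ns ! i) ^ (ns ! i)) *
    (exp 1 * (real n + 1)) ^ length ns"
proof -
  have nsum: "n = (\<Sum>i<length ns. ns ! i)"
    by (simp add: n_def sum_list_sum_nth atLeast0LessThan)
  have le: "ns ! i \<le> n" if "i < length ns" for i
    unfolding n_def using that by (intro member_le_sum_list) auto
  have "(\<Prod>i\<in>set_mset (shape_content ns). fact (count (shape_content ns) i) :: nat) =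
      (\<Prod>i<length ns. fact (count (shape_content ns) i))"
    by (rule prod.mono_neutral_left[OF _ set_shape_content]) (auto simp: not_in_iff)
  also have "\<dots> = (\<Prod>i<length ns. fact (ns ! i))"
    by (rule prod.cong) (auto simp: count_shape_content)
  finally have "card (shape_words ns) * (\<Prod>i<length ns. fact (ns ! i)) = (fact n :: nat)"
    using card_permutations_of_multiset_aux[of "shape_content ns"] by (simp add: size_shape_content n_def)
  then have card: "real (card (shape_words ns)) * (\<Prod>i<length ns. fact (ns ! i)) = fact n"
    by (metis (mono_tags, lifting) of_nat_fact of_nat_mult of_nat_prod prod.cong)
  have "real n ^ n \<le> exp (real n) * fact n" by (rule fact_lower)
  also have "\<dots> = card (shape_words ns) * (\<Prod>i<length ns. exp (real (ns ! i)) * fact (ns ! i))"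
  proof -
    have "exp (real n) = (\<Prod>i<length ns. exp (real (ns ! i)))"
      unfolding nsum of_nat_sum by (rule exp_sum) simp
    then show ?thesis unfolding card[symmetric] by (simp add: prod.distrib mult_ac)
  qed
  also have "\<dots> \<le> card (shape_words ns) * (\<Prod>i<length ns. exp 1 * (real n + 1) * real (ns ! i) ^ (ns ! i))"
  proof (intro mult_left_mono prod_mono conjI)
    fix i assume "i \<in> {..<length ns}"
    then have "exp 1 * (real (ns ! i) + 1) * real (ns ! i) ^ (ns ! i) \<le> exp 1 * (real n + 1) * real (ns ! i) ^ (ns ! i)"
      using le[of i] by (intro mult_right_mono mult_left_mono) auto
    then show "exp (real (ns ! i)) * fact (ns ! i) \<le> exp 1 * (real n + 1) * real (ns ! i) ^ (ns ! i)"
      using fact_upper[of "ns ! i"] by linarith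
  qed auto
  also have "\<dots> = card (shape_words ns) * (\<Prod>i<length ns. real (ns ! i) ^ (ns ! i)) *
      (exp 1 * (real n + 1)) ^ length ns"
    unfolding prod.distrib[of "\<lambda>_. exp 1 * (real n + 1)"] prod_constant by (simp add: mult_ac)
  finally show ?thesis .
qed

text \<open>Once a letter \<open>Suc i\<close> has appeared in a sorted word, all letters
  \<open>i\<close> have already appeared, so the total counts decide.\<close>

lemma ballot_sorted:
  assumes "sorted w" "\<And>i. count_list w (Suc i) \<le> count_list w i"
  shows "ballot w"
  unfolding ballot_def
proof (intro allI)
  fix k i
  show "count_list (take k w) (Suc i) \<le> count_list (take k w) i"
  proof (cases "Suc i \<in> set (take k w)")
    case True
    have "sorted (take k w @ drop k w)" using assms(1) by simp
    then have "\<forall>x\<in>set (drop k w). Suc i \<le> x" using True by (simp add: sorted_append del: append_take_drop_id)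
    then have "i \<notin> set (drop k w)" by force
    then have "count_list w i = count_list (take k w) i"
      by (metis append_take_drop_id count_list_append count_notin add_0_right)
    then show ?thesis using assms(2)[of i] count_take_le[of k w "Suc i"] by linarith
  qed (simp add: count_notin)
qed

lemma shape_words_iff_count:
  "w \<in> shape_words ns \<longleftrightarrow> (\<forall>i. count_list w i = count (shape_content ns) i)"
  by (auto simp: shape_words_iff multiset_eq_iff count_mset)

lemma count_list_concat_shape_words:
  "set bs \<subseteq> shape_words ns \<Longrightarrow> count_list (concat bs) i = length bs * count (shape_content ns) i"
  by (induction bs) (auto simp: shape_words_iff_count)

text \<open>Complete blocks respect the order of the rows; only the block cut by the prefix can
  favour the lower row, and by at most its own length.\<close>

lemma count_take_concat_shape_words:
  assumes "set bs \<subseteq> shape_words ns"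
    and "count (shape_content ns) (Suc i) \<le> count (shape_content ns) i"
  shows "count_list (take k (concat bs)) (Suc i) \<le> count_list (take k (concat bs)) i + sum_list ns"
  using assms(1)
proof (induction bs arbitrary: k)
  case (Cons b bs)
  have b: "b \<in> shape_words ns" "length b = sum_list ns"
    using Cons.prems length_shape_word by auto
  show ?case
  proof (cases "k \<le> length b")
    case True
    have "count_list (take k b) (Suc i) \<le> sum_list ns"
      using count_le_length[of "take k b" "Suc i"] b(2) by simp
    then show ?thesis using True by simp
  next
    case False
    then show ?thesis using Cons.IH[of "k - length b"] Cons.prems b assms(2)
      by (simp add: shape_words_iff_count)
  qed
qed simp

text \<open>
  Words built from blocks of content \<open>\<nu>\<close> in arbitrary order are ballot sequences as soon as they are
  preceded by a sorted word giving each row a lead of at least one block length over the next row.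
\<close>

lemma card_shape_words_power_le_dim:
  fixes \<nu> :: "nat list" and B c :: nat
  defines "M \<equiv> sum_list \<nu>"
  assumes strict: "\<And>i. 0 < count (shape_content \<nu>) (Suc i) \<Longrightarrow>
      count (shape_content \<nu>) (Suc i) < count (shape_content \<nu>) i"
    and B: "M \<le> B" and len: "0 < length \<nu>"
  shows "card (shape_words \<nu>) ^ (B - M) \<le>
    cfun.dim (specht_module (map (\<lambda>i. B * \<nu> ! i + (if i = 0 then c else 0)) [0..<length \<nu>]))"
proof -
  \<comment> \<open>The \<open>c\<close> extra cells of the first row make room for a number of
    points that is not a multiple of the block length.\<close>
  define shape where "shape K = map (\<lambda>i. K * \<nu> ! i + (if i = 0 then c else 0)) [0..<length \<nu>]" for K
  let ?c = "\<lambda>i. count (shape_content \<nu>) i"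
  have cshape: "count (shape_content (shape K)) i = K * ?c i + (if i = 0 then c else 0)" for K i
    using len by (auto simp: count_shape_content shape_def)
  have mono: "?c (Suc i) \<le> ?c i" for i using strict[of i] by (cases "?c (Suc i) = 0") auto
  \<comment> \<open>The prefix spends the letters of \<open>M\<close> blocks. Strictness turns this
    into a lead of at least \<open>M\<close>, one block length, over every nonempty next row; the
    remaining \<open>B - M\<close> blocks are free.\<close>
  define pre where "pre = sorted_list_of_multiset (shape_content (shape M))"
  have pre: "count_list pre i = M * ?c i + (if i = 0 then c else 0)" for i
    using cshape[of M i] by (metis pre_def count_mset mset_sorted_list_of_multiset)
  have pre_ballot: "ballot pre"
  proof (rule ballot_sorted)
    show "sorted pre" by (simp add: pre_def)
    show "count_list pre (Suc i) \<le> count_list pre i" for i using mono[of i] by (simp add: pre trans_le_add1)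
  qed
  let ?L = "{bs. set bs \<subseteq> shape_words \<nu> \<and> length bs = B - M}"
  let ?g = "\<lambda>bs. pre @ concat bs"
  have inj: "inj_on ?g ?L"
  proof (rule inj_onI)
    fix bs bs' assume L: "bs \<in> ?L" "bs' \<in> ?L" and eq: "?g bs = ?g bs'"
    show "bs = bs'"
    proof (rule concat_injective)
      show "concat bs = concat bs'" "length bs = length bs'" using L eq by auto
      show "\<forall>(x, y)\<in>set (zip bs bs'). length x = length y"
      proof (rule ballI, clarify)
        fix x y assume "(x, y) \<in> set (zip bs bs')"
        then have "x \<in> set bs" "y \<in> set bs'" by (rule set_zip_leftD, rule set_zip_rightD)
        then have "x \<in> shape_words \<nu>" "y \<in> shape_words \<nu>" using L by auto
        then show "length x = length y" by (simp add: length_shape_word)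
      qed
    qed
  qed
  have img: "?g ` ?L \<subseteq> {w \<in> shape_words (shape B). ballot w}"
  proof (intro image_subsetI CollectI conjI)
    fix bs assume L: "bs \<in> ?L"
    show "?g bs \<in> shape_words (shape B)"
      unfolding shape_words_iff_count cshape
    proof
      fix i
      have "B * ?c i = M * ?c i + (B - M) * ?c i" using B by (simp flip: add_mult_distrib)
      then show "count_list (?g bs) i = B * ?c i + (if i = 0 then c else 0)"
        using L count_list_concat_shape_words[of bs \<nu> i] by (simp add: pre)
    qed
    show "ballot (?g bs)"
      unfolding ballot_def
    proof (intro allI)
      fix k i
      show "count_list (take k (?g bs)) (Suc i) \<le> count_list (take k (?g bs)) i"
      proof (cases "k \<le> length pre")
        case True
        then show ?thesis using pre_ballot by (simp add: ballot_def)
      next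
        case False
        let ?t = "take (k - length pre) (concat bs)"
        have "count_list pre (Suc i) + count_list ?t (Suc i) \<le> count_list pre i + count_list ?t i"
        \<comment> \<open>Strictness says nothing about empty rows, but their letters never
          occur.\<close>
        proof (cases "?c (Suc i) = 0")
          case True
          then have "count_list (concat bs) (Suc i) = 0"
            using L count_list_concat_shape_words[of bs \<nu> "Suc i"] by simp
          then have "count_list ?t (Suc i) = 0"
            using count_take_le[of "k - length pre" "concat bs" "Suc i"] by simp
          then show ?thesis using True pre by simp
        next
          case False
          then have "Suc (?c (Suc i)) \<le> ?c i" using strict[of i] by simp
          then have "M * Suc (?c (Suc i)) \<le> M * ?c i" by (rule mult_le_mono2)
          then show ?thesis
            using count_take_concat_shape_words[of bs \<nu> i "k - length pre"] L mono[of i]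
            by (simp add: pre M_def)
        qed
        then show ?thesis using False by simp
      qed
    qed
  qed
  have "card (shape_words \<nu>) ^ (B - M) = card ?L"
    by (rule card_lists_length_eq[symmetric]) simp
  also have "\<dots> = card (?g ` ?L)" by (rule card_image[OF inj, symmetric])
  also have "\<dots> \<le> card {w \<in> shape_words (shape B). ballot w}"
    by (rule card_mono[OF _ img]) simp
  also have "\<dots> \<le> cfun.dim (specht_module (shape B))" by (rule card_ballot_le_dim_specht)
  finally show ?thesis by (simp add: shape_def)
qed

section \<open>Shapes approximating a probability vector\<close>

lemma continuous_on_xlogx: "continuous_on {0..} (\<lambda>x::real. x * log 2 x)"
  unfolding continuous_on_eq_continuous_within
proof
  fix x :: real assume x: "x \<in> {0..}"
  show "continuous (at x within {0..}) (\<lambda>x. x * log 2 x)"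
  proof (cases "x = 0")
    case True
    have "((\<lambda>x::real. x * log 2 x) \<longlongrightarrow> 0) (at_right 0)"
      unfolding log_def by real_asymp
    then show ?thesis using True by (simp add: continuous_within at_within_Ici_at_right)
  next
    case False
    then have "x > 0" using x by simp
    then have "isCont (\<lambda>x. x * log 2 x) x" by (intro continuous_intros) auto
    then show ?thesis by (rule continuous_at_imp_continuous_at_within)
  qed
qed

lemma tendsto_xlogx:
  fixes f :: "'a \<Rightarrow> real"
  assumes "(f \<longlongrightarrow> x) F" "\<forall>\<^sub>F a in F. 0 \<le> f a" "0 \<le> x"
  shows "((\<lambda>a. f a * log 2 (f a)) \<longlongrightarrow> x * log 2 x) F"
  using continuous_on_tendsto_compose[OF continuous_on_xlogx assms(1)] assms(2,3) by simp

lemma tendsto_shannon_entropy: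
  fixes f :: "'a \<Rightarrow> nat \<Rightarrow> real"
  assumes "\<And>i. i < d \<Longrightarrow> ((\<lambda>a. f a i) \<longlongrightarrow> q i) F"
    and "\<forall>\<^sub>F a in F. \<forall>i<d. 0 \<le> f a i" "\<And>i. i < d \<Longrightarrow> 0 \<le> q i"
  shows "((\<lambda>a. shannon_entropy d (f a)) \<longlongrightarrow> shannon_entropy d q) F"
  unfolding shannon_entropy_def
  by (intro tendsto_minus tendsto_sum tendsto_xlogx) (use assms in \<open>auto elim: eventually_mono\<close>)

lemma log_card_shape_words_ge:
  fixes ns :: "nat list"
  defines "n \<equiv> sum_list ns" and "d \<equiv> length ns"
  assumes "n > 0"
  shows "n * shannon_entropy d (\<lambda>i. ns ! i / n) - d * log 2 (exp 1 * (n + 1)) \<le> log 2 (card (shape_words ns))"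
proof -
  have nsum: "(\<Sum>i<d. real (ns ! i)) = n"
    by (simp add: n_def d_def sum_list_sum_nth atLeast0LessThan)
  let ?P = "\<Prod>i<d. real (ns ! i) ^ (ns ! i)"
  \<comment> \<open>Empty rows contribute \<open>0 ^ 0 = 1\<close>, so the product is positive and
    its logarithm splits.\<close>
  have P0: "?P > 0" by (intro prod_pos) (auto simp: zero_less_power_eq)
  have "mset (sorted_list_of_multiset (shape_content ns)) = shape_content ns" by simp
  then have "shape_words ns \<noteq> {}" unfolding permutations_of_multiset_def by blast
  then have c0: "card (shape_words ns) > 0" by (simp add: card_gt_0_iff)
  have e0: "(exp 1 * (real n + 1)) ^ d > 0" by (intro zero_less_power mult_pos_pos) auto
  have logP: "log 2 ?P = (\<Sum>i<d. ns ! i * log 2 (ns ! i))"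
  proof -
    have "log 2 ?P = (\<Sum>i<d. log 2 (real (ns ! i) ^ (ns ! i)))"
    proof -
      have "ln ?P = (\<Sum>i<d. ln (real (ns ! i) ^ (ns ! i)))"
        by (rule ln_prod) (auto simp: zero_less_power_eq)
      then show ?thesis by (simp add: log_def sum_divide_distrib)
    qed
    also have "\<dots> = (\<Sum>i<d. ns ! i * log 2 (ns ! i))"
      by (rule sum.cong) (auto simp: log_nat_power split: nat.splits)
    finally show ?thesis .
  qed
  have "log 2 (real n ^ n) \<le> log 2 (card (shape_words ns) * ?P * (exp 1 * (real n + 1)) ^ d)"
    using card_shape_words_ge[of ns] \<open>n > 0\<close> by (intro log_mono) (auto simp: n_def d_def)
  also have "\<dots> = log 2 (card (shape_words ns)) + log 2 ?P + d * log 2 (exp 1 * (real n + 1))"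
  proof -
    have "log 2 ((exp 1 * (real n + 1)) ^ d) = d * log 2 (exp 1 * (real n + 1))"
      by (rule log_nat_power) (auto intro!: mult_pos_pos)
    moreover have "log 2 (card (shape_words ns) * ?P * (exp 1 * (real n + 1)) ^ d) =
        log 2 (card (shape_words ns) * ?P) + log 2 ((exp 1 * (real n + 1)) ^ d)"
      using c0 P0 e0 by (intro log_mult_pos) auto
    moreover have "log 2 (card (shape_words ns) * ?P) = log 2 (card (shape_words ns)) + log 2 ?P"
      using c0 P0 by (intro log_mult_pos) auto
    ultimately show ?thesis by simp
  qed
  finally have main: "n * log 2 n \<le> log 2 (card (shape_words ns)) + (\<Sum>i<d. ns ! i * log 2 (ns ! i)) + d * log 2 (exp 1 * (real n + 1))"
    using \<open>n > 0\<close> logP by (simp add: log_nat_power)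
  have "n * shannon_entropy d (\<lambda>i. ns ! i / n) = - (\<Sum>i<d. ns ! i * log 2 (ns ! i) - ns ! i * log 2 n)"
    unfolding shannon_entropy_def mult_minus_right sum_distrib_left
  proof (intro arg_cong[of _ _ uminus] sum.cong refl)
    fix i show "real n * (real (ns ! i) / real n * log 2 (real (ns ! i) / real n)) =
        real (ns ! i) * log 2 (real (ns ! i)) - real (ns ! i) * log 2 (real n)"
      using \<open>n > 0\<close> by (cases "ns ! i = 0") (auto simp: log_divide algebra_simps)
  qed
  also have "\<dots> = n * log 2 n - (\<Sum>i<d. ns ! i * log 2 (ns ! i))"
    unfolding sum_subtractf sum_distrib_right[symmetric] nsum by simp
  finally show ?thesis using main by simp
qed

text \<open>Two scales. A block type close to \<open>q\<close> is fixed first; then \<open>n\<close>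
  points are cut into blocks of that type, with the remainder in the first row. One half of
  \<epsilon> pays for the block, including its Stirling term; the other pays for the sorted prefix
  and the remainder, which stay bounded as \<open>n\<close> grows.\<close>

lemma approximating_shapes:
  fixes q :: "nat \<Rightarrow> real"
  assumes q: "prob_vector d q" and sorted: "\<And>i j. i \<le> j \<Longrightarrow> j < d \<Longrightarrow> q j \<le> q i"
    and r: "1 \<le> r" "r \<le> d" "\<And>i. r \<le> i \<Longrightarrow> i < d \<Longrightarrow> q i = 0" and \<epsilon>: "0 < \<epsilon>"
  shows "\<forall>\<^sub>F n in sequentially. \<exists>ns\<in>young_indices d n. (\<forall>i<d. r \<le> i \<longrightarrow> ns ! i = 0) \<and>
    (\<forall>i<d. \<bar>ns ! i / n - q i\<bar> \<le> \<epsilon>) \<and>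
    n * (shannon_entropy d q - \<epsilon>) \<le> log 2 (cfun.dim (specht_module ns))"
proof -
  have q0: "0 \<le> q i" if "i < d" for i using q that by (simp add: prob_vector_def)
  have q1: "(\<Sum>i<d. q i) = 1" using q by (simp add: prob_vector_def)
  \<comment> \<open>The staircase \<open>r - i\<close> makes the nonempty rows strictly decreasing,
    as free permutation of blocks requires; being bounded, it disappears after division by
    \<open>m\<close>.\<close>
  define \<nu> where "\<nu> m i = (if i < r then nat \<lfloor>real m * q i\<rfloor> + (r - i) else 0)" for m i :: nat
  define M where "M m = (\<Sum>i<d. \<nu> m i)" for m
  have near: "\<bar>real (\<nu> m i) - real m * q i\<bar> \<le> real r + 1" if "i < d" for m i
  proof (cases "i < r")
    case True
    have "0 \<le> real m * q i" using q0[OF that] by simp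
    then have "real (nat \<lfloor>real m * q i\<rfloor>) \<le> real m * q i" "real m * q i < real (nat \<lfloor>real m * q i\<rfloor>) + 1"
      by linarith+
    moreover have "real (\<nu> m i) = real (nat \<lfloor>real m * q i\<rfloor>) + (real r - real i)"
      using True by (simp add: \<nu>_def of_nat_diff)
    ultimately show ?thesis using True by (simp only: abs_le_iff) linarith
  next
    case False
    then show ?thesis using r(3)[of i] that by (simp add: \<nu>_def)
  qed
  have "(\<lambda>m. real (\<nu> m i) / real m) \<longlonglongrightarrow> q i" if i: "i < d" for i
  proof -
    have "(\<lambda>m. (real (\<nu> m i) - real m * q i) / real m) \<longlonglongrightarrow> 0"
    proof (rule Lim_null_comparison)
      show "\<forall>\<^sub>F m in sequentially. norm ((real (\<nu> m i) - real m * q i) / real m) \<le> (real r + 1) / real m"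
        using near[OF i] by (intro always_eventually allI) (simp add: divide_right_mono)
      show "(\<lambda>m. (real r + 1) / real m) \<longlonglongrightarrow> 0" by real_asymp
    qed
    then have "(\<lambda>m. (real (\<nu> m i) - real m * q i) / real m + q i) \<longlonglongrightarrow> 0 + q i"
      by (intro tendsto_intros)
    moreover have "\<forall>\<^sub>F m in sequentially. (real (\<nu> m i) - real m * q i) / real m + q i = real (\<nu> m i) / real m"
      using eventually_gt_at_top[of 0] by eventually_elim (simp add: field_simps)
    ultimately show ?thesis by (simp add: filterlim_cong)
  qed
  note lim_nu = this
  have lim_M: "(\<lambda>m. real (M m) / real m) \<longlonglongrightarrow> 1"
    unfolding M_def of_nat_sum sum_divide_distrib q1[symmetric] by (intro tendsto_sum lim_nu) simp
  have M_top: "filterlim (\<lambda>m. real (M m)) at_top sequentially"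
  proof -
    have "filterlim (\<lambda>m. real (M m) / real m * real m) at_top sequentially"
      by (rule filterlim_tendsto_pos_mult_at_top[OF lim_M _ filterlim_real_sequentially]) simp
    moreover have "\<forall>\<^sub>F m in sequentially. real (M m) / real m * real m = real (M m)"
      using eventually_gt_at_top[of 0] by eventually_elim simp
    ultimately show ?thesis by (simp cong: filterlim_cong)
  qed
  have lim_type: "(\<lambda>m. real (\<nu> m i) / real (M m)) \<longlonglongrightarrow> q i" if i: "i < d" for i
  proof -
    have "(\<lambda>m. (real (\<nu> m i) / real m) / (real (M m) / real m)) \<longlonglongrightarrow> q i / 1"
      by (intro tendsto_divide lim_nu lim_M i) simp
    moreover have "\<forall>\<^sub>F m in sequentially. (real (\<nu> m i) / real m) / (real (M m) / real m) = real (\<nu> m i) / real (M m)"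
      using eventually_gt_at_top[of 0] by eventually_elim simp
    ultimately have "(\<lambda>m. real (\<nu> m i) / real (M m)) \<longlonglongrightarrow> q i / 1"
      by (rule Lim_transform_eventually)
    then show ?thesis by simp
  qed
  have lim_H: "(\<lambda>m. shannon_entropy d (\<lambda>i. real (\<nu> m i) / real (M m))) \<longlonglongrightarrow> shannon_entropy d q"
    by (intro tendsto_shannon_entropy lim_type q0) auto
  have "((\<lambda>x::real. d * log 2 (exp 1 * (x + 1)) / x) \<longlongrightarrow> 0) at_top"
    unfolding log_def by real_asymp
  from filterlim_compose[OF this M_top]
  have lim_e: "(\<lambda>m. d * log 2 (exp 1 * (real (M m) + 1)) / real (M m)) \<longlonglongrightarrow> 0" .
  have "(\<lambda>m. shannon_entropy d (\<lambda>i. real (\<nu> m i) / real (M m)) -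
      d * log 2 (exp 1 * (real (M m) + 1)) / real (M m)) \<longlonglongrightarrow> shannon_entropy d q - 0"
    by (intro tendsto_diff lim_H lim_e)
  then have "\<forall>\<^sub>F m in sequentially. shannon_entropy d q - \<epsilon> / 2 < shannon_entropy d (\<lambda>i. real (\<nu> m i) / real (M m)) -
      d * log 2 (exp 1 * (real (M m) + 1)) / real (M m)"
    using \<epsilon> by (intro order_tendstoD) auto
  moreover have "\<forall>\<^sub>F m in sequentially. \<forall>i\<in>{..<d}. \<bar>real (\<nu> m i) / real (M m) - q i\<bar> < \<epsilon> / 2"
  proof (intro eventually_ball_finite ballI)
    fix i assume "i \<in> {..<d}"
    then show "\<forall>\<^sub>F m in sequentially. \<bar>real (\<nu> m i) / real (M m) - q i\<bar> < \<epsilon> / 2"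
      using tendstoD[OF lim_type, of i "\<epsilon> / 2"] \<epsilon> by (simp add: dist_real_def)
  qed simp
  moreover have "\<forall>\<^sub>F m in sequentially. 0 < real (M m)"
    using M_top unfolding filterlim_at_top_dense by blast
  ultimately have "\<forall>\<^sub>F m in sequentially. shannon_entropy d q - \<epsilon> / 2 < shannon_entropy d (\<lambda>i. real (\<nu> m i) / real (M m)) -
      d * log 2 (exp 1 * (real (M m) + 1)) / real (M m) \<and>
      (\<forall>i\<in>{..<d}. \<bar>real (\<nu> m i) / real (M m) - q i\<bar> < \<epsilon> / 2) \<and> 0 < real (M m)"
    by eventually_elim blast
  \<comment> \<open>From here on \<open>m\<close>, and with it the block length \<open>N\<close> and
    the number \<open>K\<close> of block words, is constant.\<close>
  then obtain m where
    m1: "shannon_entropy d q - \<epsilon> / 2 < shannon_entropy d (\<lambda>i. real (\<nu> m i) / real (M m)) -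
      d * log 2 (exp 1 * (real (M m) + 1)) / real (M m)" and
    m2: "\<And>i. i < d \<Longrightarrow> \<bar>real (\<nu> m i) / real (M m) - q i\<bar> < \<epsilon> / 2" and m3: "0 < M m"
    by (auto dest!: eventually_happens'[OF sequentially_bot])
  define v where "v = map (\<nu> m) [0..<d]"
  define N where "N = M m"
  define K where "K = card (shape_words v)"
  have N0: "0 < N" using m3 by (simp add: N_def)
  have lv: "length v = d" by (simp add: v_def)
  have sv: "sum_list v = N"
    by (simp add: v_def N_def M_def sum_list_sum_nth atLeast0LessThan interv_sum_list_conv_sum_set_nat)
  have vi: "v ! i = \<nu> m i" if "i < d" for i using that by (simp add: v_def)
  have Hv: "shannon_entropy d (\<lambda>i. real (v ! i) / N) = shannon_entropy d (\<lambda>i. real (\<nu> m i) / N)"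
    by (simp add: shannon_entropy_def vi)
  have K1: "N * (shannon_entropy d q - \<epsilon> / 2) \<le> log 2 K"
  proof -
    have "N * (shannon_entropy d q - \<epsilon> / 2) \<le> N * (shannon_entropy d (\<lambda>i. real (\<nu> m i) / N) - d * log 2 (exp 1 * (real N + 1)) / N)"
      using m1 by (intro mult_left_mono) (auto simp: N_def)
    also have "\<dots> = N * shannon_entropy d (\<lambda>i. real (v ! i) / N) - d * log 2 (exp 1 * (real N + 1))"
      unfolding Hv using N0 by (simp add: algebra_simps)
    also have "\<dots> \<le> log 2 K"
      using log_card_shape_words_ge[of v] N0 sv lv by (simp add: K_def)
    finally show ?thesis .
  qed
  have K0: "1 \<le> K"
  proof -
    have "mset (sorted_list_of_multiset (shape_content v)) = shape_content v" by simp
    then have "shape_words v \<noteq> {}" unfolding permutations_of_multiset_def by blast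
    then show ?thesis by (simp add: card_gt_0_iff K_def Suc_le_eq)
  qed
  have logK: "0 \<le> log 2 K" using K0 by simp
  have d0: "0 < d" using r by simp
  have strict: "count (shape_content v) (Suc i) < count (shape_content v) i"
    if "0 < count (shape_content v) (Suc i)" for i
  proof -
    have i: "Suc i < d" "Suc i < r" using that vi[of "Suc i"]
      by (auto simp: count_shape_content lv \<nu>_def split: if_splits)
    have "real m * q (Suc i) \<le> real m * q i" using sorted[of i "Suc i"] i by (intro mult_left_mono) auto
    then have "nat \<lfloor>real m * q (Suc i)\<rfloor> \<le> nat \<lfloor>real m * q i\<rfloor>" by (intro nat_mono floor_mono)
    then show ?thesis using i vi by (simp add: count_shape_content lv \<nu>_def)
  qed
  define ns where "ns n = map (\<lambda>i. (n div N) * v ! i + (if i = 0 then n mod N else 0)) [0..<d]" for n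
  have nsi: "ns n ! i = (n div N) * \<nu> m i + (if i = 0 then n mod N else 0)" if "i < d" for n i
    using that vi by (simp add: ns_def)
  have young: "ns n \<in> young_indices d n" for n
  proof -
    have "sum_list (ns n) = (\<Sum>i<d. (n div N) * v ! i + (if i = 0 then n mod N else 0))"
      by (simp add: ns_def interv_sum_list_conv_sum_set_nat atLeast0LessThan)
    also have "\<dots> = (n div N) * (\<Sum>i<d. v ! i) + n mod N"
      using d0 by (simp add: sum.distrib sum_distrib_left)
    also have "(\<Sum>i<d. v ! i) = N" by (simp add: vi N_def M_def)
    finally have "sum_list (ns n) = n" by simp
    moreover have "sorted_wrt (\<ge>) (ns n)"
    proof (subst sorted_wrt_iff_nth_less, intro allI impI)
      fix i j assume ij: "i < j" "j < length (ns n)"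
      have jd: "j < d" using ij by (simp add: ns_def)
      have "real m * q j \<le> real m * q i" using sorted[of i j] ij jd by (intro mult_left_mono) auto
      then have "nat \<lfloor>real m * q j\<rfloor> \<le> nat \<lfloor>real m * q i\<rfloor>" by (intro nat_mono floor_mono)
      moreover have "(if j < r then b + (r - j) else 0) \<le> (if i < r then a + (r - i) else 0)"
        if "b \<le> a" for a b :: nat using that ij(1) by auto
      ultimately have "\<nu> m j \<le> \<nu> m i" unfolding \<nu>_def by blast
      then show "ns n ! i \<ge> ns n ! j" using ij jd by (simp add: nsi mult_le_mono2 trans_le_add1)
    qed
    ultimately show ?thesis by (simp add: young_indices_def ns_def)
  qed
  have supp: "ns n ! i = 0" if "i < d" "r \<le> i" for n i
    using that r by (simp add: nsi \<nu>_def)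
  have dist: "\<bar>ns n ! i / n - q i\<bar> \<le> \<epsilon>" if i: "i < d" and n: "0 < n" "N / n \<le> \<epsilon> / 2" for n i
  proof -
    have nn: "real n = real (n div N) * real N + real (n mod N)"
      by (metis div_mult_mod_eq of_nat_add of_nat_mult)
    define x where "x = real (\<nu> m i) / N"
    have x: "0 \<le> x" "x \<le> 1" 
    proof -
      have "\<nu> m i \<le> N" unfolding N_def M_def using i by (intro member_le_sum) auto
      then show "0 \<le> x" "x \<le> 1" using N0 by (auto simp: x_def)
    qed
    have "real (ns n ! i) = real (n div N) * (N * x) + (if i = 0 then real (n mod N) else 0)"
      using N0 i by (simp add: nsi x_def)
    \<comment> \<open>Only the remainder deviates from the block proportions: it sits in row 0
      instead of being shared out according to \<open>x\<close>.\<close>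
    then have "real (ns n ! i) - n * x = real (n mod N) * ((if i = 0 then 1 else 0) - x)"
      unfolding nn by (simp add: algebra_simps)
    also have "\<bar>\<dots>\<bar> \<le> real (n mod N) * 1"
      unfolding abs_mult using x by (intro mult_mono) auto
    also have "\<dots> \<le> N" using N0 by (simp add: less_imp_le)
    finally have "\<bar>real (ns n ! i) - n * x\<bar> / n \<le> N / n" by (rule divide_right_mono) simp
    moreover have "\<bar>real (ns n ! i) - n * x\<bar> / n = \<bar>ns n ! i / n - x\<bar>"
    proof -
      have "ns n ! i / n - x = (real (ns n ! i) - n * x) / n" using n(1) by (simp add: field_simps)
      then show ?thesis using n(1) by (simp add: abs_divide)
    qed
    ultimately have "\<bar>ns n ! i / n - x\<bar> \<le> \<epsilon> / 2" using n(2) by linarith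
    then show ?thesis using m2[OF i] unfolding N_def[symmetric] x_def[symmetric] by linarith
  qed
  \<comment> \<open>The \<open>N\<close> blocks given to the prefix and the rounding of
    \<open>n / N\<close> together cost at most \<open>(1 + N) * log 2 K\<close>.\<close>
  have dim: "n * (shannon_entropy d q - \<epsilon>) \<le> log 2 (cfun.dim (specht_module (ns n)))"
    if n: "N \<le> n div N" "(1 + N) * log 2 K \<le> n * (\<epsilon> / 2)" for n
  proof -
    have "real (K ^ (n div N - N)) \<le> cfun.dim (specht_module (ns n))"
      using card_shape_words_power_le_dim[of v "n div N" "n mod N"] strict n(1) d0
      by (simp add: sv lv ns_def K_def)
    then have "log 2 (real K ^ (n div N - N)) \<le> log 2 (cfun.dim (specht_module (ns n)))"
      using K0 by (intro log_mono) auto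
    then have 1: "real (n div N - N) * log 2 K \<le> log 2 (cfun.dim (specht_module (ns n)))"
      using K0 by (simp add: log_nat_power)
    have "real n / N - 1 \<le> real (n div N)"
    proof -
      have "real n = real (n div N) * real N + real (n mod N)"
        by (metis div_mult_mod_eq of_nat_add of_nat_mult)
      moreover have "real (n mod N) \<le> real N" using N0 by (simp add: less_imp_le)
      ultimately have "real n \<le> (real (n div N) + 1) * real N" by (simp add: algebra_simps)
      then have "real n / N \<le> real (n div N) + 1" using N0 by (simp add: divide_le_eq)
      then show ?thesis by simp
    qed
    then have "(real n / N - 1 - N) * log 2 K \<le> real (n div N - N) * log 2 K"
      using n(1) logK by (intro mult_right_mono) (auto simp: of_nat_diff)
    moreover have "n / N * (N * (shannon_entropy d q - \<epsilon> / 2)) \<le> n / N * log 2 K"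
      using K1 by (intro mult_left_mono) auto
    then have "n * (shannon_entropy d q - \<epsilon> / 2) \<le> n / N * log 2 K" using N0 by simp
    ultimately show ?thesis using 1 n(2) by (simp add: algebra_simps)
  qed
  have "\<forall>\<^sub>F n in sequentially. N / n \<le> \<epsilon> / 2"
  proof -
    have "(\<lambda>n. real N / real n) \<longlonglongrightarrow> 0" by real_asymp
    then show ?thesis using \<epsilon> by (auto dest!: order_tendstoD(2)[of _ 0 _ "\<epsilon> / 2"] elim: eventually_mono)
  qed
  moreover have "\<forall>\<^sub>F n in sequentially. (1 + N) * log 2 K \<le> n * (\<epsilon> / 2)"
  proof -
    have "filterlim (\<lambda>n. real n * (\<epsilon> / 2)) at_top sequentially" using \<epsilon> by real_asymp
    then show ?thesis by (simp add: filterlim_at_top)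
  qed
  moreover have "\<forall>\<^sub>F n in sequentially. N \<le> n div N"
    using eventually_ge_at_top[of "N * N"]
    by eventually_elim (metis N0 div_le_mono nonzero_mult_div_cancel_right less_not_refl2)
  ultimately show ?thesis
    using eventually_gt_at_top[of 0]
  proof eventually_elim
    case (elim n)
    then show ?case using young[of n] supp dist[of _ n] dim[of n] by blast
  qed
qed

section \<open>Weights of the isotypic component\<close>

lemma sum_apply: "(\<Sum>i\<in>I. g i) x = (\<Sum>i\<in>I. g i x)" for g :: "_ \<Rightarrow> 'w \<Rightarrow> complex"
  by (induction I rule: infinite_finite_induct) auto

lemma finite_words: "finite (words n :: 'a::finite list set)"
  using finite_lists_length_eq[of "UNIV :: 'a set" n] by (simp add: words_def)

lemma bij_permute_words:
  assumes "\<pi> permutes {..<n}"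
  shows "bij_betw (permute_list \<pi>) (words n) (words n)"
  by (rule bij_betw_byWitness[where f' = "permute_list (inv \<pi>)"])
    (use permute_list_inv[of \<pi>] assms in \<open>auto simp: words_def\<close>)

lemma tensor_cinner_eq_fun_cinner: "tensor_cinner n = fun_cinner (words n)"
  by (intro ext) (simp add: tensor_cinner_def fun_cinner_def)

global_interpretation tensor: complex_inner_space cscale "tensor_space n" "tensor_cinner n" for n
  unfolding tensor_cinner_eq_fun_cinner tensor_space_eq_funs_on
  by (rule fun_cinner_inner_space[OF finite_words])

text \<open>The trace of a projection times an operator is the sum of the operator's diagonal
  entries over an orthonormal basis of the range; this turns probabilities into quadratic
  forms.\<close>

lemma tensor_trace_orth_proj:
  assumes "finite F" "tensor.orthonormal n F" "F \<subseteq> tensor_space n" "cfun.span F = W"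
  shows "tensor_trace n (orth_proj (tensor_cinner n) W \<circ> tensor_power n A) =
    (\<Sum>e\<in>F. tensor_cinner n e (tensor_power n A e))"
proof -
  let ?K = "\<lambda>x y. \<Prod>k<n. A $ (x ! k) $ (y ! k)"
  have basis: "tensor_power n A (basis_vec x) y = ?K y x" if "x \<in> words n" "y \<in> words n" for x y
    using that by (simp add: tensor_power_def basis_vec_def if_distrib finite_words cong: if_cong)
  have "tensor_trace n (orth_proj (tensor_cinner n) W \<circ> tensor_power n A) =
      (\<Sum>x\<in>words n. \<Sum>e\<in>F. tensor_cinner n e (tensor_power n A (basis_vec x)) * e x)"
    unfolding tensor_trace_def comp_def tensor.orth_proj_orthonormal[OF assms] sum_apply
    by (simp add: cscale_def)
  also have "\<dots> = (\<Sum>e\<in>F. \<Sum>x\<in>words n. tensor_cinner n e (tensor_power n A (basis_vec x)) * e x)"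
    by (rule sum.swap)
  also have "\<dots> = (\<Sum>e\<in>F. \<Sum>x\<in>words n. \<Sum>y\<in>words n. cnj (e y) * (?K y x * e x))"
    unfolding tensor_cinner_def sum_distrib_right
    by (intro sum.cong refl) (simp add: basis)
  also have "\<dots> = (\<Sum>e\<in>F. \<Sum>y\<in>words n. \<Sum>x\<in>words n. cnj (e y) * (?K y x * e x))"
    by (intro sum.cong refl sum.swap)
  also have "\<dots> = (\<Sum>e\<in>F. tensor_cinner n e (tensor_power n A e))"
    unfolding tensor_cinner_def by (intro sum.cong refl) (simp add: tensor_power_def sum_distrib_left)
  finally show ?thesis .
qed

lemma prod_indicator_eq:
  assumes "length x = n" "length y = n"
  shows "(\<Prod>k<n. if x ! k = y ! k then 1 else 0) = (if x = y then 1 else (0 :: complex))"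
proof (cases "x = y")
  case False
  then obtain k where "k < n" "x ! k \<noteq> y ! k" using assms nth_equalityI[of x y] by auto
  then show ?thesis using False by (auto intro!: prod_zero bexI[of _ k])
qed simp

section \<open>Product vectors of an orthonormal basis as coordinates of the tensor power\<close>

locale unitary_frame =
  fixes u :: "nat \<Rightarrow> complex ^ 'a::finite"
  assumes orthonormal:
      "\<And>i j. i < CARD('a) \<Longrightarrow> j < CARD('a) \<Longrightarrow> (\<Sum>a\<in>UNIV. cnj (u i $ a) * u j $ a) = (if i = j then 1 else 0)"
    and complete: "\<And>a b. (\<Sum>i<CARD('a). u i $ a * cnj (u i $ b)) = (if a = b then 1 else 0)"
begin

definition frame_words :: "nat \<Rightarrow> nat list set" where
  "frame_words n = {w. set w \<subseteq> {..<CARD('a)} \<and> length w = n}"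

definition frame_vec :: "nat list \<Rightarrow> 'a list \<Rightarrow> complex" where
  "frame_vec w x = (\<Prod>k<length w. u (w ! k) $ (x ! k))"

text \<open>\<open>coord\<close> and \<open>synth\<close> identify the tensor power with functions
  on index words. Since Specht modules consist of functions on words of naturals,
  \<open>synth\<close> is the map that places them in the tensor power.\<close>

definition coord :: "nat \<Rightarrow> ('a list \<Rightarrow> complex) \<Rightarrow> nat list \<Rightarrow> complex" where
  "coord n v w = (if w \<in> frame_words n then \<Sum>x\<in>words n. cnj (frame_vec w x) * v x else 0)"

definition synth :: "nat \<Rightarrow> (nat list \<Rightarrow> complex) \<Rightarrow> 'a list \<Rightarrow> complex" where
  "synth n v x = (if x \<in> words n then \<Sum>w\<in>frame_words n. v w * frame_vec w x else 0)"

lemma finite_frame_words: "finite (frame_words n)"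
  unfolding frame_words_def by (rule finite_lists_length_eq) simp

lemma frame_vec_orthonormal:
  assumes "w \<in> frame_words n" "w' \<in> frame_words n"
  shows "(\<Sum>x\<in>words n. cnj (frame_vec w x) * frame_vec w' x) = (if w = w' then 1 else 0)"
proof -
  have l: "length w = n" "length w' = n" and s: "\<And>k. k < n \<Longrightarrow> w ! k < CARD('a)" "\<And>k. k < n \<Longrightarrow> w' ! k < CARD('a)"
    using assms nth_mem by (auto simp: frame_words_def subset_iff)
  have "(\<Sum>x\<in>words n. cnj (frame_vec w x) * frame_vec w' x) =
      (\<Sum>x | set x \<subseteq> UNIV \<and> length x = n. \<Prod>k<n. cnj (u (w ! k) $ (x ! k)) * u (w' ! k) $ (x ! k))"
    by (simp add: words_def frame_vec_def l prod.distrib)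
  also have "\<dots> = (\<Prod>k<n. \<Sum>a\<in>UNIV. cnj (u (w ! k) $ a) * u (w' ! k) $ a)"
    by (rule sum_words_prod) simp
  also have "\<dots> = (\<Prod>k<n. if w ! k = w' ! k then 1 else 0)"
    by (rule prod.cong) (use s in \<open>auto simp: orthonormal\<close>)
  finally show ?thesis using prod_indicator_eq[OF l] by simp
qed

lemma coord_synth:
  assumes "v \<in> funs_on (frame_words n)"
  shows "coord n (synth n v) = v"
proof
  fix w
  show "coord n (synth n v) w = v w"
  proof (cases "w \<in> frame_words n")
    case True
    have "coord n (synth n v) w = (\<Sum>x\<in>words n. \<Sum>w'\<in>frame_words n. v w' * (cnj (frame_vec w x) * frame_vec w' x))"
      using True by (simp add: coord_def synth_def sum_distrib_left mult_ac)
    also have "\<dots> = (\<Sum>w'\<in>frame_words n. v w' * (\<Sum>x\<in>words n. cnj (frame_vec w x) * frame_vec w' x))"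
      unfolding sum_distrib_left by (rule sum.swap)
    also have "\<dots> = (\<Sum>w'\<in>frame_words n. if w' = w then v w else 0)"
      by (rule sum.cong) (auto simp: frame_vec_orthonormal[OF True])
    finally show ?thesis using True finite_frame_words by simp
  next
    case False
    then show ?thesis using assms by (simp add: coord_def funs_on_def)
  qed
qed

lemma synth_add: "synth n (v + w) = synth n v + synth n w"
  by (auto simp: synth_def fun_eq_iff algebra_simps sum.distrib)

lemma synth_cscale: "synth n (cscale c v) = cscale c (synth n v)"
  by (auto simp: synth_def cscale_def fun_eq_iff sum_distrib_left mult.assoc)

lemma synth_tensor_space: "synth n v \<in> tensor_space n"
  by (auto simp: synth_def tensor_space_def)

lemma coord_add: "coord n (v + w) = coord n v + coord n w"
  by (auto simp: coord_def fun_eq_iff algebra_simps sum.distrib)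

lemma coord_cscale: "coord n (cscale c v) = cscale c (coord n v)"
  by (auto simp: coord_def cscale_def fun_eq_iff sum_distrib_left algebra_simps)

lemma coord_zero: "coord n 0 = 0"
  by (auto simp: coord_def fun_eq_iff)

lemma tensor_cinner_synth:
  "tensor_cinner n (synth n v) b = fun_cinner (frame_words n) v (coord n b)"
proof -
  have "tensor_cinner n (synth n v) b =
      (\<Sum>x\<in>words n. \<Sum>w\<in>frame_words n. cnj (v w) * (cnj (frame_vec w x) * b x))"
    by (simp add: tensor_cinner_def synth_def sum_distrib_right mult.assoc)
  also have "\<dots> = (\<Sum>w\<in>frame_words n. cnj (v w) * (\<Sum>x\<in>words n. cnj (frame_vec w x) * b x))"
    unfolding sum_distrib_left by (rule sum.swap)
  finally show ?thesis by (simp add: fun_cinner_def coord_def)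
qed

text \<open>If \<open>A\<close> is diagonal in the basis \<open>u\<close> with eigenvalues
  \<open>c\<close>, then its tensor power is diagonal in the product vectors, with the products of
  letter eigenvalues.\<close>

lemma tensor_cinner_tensor_power:
  assumes A: "\<And>a b. (\<Sum>i<CARD('a). c i * (u i $ a * cnj (u i $ b))) = A $ a $ b"
  shows "tensor_cinner n v (tensor_power n A v') =
    (\<Sum>w\<in>frame_words n. (\<Prod>k<n. c (w ! k)) * (cnj (coord n v w) * coord n v' w))"
proof -
  let ?C = "\<lambda>w. \<Prod>k<n. c (w ! k)"
  have K: "(\<Prod>k<n. A $ (x ! k) $ (y ! k)) = (\<Sum>w\<in>frame_words n. ?C w * (frame_vec w x * cnj (frame_vec w y)))"
    for x y
  proof -
    have "(\<Prod>k<n. A $ (x ! k) $ (y ! k)) =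
        (\<Sum>w\<in>frame_words n. \<Prod>k<n. c (w ! k) * (u (w ! k) $ (x ! k) * cnj (u (w ! k) $ (y ! k))))"
      unfolding A[symmetric] frame_words_def by (rule sum_words_prod[symmetric]) simp
    also have "\<dots> = (\<Sum>w\<in>frame_words n. ?C w * (frame_vec w x * cnj (frame_vec w y)))"
      by (rule sum.cong) (auto simp: frame_words_def frame_vec_def prod.distrib)
    finally show ?thesis .
  qed
  have "tensor_cinner n v (tensor_power n A v') =
      (\<Sum>x\<in>words n. \<Sum>y\<in>words n. \<Sum>w\<in>frame_words n. ?C w * (cnj (v x) * frame_vec w x * (cnj (frame_vec w y) * v' y)))"
    by (simp add: tensor_cinner_def tensor_power_def K sum_distrib_left sum_distrib_right mult_ac)
  also have "\<dots> = (\<Sum>x\<in>words n. \<Sum>w\<in>frame_words n. \<Sum>y\<in>words n. ?C w * (cnj (v x) * frame_vec w x * (cnj (frame_vec w y) * v' y)))"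
    by (intro sum.cong refl sum.swap)
  also have "\<dots> = (\<Sum>w\<in>frame_words n. \<Sum>x\<in>words n. \<Sum>y\<in>words n. ?C w * (cnj (v x) * frame_vec w x * (cnj (frame_vec w y) * v' y)))"
    by (rule sum.swap)
  also have "\<dots> = (\<Sum>w\<in>frame_words n. ?C w * (cnj (coord n v w) * coord n v' w))"
  proof (intro sum.cong refl)
    fix w assume w: "w \<in> frame_words n"
    have "(\<Sum>x\<in>words n. \<Sum>y\<in>words n. ?C w * (cnj (v x) * frame_vec w x * (cnj (frame_vec w y) * v' y))) =
        ?C w * ((\<Sum>x\<in>words n. cnj (v x) * frame_vec w x) * (\<Sum>y\<in>words n. cnj (frame_vec w y) * v' y))"
      unfolding sum_product by (simp only: sum_distrib_left)
    also have "(\<Sum>x\<in>words n. cnj (v x) * frame_vec w x) = cnj (coord n v w)"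
      using w by (simp add: coord_def mult.commute)
    finally show "(\<Sum>x\<in>words n. \<Sum>y\<in>words n. ?C w * (cnj (v x) * frame_vec w x * (cnj (frame_vec w y) * v' y))) =
        ?C w * (cnj (coord n v w) * coord n v' w)"
      using w by (simp add: coord_def)
  qed
  finally show ?thesis .
qed

lemma tensor_cinner_coord:
  assumes "v \<in> tensor_space n"
  shows "tensor_cinner n v v = (\<Sum>w\<in>frame_words n. cnj (coord n v w) * coord n v w)"
proof -
  \<comment> \<open>Parseval is obtained as the spectral formula of the identity, all of whose
    eigenvalues are 1.\<close>
  have "tensor_power n (mat 1) v = v"
  proof
    fix x
    show "tensor_power n (mat 1) v x = v x"
    proof (cases "x \<in> words n")
      case True
      have "tensor_power n (mat 1) v x = (\<Sum>y\<in>words n. (if x = y then 1 else 0) * v y)"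
        using True unfolding tensor_power_def mat_def
        by (auto intro!: sum.cong simp: prod_indicator_eq words_def)
      also have "\<dots> = (\<Sum>y\<in>words n. if y = x then v x else 0)" by (rule sum.cong) auto
      finally show ?thesis using True by (simp add: finite_words)
    next
      case False
      then show ?thesis using assms by (auto simp: tensor_power_def tensor_space_def)
    qed
  qed
  then show ?thesis
    using tensor_cinner_tensor_power[of "\<lambda>_. 1" "mat 1" n v v] complete by (simp add: mat_def)
qed

lemma bij_permute_frame_words:
  assumes "\<pi> permutes {..<n}"
  shows "bij_betw (permute_list \<pi>) (frame_words n) (frame_words n)"
  by (rule bij_betw_byWitness[where f' = "permute_list (inv \<pi>)"])
    (use permute_list_inv[of \<pi>] assms permutes_inv[OF assms] in \<open>auto simp: frame_words_def\<close>)

lemma permute_frame_words_iff: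
  assumes "\<pi> permutes {..<n}" "length w = n"
  shows "permute_list \<pi> w \<in> frame_words n \<longleftrightarrow> w \<in> frame_words n"
  using assms by (simp add: frame_words_def)

text \<open>Permuting both words only reorders the factors. For this reason \<open>coord\<close> and
  \<open>synth\<close> commute with the symmetric group.\<close>

lemma frame_vec_permute:
  assumes "\<pi> permutes {..<n}" "length w = n" "length x = n"
  shows "frame_vec (permute_list \<pi> w) (permute_list \<pi> x) = frame_vec w x"
proof -
  have "frame_vec (permute_list \<pi> w) (permute_list \<pi> x) = (\<Prod>k<n. u (w ! \<pi> k) $ (x ! \<pi> k))"
    using assms by (simp add: frame_vec_def permute_list_nth)
  also have "\<dots> = (\<Prod>k<n. u (w ! k) $ (x ! k))"
    by (rule prod.reindex_bij_betw[OF permutes_imp_bij[OF assms(1)]])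
  finally show ?thesis using assms by (simp add: frame_vec_def)
qed

lemma coord_perm_act:
  assumes "\<pi> permutes {..<n}"
  shows "coord n (perm_act \<pi> v) = perm_act \<pi> (coord n v)"
proof
  fix w
  show "coord n (perm_act \<pi> v) w = perm_act \<pi> (coord n v) w"
  proof (cases "w \<in> frame_words n")
    case True
    then have l: "length w = n" by (simp add: frame_words_def)
    have "perm_act \<pi> (coord n v) w = (\<Sum>x\<in>words n. cnj (frame_vec (permute_list \<pi> w) x) * v x)"
      using True permute_frame_words_iff[OF assms l] by (simp add: perm_act_def coord_def)
    also have "\<dots> = (\<Sum>x\<in>words n. cnj (frame_vec (permute_list \<pi> w) (permute_list \<pi> x)) * v (permute_list \<pi> x))"
      by (rule sum.reindex_bij_betw[OF bij_permute_words[OF assms], symmetric])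
    also have "\<dots> = coord n (perm_act \<pi> v) w"
      using True l by (simp add: coord_def perm_act_def frame_vec_permute[OF assms] words_def)
    finally show ?thesis by simp
  next
    case False
    then have "permute_list \<pi> w \<notin> frame_words n"
      using permute_frame_words_iff[OF assms] by (cases "length w = n") (auto simp: frame_words_def)
    then show ?thesis using False by (simp add: coord_def perm_act_def)
  qed
qed

lemma synth_perm_act:
  assumes "\<pi> permutes {..<n}"
  shows "synth n (perm_act \<pi> v) = perm_act \<pi> (synth n v)"
proof
  fix x :: "'a list"
  show "synth n (perm_act \<pi> v) x = perm_act \<pi> (synth n v) x"
  proof (cases "x \<in> words n")
    case True
    then have l: "length x = n" by (simp add: words_def)
    have "perm_act \<pi> (synth n v) x = (\<Sum>w\<in>frame_words n. v w * frame_vec w (permute_list \<pi> x))"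
      using True by (simp add: perm_act_def synth_def words_def)
    also have "\<dots> = (\<Sum>w\<in>frame_words n. v (permute_list \<pi> w) * frame_vec (permute_list \<pi> w) (permute_list \<pi> x))"
      by (rule sum.reindex_bij_betw[OF bij_permute_frame_words[OF assms], symmetric])
    also have "\<dots> = synth n (perm_act \<pi> v) x"
      using True l by (simp add: synth_def perm_act_def frame_vec_permute[OF assms] frame_words_def)
    finally show ?thesis by simp
  next
    case False
    then show ?thesis by (simp add: synth_def perm_act_def words_def)
  qed
qed

end

section \<open>Orthonormal bases of the isotypic component and the lower probability bound\<close>

lemma subspace_schur_weyl_space: "cfun.subspace (schur_weyl_space ns)"
  by (simp add: schur_weyl_space_def)

lemma schur_weyl_space_tensor_space: "schur_weyl_space ns \<subseteq> tensor_space (sum_list ns)"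
  unfolding schur_weyl_space_def
  by (intro cfun.span_minimal) (auto simp: perm_submodule_def tensor_space_eq_funs_on subspace_funs_on)

lemma schur_weyl_space_finite_span:
  "schur_weyl_space ns \<subseteq> cfun.span (basis_vec ` (words (sum_list ns) :: 'a::finite list set))"
  by (rule subset_trans[OF schur_weyl_space_tensor_space[unfolded tensor_space_eq_funs_on]
        funs_on_span[OF finite_words]])

lemma schur_weyl_prob_orthonormal:
  assumes "finite F" "tensor.orthonormal (sum_list ns) F" "F \<subseteq> tensor_space (sum_list ns)"
    "cfun.span F = schur_weyl_space ns"
  shows "schur_weyl_prob \<rho> ns = (\<Sum>e\<in>F. Re (tensor_cinner (sum_list ns) e (tensor_power (sum_list ns) \<rho> e)))"
  unfolding schur_weyl_prob_def schur_weyl_proj_def tensor_trace_orth_proj[OF assms] by simp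

lemma specht_orthonormal_basis:
  obtains E where "finite E" "complex_inner_space.orthonormal (fun_cinner (shape_words ns)) E"
    "E \<subseteq> funs_on (shape_words ns)" "cfun.span E = specht_module ns" "card E = cfun.dim (specht_module ns)"
proof -
  interpret S: complex_inner_space cscale "funs_on (shape_words ns)" "fun_cinner (shape_words ns)"
    by (rule fun_cinner_inner_space) simp
  have sp: "specht_module ns \<subseteq> cfun.span (basis_vec ` shape_words ns)"
    using specht_module_shape_funs funs_on_span[of "shape_words ns"] by auto
  have fin: "finite (basis_vec ` shape_words ns :: (nat list \<Rightarrow> complex) set)" by simp
  have sub: "basis_vec ` shape_words ns \<subseteq> funs_on (shape_words ns)"
    using basis_vec_funs_on by blast
  have on: "S.orthonormal {}" by (simp add: S.orthonormal_def)
  obtain F where F: "finite F" "{} \<subseteq> F" "F \<subseteq> funs_on (shape_words ns)" "S.orthonormal F"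
    "cfun.span F = specht_module ns" "card F = cfun.dim (specht_module ns)"
    by (rule S.orthonormal_basis_extend[OF subspace_specht_module sp fin sub empty_subsetI finite.emptyI on])
  show ?thesis by (rule that[OF F(1,4,3,5,6)])
qed

context unitary_frame
begin

lemma tensor_norm_coord:
  assumes "v \<in> tensor_space n"
  shows "(\<Sum>w\<in>frame_words n. (cmod (coord n v w))\<^sup>2) = Re (tensor_cinner n v v)"
proof -
  have "tensor_cinner n v v = of_real (\<Sum>w\<in>frame_words n. (cmod (coord n v w))\<^sup>2)"
    unfolding tensor_cinner_coord[OF assms] of_real_sum complex_norm_square by (simp add: mult.commute)
  then show ?thesis by simp
qed

context
  fixes c :: "nat \<Rightarrow> real" and A :: "complex ^ 'a ^ 'a"
  assumes A: "\<And>a b. (\<Sum>i<CARD('a). of_real (c i) * (u i $ a * cnj (u i $ b))) = A $ a $ b"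
begin

lemma tensor_power_quadratic_form:
  "Re (tensor_cinner n v (tensor_power n A v)) =
    (\<Sum>w\<in>frame_words n. (\<Prod>k<n. c (w ! k)) * (cmod (coord n v w))\<^sup>2)"
proof -
  have "tensor_cinner n v (tensor_power n A v) =
      (\<Sum>w\<in>frame_words n. (\<Prod>k<n. of_real (c (w ! k))) * (coord n v w * cnj (coord n v w)))"
    unfolding tensor_cinner_tensor_power[OF A] by (simp add: mult.commute)
  also have "\<dots> = of_real (\<Sum>w\<in>frame_words n. (\<Prod>k<n. c (w ! k)) * (cmod (coord n v w))\<^sup>2)"
    unfolding of_real_sum of_real_mult of_real_prod complex_norm_square ..
  finally show ?thesis by (simp only: Re_complex_of_real)
qed

text \<open>An orthonormal basis of a single Specht copy accounts for the left side: every index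
  word of its vectors has the same eigenvalue. The remaining diagonal terms of the trace are
  nonnegative and are dropped.\<close>

lemma schur_weyl_prob_ge:
  assumes len: "length ns = CARD('a)" and c0: "\<And>i. i < CARD('a) \<Longrightarrow> 0 \<le> c i"
  shows "(\<Prod>i<CARD('a). c i ^ (ns ! i)) * cfun.dim (specht_module ns) \<le> schur_weyl_prob A ns"
proof -
  let ?n = "sum_list ns" and ?X = "shape_words ns"
  let ?q = "\<lambda>v. Re (tensor_cinner ?n v (tensor_power ?n A v))"
  interpret S: complex_inner_space cscale "funs_on ?X" "fun_cinner ?X"
    by (rule fun_cinner_inner_space) simp
  obtain E where E: "finite E" "S.orthonormal E" "E \<subseteq> funs_on ?X" "cfun.span E = specht_module ns"
    "card E = cfun.dim (specht_module ns)"
    by (rule specht_orthonormal_basis)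
  have Xf: "?X \<subseteq> frame_words ?n"
    using shape_words_subset_words[of ns] len by (simp add: frame_words_def)
  have cs: "coord ?n (synth ?n v) = v" if "v \<in> funs_on ?X" for v
    using that funs_on_mono[OF Xf] by (intro coord_synth) blast
  have VX: "specht_module ns \<subseteq> funs_on ?X" by (rule specht_module_shape_funs)
  have inj: "inj_on (synth ?n) (funs_on ?X)" using cs by (metis inj_onI)
  have fip: "fun_cinner (frame_words ?n) v v' = fun_cinner ?X v v'" if "v \<in> funs_on ?X" for v v'
    unfolding fun_cinner_def
    by (rule sum.mono_neutral_right[OF finite_frame_words Xf]) (use that in \<open>auto simp: funs_on_def\<close>)
  have ip: "tensor_cinner ?n (synth ?n v) (synth ?n v') = fun_cinner ?X v v'"
    if "v \<in> funs_on ?X" "v' \<in> funs_on ?X" for v v'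
    unfolding tensor_cinner_synth cs[OF that(2)] by (rule fip[OF that(1)])
  have "synth ?n ` specht_module ns \<subseteq> schur_weyl_space ns"
  proof -
    have "perm_submodule ?n (synth ?n ` specht_module ns)"
      unfolding perm_submodule_def cfun.subspace_def
    proof (intro conjI allI impI ballI)
      have "synth ?n 0 = 0" by (auto simp: synth_def fun_eq_iff)
      then show "0 \<in> synth ?n ` specht_module ns"
        using cfun.subspace_0[OF subspace_specht_module] by (metis imageI)
    next
      fix x y assume "x \<in> synth ?n ` specht_module ns" "y \<in> synth ?n ` specht_module ns"
      then obtain v w where vw: "v \<in> specht_module ns" "w \<in> specht_module ns" "x = synth ?n v" "y = synth ?n w"
        by blast
      show "x + y \<in> synth ?n ` specht_module ns"
        unfolding vw(3,4) synth_add[symmetric]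
        by (rule imageI, rule cfun.subspace_add[OF subspace_specht_module vw(1,2)])
    next
      fix c x assume "x \<in> synth ?n ` specht_module ns"
      then obtain v where v: "v \<in> specht_module ns" "x = synth ?n v" by blast
      show "cscale c x \<in> synth ?n ` specht_module ns"
        unfolding v(2) synth_cscale[symmetric]
        by (rule imageI, rule cfun.subspace_scale[OF subspace_specht_module v(1)])
    next
      show "synth ?n ` specht_module ns \<subseteq> tensor_space ?n" using synth_tensor_space by blast
    next
      fix \<pi> x assume \<pi>: "\<pi> permutes {..<?n}" and "x \<in> synth ?n ` specht_module ns"
      then obtain v where v: "v \<in> specht_module ns" "x = synth ?n v" by blast
      show "perm_act \<pi> x \<in> synth ?n ` specht_module ns"
        unfolding v(2) synth_perm_act[OF \<pi>, symmetric]
        by (rule imageI, rule perm_act_specht_module[OF \<pi> v(1)])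
    qed
    moreover have "perm_isomorphic ?n (specht_module ns) (synth ?n ` specht_module ns)"
      unfolding perm_isomorphic_def
      using inj_on_subset[OF inj VX] synth_add synth_cscale synth_perm_act
      by (intro exI[of _ "synth ?n"]) (auto simp: bij_betw_def)
    ultimately show ?thesis unfolding schur_weyl_space_def by (auto intro: cfun.span_base)
  qed
  then have EW: "synth ?n ` E \<subseteq> schur_weyl_space ns" using E(4) cfun.span_superset by blast
  have injE: "inj_on (synth ?n) E" using inj_on_subset[OF inj E(3)] .
  have EX: "e \<in> funs_on ?X" if "e \<in> E" for e using that E(3) by blast
  have onE: "tensor.orthonormal ?n (synth ?n ` E)"
    unfolding tensor.orthonormal_def
  proof (intro ballI)
    fix a b assume "a \<in> synth ?n ` E" "b \<in> synth ?n ` E"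
    then obtain e e' where e: "e \<in> E" "e' \<in> E" "a = synth ?n e" "b = synth ?n e'" by blast
    then show "tensor_cinner ?n a b = (if a = b then 1 else 0)"
      using ip[OF EX EX] S.orthonormalD[OF E(2)] inj_onD[OF injE] by auto
  qed
  have finB: "finite (basis_vec ` (words ?n :: 'a list set))" by (intro finite_imageI finite_words)
  have subB: "basis_vec ` (words ?n :: 'a list set) \<subseteq> tensor_space ?n"
    unfolding tensor_space_eq_funs_on using basis_vec_funs_on by blast
  have finE: "finite (synth ?n ` E)" using E(1) by blast
  obtain F where F: "finite F" "synth ?n ` E \<subseteq> F" "F \<subseteq> tensor_space ?n" "tensor.orthonormal ?n F"
    "cfun.span F = schur_weyl_space ns"
    by (rule tensor.orthonormal_basis_extend[OF subspace_schur_weyl_space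
          schur_weyl_space_finite_span finB subB EW finE onE])
  have q_nonneg: "0 \<le> ?q v" for v
    unfolding tensor_power_quadratic_form
  proof (intro sum_nonneg mult_nonneg_nonneg prod_nonneg)
    fix w k assume "w \<in> frame_words ?n" "k \<in> {..<?n}"
    then have "w ! k \<in> set w" "set w \<subseteq> {..<CARD('a)}" by (auto simp: frame_words_def)
    then show "0 \<le> c (w ! k)" using c0 by blast
  qed auto
  have q_synth: "?q (synth ?n e) = (\<Prod>i<CARD('a). c i ^ (ns ! i))" if "e \<in> E" for e
  proof -
    have "?q (synth ?n e) = (\<Sum>w\<in>frame_words ?n. (\<Prod>k<?n. c (w ! k)) * (cmod (e w))\<^sup>2)"
      unfolding tensor_power_quadratic_form cs[OF EX[OF that]] ..
    also have "\<dots> = (\<Sum>w\<in>?X. (\<Prod>k<?n. c (w ! k)) * (cmod (e w))\<^sup>2)"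
      by (rule sum.mono_neutral_right[OF finite_frame_words Xf])
        (use EX[OF that] in \<open>auto simp: funs_on_def\<close>)
    also have "\<dots> = (\<Prod>i<CARD('a). c i ^ (ns ! i)) * (\<Sum>w\<in>?X. (cmod (e w))\<^sup>2)"
      using prod_letters_shape_word[of _ ns c] len by (simp add: sum_distrib_left)
    also have "(\<Sum>w\<in>?X. (cmod (e w))\<^sup>2) = 1"
    proof -
      have "complex_of_real (\<Sum>w\<in>?X. (cmod (e w))\<^sup>2) = fun_cinner ?X e e"
        unfolding fun_cinner_def of_real_sum complex_norm_square by (simp add: mult.commute)
      also have "\<dots> = 1" using S.orthonormalD[OF E(2) that that] by simp
      finally show ?thesis by (metis of_real_eq_1_iff)
    qed
    finally show ?thesis by simp
  qed
  have "(\<Prod>i<CARD('a). c i ^ (ns ! i)) * cfun.dim (specht_module ns) = (\<Sum>v\<in>synth ?n ` E. ?q v)"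
    using E(5) q_synth by (simp add: sum.reindex[OF injE] mult.commute)
  also have "\<dots> \<le> (\<Sum>v\<in>F. ?q v)" by (rule sum_mono2[OF F(1,2)]) (use q_nonneg in blast)
  also have "\<dots> = schur_weyl_prob A ns" by (rule schur_weyl_prob_orthonormal[OF F(1,4,3,5), symmetric])
  finally show ?thesis .
qed

end

end

text \<open>Moving exponents to earlier, larger factors increases the product. The power of
  \<open>q\<close> carries the surplus of \<open>l\<close> over \<open>m\<close> not yet matched by
  later factors, so that the induction closes; with equal totals it is \<open>q ^ 0 = 1\<close>,
  even for \<open>q = 0\<close>.\<close>

lemma prod_power_majorize:
  fixes p :: "nat \<Rightarrow> real"
  assumes "\<And>k. k \<le> d \<Longrightarrow> (\<Sum>i<k. m i) \<le> (\<Sum>i<k. l i)"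
    and "\<And>i j. i \<le> j \<Longrightarrow> j < d \<Longrightarrow> p j \<le> p i" "0 \<le> q" "\<And>i. i < d \<Longrightarrow> q \<le> p i"
  shows "(\<Prod>i<d. p i ^ m i) * q ^ ((\<Sum>i<d. l i) - (\<Sum>i<d. m i)) \<le> (\<Prod>i<d. p i ^ l i)"
  using assms
proof (induction d arbitrary: q)
  case (Suc d)
  define M where "M = (\<Sum>i<d. m i)"
  define L where "L = (\<Sum>i<d. l i)"
  have MLle: "M \<le> L" "M + m d \<le> L + l d"
    using Suc.prems(1)[of d] Suc.prems(1)[of "Suc d"] by (auto simp: M_def L_def)
  have qd: "q \<le> p d" "0 \<le> p d" using Suc.prems(3) Suc.prems(4)[of d] by auto
  have p0: "0 \<le> (\<Prod>i<d. p i ^ m i)"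
    using Suc.prems(3,4) by (intro prod_nonneg zero_le_power) (meson lessThan_iff less_SucI order_trans)
  \<comment> \<open>The surplus left by the first \<open>d\<close> factors is charged at the value
    \<open>p d\<close>.\<close>
  have IH: "(\<Prod>i<d. p i ^ m i) * p d ^ (L - M) \<le> (\<Prod>i<d. p i ^ l i)"
    unfolding L_def M_def by (rule Suc.IH) (use Suc.prems qd in auto)
  have "(\<Prod>i<Suc d. p i ^ m i) * q ^ ((\<Sum>i<Suc d. l i) - (\<Sum>i<Suc d. m i)) =
      (\<Prod>i<d. p i ^ m i) * (p d ^ m d * q ^ (L + l d - (M + m d)))"
    by (simp add: L_def M_def mult.assoc)
  also have "\<dots> \<le> (\<Prod>i<d. p i ^ m i) * (p d ^ m d * p d ^ (L + l d - (M + m d)))"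
    using Suc.prems(3) qd p0 by (intro mult_left_mono power_mono) auto
  also have "p d ^ m d * p d ^ (L + l d - (M + m d)) = p d ^ (L - M) * p d ^ l d"
    using MLle unfolding power_add[symmetric] by (intro arg_cong[of _ _ "power (p d)"]) simp
  also have "(\<Prod>i<d. p i ^ m i) * (p d ^ (L - M) * p d ^ l d) \<le> (\<Prod>i<d. p i ^ l i) * p d ^ l d"
    using IH qd by (simp add: mult_right_mono flip: mult.assoc)
  finally show ?case by simp
qed simp

lemma sum_count_list_prefix:
  fixes w :: "nat list"
  shows "(\<Sum>i<k. count_list w i) = card {a. a < length w \<and> w ! a < k}"
proof -
  have "(\<Sum>i<k. count_list w i) = (\<Sum>i<k. card {a. a < length w \<and> w ! a = i})"
    by (rule sum.cong) (auto simp: count_list_eq_length_filter length_filter_conv_card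
        intro!: arg_cong[of _ _ card])
  also have "\<dots> = (\<Sum>i<k. card {a \<in> {a. a < length w \<and> w ! a < k}. w ! a = i})"
    by (intro sum.cong refl arg_cong[of _ _ card]) auto
  also have "\<dots> = (\<Sum>i<k. \<Sum>a\<in>{a \<in> {a. a < length w \<and> w ! a < k}. w ! a = i}. 1)"
    by simp
  also have "\<dots> = (\<Sum>a\<in>{a. a < length w \<and> w ! a < k}. 1)"
    by (rule sum.group) auto
  finally show ?thesis by simp
qed

text \<open>Counted column by column: a column holds distinct letters, so it has at most
  \<open>min k h\<close> letters below \<open>k\<close>, where \<open>h\<close> is its height.
  Summing \<open>min k h\<close> over the columns counts the cells in the first \<open>k\<close>
  rows.\<close>

lemma column_distinct_prefix_le:
  assumes t: "t \<in> tableaux ns" and young: "ns \<in> young_indices d n" and w: "length w = n"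
    and dist: "\<And>a b. a < n \<Longrightarrow> b < n \<Longrightarrow> a \<noteq> b \<Longrightarrow> snd (t a) = snd (t b) \<Longrightarrow> w ! a \<noteq> w ! b"
    and k: "k \<le> d"
  shows "(\<Sum>i<k. count_list w i) \<le> (\<Sum>i<k. ns ! i)"
proof -
  have ns: "length ns = d" "sum_list ns = n" and mono: "\<And>i j. i < j \<Longrightarrow> j < d \<Longrightarrow> ns ! j \<le> ns ! i"
    using young by (auto simp: young_indices_def sorted_wrt_iff_nth_less)
  have bij: "bij_betw t {..<n} (young_cells ns)" using t ns by (simp add: tableaux_def)
  let ?S = "{a. a < n \<and> w ! a < k}"
  let ?C = "\<lambda>j. {i. i < k \<and> j < ns ! i}"
  have cell: "fst (t a) < d \<and> snd (t a) < ns ! fst (t a)" if "a < n" for a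
    using bij_betw_apply[OF bij, of a] that ns by (auto simp: young_cells_def split: prod.splits)
  have nsn: "ns ! i \<le> n" if "i < d" for i
    using that ns by (metis elem_le_sum_list)
  have "card {a \<in> ?S. snd (t a) = j} \<le> card (?C j)" for j
  \<comment> \<open>Column of height at least \<open>k\<close>: the bound is the number of available
    letters.\<close>
  proof (cases "\<forall>i<k. j < ns ! i")
    case True
    have "card {a \<in> ?S. snd (t a) = j} = card ((!) w ` {a \<in> ?S. snd (t a) = j})"
      by (rule card_image[symmetric], rule inj_onI) (use dist in auto)
    also have "\<dots> \<le> card {..<k}" by (rule card_mono) auto
    also have "{..<k} = ?C j" using True by auto
    finally show ?thesis .
  next
    case False
    \<comment> \<open>Column ending above row \<open>i0 < k\<close>: the bound is its height, since
      distinct points occupy distinct rows.\<close>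
    then obtain i0 where i0: "i0 < k" "ns ! i0 \<le> j" by (auto simp: not_less)
    have "card {a \<in> ?S. snd (t a) = j} = card ((\<lambda>a. fst (t a)) ` {a \<in> ?S. snd (t a) = j})"
    proof (rule card_image[symmetric], rule inj_onI)
      fix a b assume "a \<in> {a \<in> ?S. snd (t a) = j}" "b \<in> {a \<in> ?S. snd (t a) = j}" "fst (t a) = fst (t b)"
      then have "t a = t b" "a < n" "b < n" by (auto simp: prod_eq_iff)
      then show "a = b" using bij_betw_imp_inj_on[OF bij] by (auto dest: inj_onD)
    qed
    also have "\<dots> \<le> card (?C j)"
    proof (rule card_mono)
      show "(\<lambda>a. fst (t a)) ` {a \<in> ?S. snd (t a) = j} \<subseteq> ?C j"
      proof (rule image_subsetI)
        fix a assume a: "a \<in> {a \<in> ?S. snd (t a) = j}"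
        then have c: "fst (t a) < d" "j < ns ! fst (t a)" using cell[of a] by auto
        have "fst (t a) < i0"
        proof (rule ccontr)
          assume "\<not> fst (t a) < i0"
          then have "ns ! fst (t a) \<le> ns ! i0" using mono[of i0 "fst (t a)"] c(1) by (cases "fst (t a) = i0") auto
          then show False using c(2) i0(2) by simp
        qed
        then show "fst (t a) \<in> ?C j" using c i0(1) by simp
      qed
    qed simp
    finally show ?thesis .
  qed
  then have "(\<Sum>j<n. card {a \<in> ?S. snd (t a) = j}) \<le> (\<Sum>j<n. card (?C j))"
    by (intro sum_mono)
  moreover have "(\<Sum>j<n. card {a \<in> ?S. snd (t a) = j}) = card ?S"
  proof -
    have "(\<lambda>a. snd (t a)) ` ?S \<subseteq> {..<n}"
      using cell nsn by (auto intro: less_le_trans)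
    then have "(\<Sum>j<n. \<Sum>a\<in>{a \<in> ?S. snd (t a) = j}. 1) = (\<Sum>a\<in>?S. 1 :: nat)"
      by (intro sum.group) auto
    then show ?thesis by simp
  qed
  moreover have "(\<Sum>j<n. card (?C j)) = (\<Sum>i<k. ns ! i)"
  proof -
    have "(\<Sum>j<n. card (?C j)) = (\<Sum>j<n. \<Sum>i<k. if j < ns ! i then 1 else 0)"
      by (intro sum.cong refl) (simp add: sum.If_cases lessThan_def Int_def)
    also have "\<dots> = (\<Sum>i<k. \<Sum>j<n. if j < ns ! i then 1 else 0)" by (rule sum.swap)
    also have "\<dots> = (\<Sum>i<k. ns ! i)"
    proof (rule sum.cong[OF refl])
      fix i assume "i \<in> {..<k}"
      then have "{j. j < n \<and> j < ns ! i} = {..<ns ! i}" using nsn[of i] k by auto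
      then show "(\<Sum>j<n. if j < ns ! i then 1 else 0) = ns ! i"
        by (simp add: sum.If_cases lessThan_def Int_def)
    qed
    finally show ?thesis .
  qed
  ultimately show ?thesis unfolding sum_count_list_prefix w by simp
qed

context unitary_frame
begin

text \<open>If two points of one column carried the same letter, their transposition would fix
  \<open>w\<close> but reverse the sign of the coordinate, which would then vanish.\<close>

lemma column_antisymmetric_coord:
  assumes v: "\<And>\<pi>. \<pi> \<in> column_group n t \<Longrightarrow> perm_act \<pi> v = cscale (of_int (sign \<pi>)) v"
    and w: "w \<in> frame_words n" "coord n v w \<noteq> 0"
    and ab: "a < n" "b < n" "a \<noteq> b" "snd (t a) = snd (t b)"
  shows "w ! a \<noteq> w ! b"
proof
  assume eq: "w ! a = w ! b"
  let ?\<tau> = "Transposition.transpose a b"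
  have p: "?\<tau> permutes {..<n}" using ab by (intro permutes_swap_id) auto
  then have "?\<tau> \<in> column_group n t"
    using ab by (auto simp: column_group_def Transposition.transpose_def)
  then have "coord n (perm_act ?\<tau> v) = cscale (of_int (sign ?\<tau>)) (coord n v)"
    unfolding coord_cscale[symmetric] by (intro arg_cong[of _ _ "coord n"] v)
  then have "coord n (perm_act ?\<tau> v) w = - coord n v w"
    using ab(3) by (simp only: cscale_def sign_swap_id) simp
  moreover have "coord n (perm_act ?\<tau> v) w = coord n v (permute_list ?\<tau> w)"
    unfolding coord_perm_act[OF p] by (simp add: perm_act_def)
  moreover have "permute_list ?\<tau> w = w"
    using eq by (intro nth_equalityI) (auto simp: permute_list_def Transposition.transpose_def)
  ultimately show False using w(2) by simp
qed

lemma schur_weyl_space_weights: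
  assumes young: "ns \<in> young_indices CARD('a) n"
    and p: "\<And>i j. i \<le> j \<Longrightarrow> j < CARD('a) \<Longrightarrow> p j \<le> p i" "\<And>i. i < CARD('a) \<Longrightarrow> (0 :: real) \<le> p i"
    and v: "v \<in> schur_weyl_space ns" and w: "w \<in> frame_words n" "coord n v w \<noteq> 0"
  shows "(\<Prod>k<n. p (w ! k)) \<le> (\<Prod>i<CARD('a). p i ^ (ns ! i))"
proof -
  have ns: "length ns = CARD('a)" "sum_list ns = n" using young by (auto simp: young_indices_def)
  \<comment> \<open>Restricting which words may occur defines a subspace, so it suffices to look at
    the images of the generators of a Specht copy.\<close>
  define G where "G = {v. \<forall>w\<in>frame_words n. coord n v w \<noteq> 0 \<longrightarrow>
    (\<Prod>k<n. p (w ! k)) \<le> (\<Prod>i<CARD('a). p i ^ (ns ! i))}"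
  have G: "cfun.subspace G"
    unfolding cfun.subspace_def G_def
    by (auto simp: coord_add coord_cscale coord_zero) (auto simp: cscale_def)
  have "U \<subseteq> G" if U: "perm_submodule n U" "perm_isomorphic n (specht_module ns) U" for U
  proof -
    obtain f where f: "bij_betw f (specht_module ns) U"
      "\<And>u v. u \<in> specht_module ns \<Longrightarrow> v \<in> specht_module ns \<Longrightarrow> f (u + v) = f u + f v"
      "\<And>c v. v \<in> specht_module ns \<Longrightarrow> f (cscale c v) = cscale c (f v)"
      "\<And>\<pi> v. \<pi> permutes {..<n} \<Longrightarrow> v \<in> specht_module ns \<Longrightarrow> f (perm_act \<pi> v) = perm_act \<pi> (f v)"
      using U(2) unfolding perm_isomorphic_def by blast
    have poly: "polytabloid n t \<in> specht_module ns" if "t \<in> tableaux ns" for t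
      unfolding specht_module_def ns by (intro cfun.span_base imageI that)
    have gen: "f (polytabloid n t) \<in> G" if t: "t \<in> tableaux ns" for t
      unfolding G_def
    proof (intro CollectI ballI impI)
      fix w assume w: "w \<in> frame_words n" "coord n (f (polytabloid n t)) w \<noteq> 0"
      have wl: "set w \<subseteq> {..<CARD('a)}" "length w = n" using w by (auto simp: frame_words_def)
      have "perm_act \<pi> (f (polytabloid n t)) = cscale (of_int (sign \<pi>)) (f (polytabloid n t))"
        if "\<pi> \<in> column_group n t" for \<pi>
        using polytabloid_column_antisymmetric[OF that] f(3,4) poly[OF t] that
        by (metis (no_types, lifting) column_group_def mem_Collect_eq)
      then have dist: "\<And>a b. a < n \<Longrightarrow> b < n \<Longrightarrow> a \<noteq> b \<Longrightarrow> snd (t a) = snd (t b) \<Longrightarrow> w ! a \<noteq> w ! b"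
        using column_antisymmetric_coord[OF _ w] by blast
      have prefix: "(\<Sum>i<k. count_list w i) \<le> (\<Sum>i<k. ns ! i)" if "k \<le> CARD('a)" for k
        by (rule column_distinct_prefix_le[OF t young wl(2) dist that])
      have "(\<Sum>i<CARD('a). ns ! i) = n"
        using ns by (simp add: sum_list_sum_nth atLeast0LessThan)
      moreover have "{a. a < length w \<and> w ! a < CARD('a)} = {..<n}"
        using wl nth_mem by fastforce
      then have "(\<Sum>i<CARD('a). count_list w i) = n"
        unfolding sum_count_list_prefix by simp
      ultimately have "(\<Prod>i<CARD('a). p i ^ count_list w i) \<le> (\<Prod>i<CARD('a). p i ^ (ns ! i))"
        using prod_power_majorize[of "CARD('a)" "count_list w" "(!) ns" p 0] prefix p by simp
      then show "(\<Prod>k<n. p (w ! k)) \<le> (\<Prod>i<CARD('a). p i ^ (ns ! i))"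
        using prod_letters_eq_prod_counts[OF wl(1), of p] wl(2) by simp
    qed
    have "f v \<in> G" if "v \<in> specht_module ns" for v
    proof -
      \<comment> \<open>Membership is carried through the induction because \<open>f\<close> is
        additive on the Specht module only.\<close>
      have "v \<in> specht_module ns \<and> f v \<in> G"
        using that unfolding specht_module_def
      proof (induction rule: cfun.span_induct_alt)
        case base
        have "0 \<in> specht_module ns" by (rule cfun.subspace_0[OF subspace_specht_module])
        then have "f 0 = 0" using f(2)[of 0 0] by simp
        then have "f 0 \<in> G" using cfun.subspace_0[OF G] by (simp only:)
        then show ?case using cfun.span_zero by blast
      next
        case (step c x y)
        then obtain t where t: "t \<in> tableaux ns" "x = polytabloid n t" unfolding ns by auto
        have V: "x \<in> specht_module ns" "cscale c x \<in> specht_module ns" "y \<in> specht_module ns"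
          using poly t step cfun.subspace_scale[OF subspace_specht_module] by (auto simp: specht_module_def)
        then have fxy: "f (cscale c x + y) = cscale c (f x) + f y" using f(2,3) by simp
        have "f (cscale c x + y) \<in> G"
          unfolding fxy using gen[OF t(1)] t(2) step cfun.subspace_add[OF G] cfun.subspace_scale[OF G]
          by blast
        moreover have "cscale c x + y \<in> specht_module ns"
          using V cfun.subspace_add[OF subspace_specht_module] by blast
        ultimately show ?case unfolding specht_module_def by blast
      qed
      then show ?thesis by blast
    qed
    then show ?thesis using f(1) by (auto simp: bij_betw_def)
  qed
  then have "schur_weyl_space ns \<subseteq> G"
    unfolding schur_weyl_space_def ns using G by (intro cfun.span_minimal) auto
  then show ?thesis using v w unfolding G_def by blast
qed

end

text \<open>
  A homomorphism from the Specht module to the tensor power extends to the permutation module by the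
  orthogonal projection. Its matrix coefficient at the words \<open>x\<close> and \<open>z\<close> then depends only on the
  multiset of pairs of letters, which bounds the multiplicity polynomially.
\<close>

definition pair_contents :: "nat list \<Rightarrow> (nat \<times> 'a::finite) multiset set" where
  "pair_contents ns = {mset (zip x z) |x z. x \<in> shape_words ns \<and> z \<in> words (sum_list ns)}"

text \<open>The operator whose matrix is the indicator of one orbit of the symmetric group on pairs
  of words; every equivariant map from the permutation module is a combination of these.\<close>

definition pair_sum :: "nat list \<Rightarrow> (nat \<times> 'a::finite) multiset \<Rightarrow> (nat list \<Rightarrow> complex) \<Rightarrow> 'a list \<Rightarrow> complex" where
  "pair_sum ns J v z = (if z \<in> words (sum_list ns)
    then \<Sum>x\<in>shape_words ns. if mset (zip x z) = J then v x else 0 else 0)"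

text \<open>An orbit is determined by its table of counts, with \<open>length ns * CARD('a)\<close>
  entries between 0 and \<open>sum_list ns\<close>.\<close>

lemma pair_contents_bound:
  "finite (pair_contents ns :: (nat \<times> 'a::finite) multiset set)"
  "card (pair_contents ns :: (nat \<times> 'a) multiset set) \<le> (sum_list ns + 1) ^ (length ns * CARD('a))"
proof -
  let ?J = "pair_contents ns :: (nat \<times> 'a) multiset set"
  let ?D = "{..<length ns} \<times> (UNIV :: 'a set)"
  let ?P = "PiE ?D (\<lambda>_. {..sum_list ns})"
  let ?c = "\<lambda>J. restrict (count J) ?D"
  have J: "set_mset J \<subseteq> ?D" "size J = sum_list ns" if "J \<in> ?J" for J
  proof -
    obtain x z where xz: "J = mset (zip x z)" "x \<in> shape_words ns" "z \<in> words (sum_list ns)"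
      using \<open>J \<in> ?J\<close> by (auto simp: pair_contents_def)
    show "set_mset J \<subseteq> ?D"
      using xz(1) set_shape_word[OF xz(2)] by (auto dest: set_zip_leftD)
    show "size J = sum_list ns"
      using xz length_shape_word[OF xz(2)] by (simp add: words_def)
  qed
  have inj: "inj_on ?c ?J"
  proof (rule inj_onI)
    fix J K assume JK: "J \<in> ?J" "K \<in> ?J" "?c J = ?c K"
    show "J = K"
    proof (rule multiset_eqI)
      fix y show "count J y = count K y"
      proof (cases "y \<in> ?D")
        case True
        then show ?thesis using fun_cong[OF JK(3), of y] by simp
      next
        case False
        then show ?thesis using J(1)[OF JK(1)] J(1)[OF JK(2)] by (metis not_in_iff subsetD)
      qed
    qed
  qed
  have img: "?c ` ?J \<subseteq> ?P"
  proof (rule image_subsetI)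
    fix M assume M: "M \<in> ?J"
    show "?c M \<in> ?P"
      using count_le_size[of M] J(2)[OF M] by (auto simp: restrict_PiE_iff)
  qed
  have fin: "finite ?P" by (intro finite_PiE) auto
  show "finite ?J" using inj_on_finite[OF inj img fin] .
  have "card ?J \<le> card ?P" by (rule card_inj_on_le[OF inj img fin])
  also have "card ?P = (sum_list ns + 1) ^ (length ns * CARD('a))"
    by (simp add: card_PiE card_cartesian_product)
  finally show "card ?J \<le> (sum_list ns + 1) ^ (length ns * CARD('a))" .
qed

lemma sum_cscale_hom:
  assumes V: "cfun.subspace V"
    and add: "\<And>u v. u \<in> V \<Longrightarrow> v \<in> V \<Longrightarrow> f (u + v) = f u + f v"
    and scale: "\<And>c v. v \<in> V \<Longrightarrow> f (cscale c v) = cscale c (f v)"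
    and g: "\<And>i. i \<in> I \<Longrightarrow> g i \<in> V"
  shows "f (\<Sum>i\<in>I. cscale (c i) (g i)) = (\<Sum>i\<in>I. cscale (c i) (f (g i)))"
proof -
  have 0: "f 0 = 0" using add[of 0 0] cfun.subspace_0[OF V] by simp
  show ?thesis using g
  proof (induction I rule: infinite_finite_induct)
    case (insert i I)
    have "(\<Sum>i\<in>I. cscale (c i) (g i)) \<in> V"
      using insert.prems by (intro cfun.subspace_sum[OF V] cfun.subspace_scale[OF V]) auto
    moreover have "cscale (c i) (g i) \<in> V" using insert.prems cfun.subspace_scale[OF V] by auto
    ultimately have 1: "f (cscale (c i) (g i) + (\<Sum>i\<in>I. cscale (c i) (g i))) =
        f (cscale (c i) (g i)) + f (\<Sum>i\<in>I. cscale (c i) (g i))"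
      using add by blast
    have 2: "f (cscale (c i) (g i)) = cscale (c i) (f (g i))"
      using insert.prems by (intro scale) simp
    have 3: "f (\<Sum>i\<in>I. cscale (c i) (g i)) = (\<Sum>i\<in>I. cscale (c i) (f (g i)))"
      using insert.prems by (intro insert.IH) simp
    show ?case unfolding sum.insert[OF insert.hyps] 1 2 3 ..
  qed (simp_all only: sum.infinite sum.empty 0 not_False_eq_True)
qed

text \<open>Invariance of the form is what makes the orthogonal projection onto the Specht module
  equivariant.\<close>

lemma fun_cinner_perm_act:
  assumes "\<pi> permutes {..<sum_list ns}"
  shows "fun_cinner (shape_words ns) (perm_act \<pi> u) (perm_act \<pi> v) = fun_cinner (shape_words ns) u v"
proof -
  have "bij_betw (permute_list \<pi>) (shape_words ns) (shape_words ns)"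
  proof (rule bij_betw_byWitness[where f' = "permute_list (inv \<pi>)"])
    have p: "\<pi> permutes {..<length w}" if "w \<in> shape_words ns" for w
      using assms length_shape_word[OF that] by simp
    show "\<forall>w\<in>shape_words ns. permute_list (inv \<pi>) (permute_list \<pi> w) = w"
      "\<forall>w\<in>shape_words ns. permute_list \<pi> (permute_list (inv \<pi>) w) = w"
      using permute_list_inv[OF p] by auto
    show "permute_list \<pi> ` shape_words ns \<subseteq> shape_words ns"
      using mset_permute_list[OF p] by (auto simp: shape_words_iff)
    show "permute_list (inv \<pi>) ` shape_words ns \<subseteq> shape_words ns"
      using mset_permute_list[OF permutes_inv[OF p]] by (auto simp: shape_words_iff)
  qed
  then show ?thesis
    unfolding fun_cinner_def perm_act_def by (rule sum.reindex_bij_betw)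
qed

text \<open>The spanning family does not depend on \<open>U\<close>, so it spans all copies of the
  Specht module, and hence the isotypic component, at once.\<close>

lemma isomorphic_submodule_span:
  fixes U :: "('a::finite list \<Rightarrow> complex) set"
  assumes U: "perm_submodule (sum_list ns) U" "perm_isomorphic (sum_list ns) (specht_module ns) U"
    and E: "cfun.span E = specht_module ns"
  shows "U \<subseteq> cfun.span (\<Union>J\<in>pair_contents ns. pair_sum ns J ` E)"
proof
  fix y assume "y \<in> U"
  let ?n = "sum_list ns" and ?V = "specht_module ns" and ?X = "shape_words ns"
  interpret S: complex_inner_space cscale "funs_on ?X" "fun_cinner ?X"
    by (rule fun_cinner_inner_space) simp
  have Vsub: "cfun.subspace ?V" and VX: "?V \<subseteq> funs_on ?X"
    by (rule subspace_specht_module, rule specht_module_shape_funs)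
  obtain f where f: "bij_betw f ?V U"
    "\<And>u v. u \<in> ?V \<Longrightarrow> v \<in> ?V \<Longrightarrow> f (u + v) = f u + f v"
    "\<And>c v. v \<in> ?V \<Longrightarrow> f (cscale c v) = cscale c (f v)"
    "\<And>\<pi> v. \<pi> permutes {..<?n} \<Longrightarrow> v \<in> ?V \<Longrightarrow> f (perm_act \<pi> v) = perm_act \<pi> (f v)"
    using U(2) unfolding perm_isomorphic_def by blast
  obtain v where v: "v \<in> ?V" "y = f v" using \<open>y \<in> U\<close> f(1) by (auto simp: bij_betw_def)
  obtain F where F: "finite F" "S.orthonormal F" "F \<subseteq> funs_on ?X" "cfun.span F = ?V"
    "card F = cfun.dim ?V"
    by (rule specht_orthonormal_basis)
  define Q where "Q = orth_proj (fun_cinner ?X) ?V"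
  have Q: "Q a = (\<Sum>e\<in>F. cscale (fun_cinner ?X e a) e)" for a
    unfolding Q_def by (rule S.orth_proj_orthonormal[OF F(1-4)])
  have QV: "Q a \<in> ?V" for a
    unfolding Q F(4)[symmetric] by (intro cfun.span_sum cfun.span_scale cfun.span_base)
  have Qorth: "fun_cinner ?X s (a - Q a) = 0" if "s \<in> ?V" for s a
    unfolding Q using that F(4) by (intro S.ip_residual_orthonormal[OF F(1,2)]) simp
  have Qperm: "Q (perm_act \<pi> a) = perm_act \<pi> (Q a)" if \<pi>: "\<pi> permutes {..<?n}" for \<pi> a
    unfolding Q_def
  proof (rule S.orth_proj_eqI[OF Vsub VX])
    show "perm_act \<pi> (orth_proj (fun_cinner ?X) ?V a) \<in> ?V"
      using perm_act_specht_module[OF \<pi> QV] unfolding Q_def .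
    fix s assume s: "s \<in> ?V"
    define s' where "s' = perm_act (inv \<pi>) s"
    have s': "s' \<in> ?V" unfolding s'_def by (rule perm_act_specht_module[OF permutes_inv[OF \<pi>] s])
    have "s \<in> tensor_space ?n" using s VX shape_funs_tensor_space by blast
    then have ss: "s = perm_act \<pi> s'"
      unfolding s'_def using perm_act_compose[OF _ permutes_inv[OF \<pi>], of s \<pi>] permutes_inv_o(1)[OF \<pi>]
      by (simp add: perm_act_id)
    have "perm_act \<pi> a - perm_act \<pi> (orth_proj (fun_cinner ?X) ?V a) = perm_act \<pi> (a - Q a)"
      by (simp add: perm_act_def Q_def fun_eq_iff)
    then show "fun_cinner ?X s (perm_act \<pi> a - perm_act \<pi> (orth_proj (fun_cinner ?X) ?V a)) = 0"
      unfolding ss using fun_cinner_perm_act[OF \<pi>] Qorth[OF s'] by simp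
  qed
  have Qv: "Q v = v"
    unfolding Q using S.orthonormal_expansion[OF F(1,2), of v] v(1) F(4) by simp
  \<comment> \<open>\<open>K x\<close> is the column at \<open>x\<close> of the map \<open>f\<close>
    composed with \<open>Q\<close>, defined on the whole permutation module; on the Specht module
    this map agrees with \<open>f\<close>.\<close>
  define K where "K x = f (Q (basis_vec x))" for x
  have fv: "f v = (\<Sum>x\<in>?X. cscale (v x) (K x))"
  proof -
    have "v = Q (\<Sum>x\<in>?X. cscale (v x) (basis_vec x))"
      using funs_on_expansion[of ?X v] Qv v(1) VX by auto
    also have "\<dots> = (\<Sum>x\<in>?X. cscale (v x) (Q (basis_vec x)))"
      unfolding Q_def by (rule S.orth_proj_linear_combination[OF F(1-4)])
    finally have "f v = f (\<Sum>x\<in>?X. cscale (v x) (Q (basis_vec x)))" by simp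
    also have "\<dots> = (\<Sum>x\<in>?X. cscale (v x) (K x))"
      unfolding K_def by (rule sum_cscale_hom[OF Vsub f(2,3) QV])
    finally show ?thesis .
  qed
  have Kperm: "K (permute_list \<pi> x) (permute_list \<pi> z) = K x z"
    if \<pi>: "\<pi> permutes {..<?n}" and x: "length x = ?n" and z: "length z = ?n" for \<pi> x z
  proof -
    have i: "inv \<pi> permutes {..<?n}" by (rule permutes_inv[OF \<pi>])
    have "basis_vec (permute_list \<pi> x) = perm_act (inv \<pi>) (basis_vec x)"
      using perm_act_basis_vec[of "inv \<pi>" x] i x permutes_inv_inv[OF \<pi>] by simp
    then have "K (permute_list \<pi> x) = perm_act (inv \<pi>) (K x)"
      unfolding K_def using Qperm[OF i] f(4)[OF i QV] by simp
    then show ?thesis using permute_list_inv(1)[of \<pi> z] \<pi> z by (simp add: perm_act_def)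
  qed
  have Kdep: "K x z = K x' z'"
    if eq: "mset (zip x z) = mset (zip x' z')" and "x \<in> ?X" "x' \<in> ?X" "z \<in> words ?n" "z' \<in> words ?n" for x z x' z'
  proof -
    have l: "length x = ?n" "length x' = ?n" "length z = ?n" "length z' = ?n"
      using that length_shape_word by (auto simp: words_def)
    \<comment> \<open>Equal pair contents mean that one permutation carries both words over
      simultaneously.\<close>
    obtain \<pi> where "\<pi> permutes {..<length (zip x' z')}" and \<pi>z: "permute_list \<pi> (zip x' z') = zip x z"
      by (rule mset_eq_permutation[OF eq])
    then have \<pi>: "\<pi> permutes {..<?n}" using l by simp
    have "zip (permute_list \<pi> x') (permute_list \<pi> z') = zip x z"
      using \<pi>z permute_list_zip[OF \<pi>, of x' z'] l by simp
    then have "permute_list \<pi> x' = x" "permute_list \<pi> z' = z"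
      using l by (metis length_permute_list map_fst_zip, metis length_permute_list map_snd_zip)
    then show ?thesis using Kperm[OF \<pi> l(2,4)] by simp
  qed
  \<comment> \<open>The common kernel value on the orbit \<open>J\<close>; the choice is harmless
    because the kernel is constant on orbits.\<close>
  define \<kappa> where "\<kappa> J = (SOME c. \<exists>x\<in>?X. \<exists>z\<in>words ?n. mset (zip x z) = J \<and> c = K x z)" for J
  have \<kappa>: "K x z = \<kappa> (mset (zip x z))" if "x \<in> ?X" "z \<in> words ?n" for x z
  proof -
    have "\<exists>x'\<in>?X. \<exists>z'\<in>words ?n. mset (zip x' z') = mset (zip x z) \<and> \<kappa> (mset (zip x z)) = K x' z'"
      unfolding \<kappa>_def by (rule someI) (use that in blast)
    then show ?thesis using Kdep that by metis
  qed
  have y_exp: "y = (\<Sum>J\<in>pair_contents ns. cscale (\<kappa> J) (pair_sum ns J v))"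
  proof
    fix z
    show "y z = (\<Sum>J\<in>pair_contents ns. cscale (\<kappa> J) (pair_sum ns J v)) z"
    proof (cases "z \<in> words ?n")
      case True
      have "(\<Sum>J\<in>pair_contents ns. cscale (\<kappa> J) (pair_sum ns J v)) z =
          (\<Sum>J\<in>pair_contents ns. \<Sum>x\<in>?X. if mset (zip x z) = J then \<kappa> J * v x else 0)"
        unfolding sum_apply cscale_def pair_sum_def using True
        by (simp add: sum_distrib_left if_distrib cong: if_cong)
      also have "\<dots> = (\<Sum>x\<in>?X. \<Sum>J\<in>pair_contents ns. if mset (zip x z) = J then \<kappa> J * v x else 0)"
        by (rule sum.swap)
      also have "\<dots> = (\<Sum>x\<in>?X. \<kappa> (mset (zip x z)) * v x)"
      proof (rule sum.cong[OF refl])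
        fix x assume "x \<in> ?X"
        then have "mset (zip x z) \<in> pair_contents ns" using True by (auto simp: pair_contents_def)
        then show "(\<Sum>J\<in>pair_contents ns. if mset (zip x z) = J then \<kappa> J * v x else 0) = \<kappa> (mset (zip x z)) * v x"
          by (simp add: sum.delta' pair_contents_bound(1))
      qed
      also have "\<dots> = (\<Sum>x\<in>?X. v x * K x z)"
        by (rule sum.cong) (use \<kappa> True in \<open>auto simp: mult.commute\<close>)
      also have "\<dots> = y z" unfolding v(2) fv sum_apply by (simp add: cscale_def)
      finally show ?thesis by simp
    next
      case False
      moreover have "y \<in> tensor_space ?n" using \<open>y \<in> U\<close> U(1) by (auto simp: perm_submodule_def)
      ultimately show ?thesis by (simp add: sum_apply cscale_def pair_sum_def tensor_space_def)
    qed
  qed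
  have "pair_sum ns J v \<in> cfun.span (pair_sum ns J ` E)" for J :: "(nat \<times> 'a) multiset"
    using v(1) unfolding E[symmetric]
  proof (induction rule: cfun.span_induct_alt)
    case base
    have "pair_sum ns J 0 = 0" by (auto simp: pair_sum_def fun_eq_iff intro!: sum.neutral)
    then show ?case by (simp only: cfun.span_zero)
  next
    case (step c x y)
    have "pair_sum ns J (cscale c x + y) = cscale c (pair_sum ns J x) + pair_sum ns J y"
      by (auto simp: pair_sum_def cscale_def fun_eq_iff sum_distrib_left sum.distrib[symmetric]
          intro!: sum.cong)
    then show ?case
      using step cfun.span_add[OF cfun.span_scale[OF cfun.span_base]] by (metis imageI)
  qed
  then have "pair_sum ns J v \<in> cfun.span (\<Union>J\<in>pair_contents ns. pair_sum ns J ` E)"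
    if "J \<in> pair_contents ns" for J :: "(nat \<times> 'a) multiset"
    using that cfun.span_mono[of "pair_sum ns J ` E" "\<Union>J\<in>pair_contents ns. pair_sum ns J ` E"] by blast
  then show "y \<in> cfun.span (\<Union>J\<in>pair_contents ns. pair_sum ns J ` E)"
    unfolding y_exp by (intro cfun.span_sum cfun.span_scale)
qed

text \<open>The polynomial factor stands in for the dimension of \<open>U_n\<close>.\<close>

lemma dim_schur_weyl_space_le:
  "cfun.dim (schur_weyl_space ns :: ('a::finite list \<Rightarrow> complex) set) \<le>
    (sum_list ns + 1) ^ (length ns * CARD('a)) * cfun.dim (specht_module ns)"
proof -
  obtain E where E: "finite E" "cfun.span E = specht_module ns" "card E = cfun.dim (specht_module ns)"
    by (rule specht_orthonormal_basis[of ns])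
  let ?J = "pair_contents ns :: (nat \<times> 'a) multiset set"
  let ?G = "\<Union>J\<in>?J. pair_sum ns J ` E"
  have fin: "finite ?G" using pair_contents_bound(1) E(1) by auto
  have "schur_weyl_space ns \<subseteq> cfun.span ?G"
    unfolding schur_weyl_space_def
    using isomorphic_submodule_span[OF _ _ E(2)] by (intro cfun.span_minimal) auto
  then have "cfun.dim (schur_weyl_space ns :: ('a list \<Rightarrow> complex) set) \<le> card ?G"
    by (rule cfun.dim_le_card[OF _ fin])
  also have "\<dots> \<le> (\<Sum>J\<in>?J. card (pair_sum ns J ` E))"
    by (rule card_UN_le[OF pair_contents_bound(1)])
  also have "\<dots> \<le> (\<Sum>J\<in>?J. card E)" by (intro sum_mono card_image_le E(1))
  also have "\<dots> = card ?J * card E" by simp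
  also have "\<dots> \<le> (sum_list ns + 1) ^ (length ns * CARD('a)) * card E"
    using pair_contents_bound(2)[where 'a = 'a] by (rule mult_le_mono1)
  finally show ?thesis unfolding E(3) .
qed

section \<open>The upper probability bound\<close>

context unitary_frame
begin

text \<open>Each diagonal entry of the trace is an average, with weights \<open>|coord|^2\<close>,
  of the eigenvalues of the words that occur. All are at most that of the shape, and there are as
  many entries as the dimension of the component.\<close>

lemma schur_weyl_prob_le:
  assumes A: "\<And>a b. (\<Sum>i<CARD('a). of_real (c i) * (u i $ a * cnj (u i $ b))) = A $ a $ b"
    and young: "ns \<in> young_indices CARD('a) n"
    and c: "\<And>i j. i \<le> j \<Longrightarrow> j < CARD('a) \<Longrightarrow> c j \<le> c i" "\<And>i. i < CARD('a) \<Longrightarrow> (0 :: real) \<le> c i"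
  shows "schur_weyl_prob A ns \<le>
    (real n + 1) ^ (CARD('a) * CARD('a)) * ((\<Prod>i<CARD('a). c i ^ (ns ! i)) * cfun.dim (specht_module ns))"
proof -
  have ns: "length ns = CARD('a)" "sum_list ns = n" using young by (auto simp: young_indices_def)
  let ?W = "schur_weyl_space ns :: ('a list \<Rightarrow> complex) set"
  let ?m = "\<Prod>i<CARD('a). c i ^ (ns ! i)"
  have m0: "0 \<le> ?m" using c(2) by (intro prod_nonneg) auto
  have fin: "finite (basis_vec ` (words n :: 'a list set))" by (intro finite_imageI finite_words)
  have sub: "basis_vec ` (words n :: 'a list set) \<subseteq> tensor_space n"
    unfolding tensor_space_eq_funs_on using basis_vec_funs_on by blast
  have on: "tensor.orthonormal n {}" by (simp add: tensor.orthonormal_def)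
  obtain F :: "('a list \<Rightarrow> complex) set" where F: "finite F" "{} \<subseteq> F" "F \<subseteq> tensor_space n"
    "tensor.orthonormal n F" "cfun.span F = ?W" "card F = cfun.dim ?W"
    by (rule tensor.orthonormal_basis_extend[OF subspace_schur_weyl_space
          schur_weyl_space_finite_span[of ns, unfolded ns] fin sub empty_subsetI _ on]) auto
  have FW: "F \<subseteq> ?W" using F(5) cfun.span_superset by blast
  have q: "Re (tensor_cinner n e (tensor_power n A e)) \<le> ?m" if e: "e \<in> F" for e
  proof -
    have "Re (tensor_cinner n e (tensor_power n A e)) =
        (\<Sum>w\<in>frame_words n. (\<Prod>k<n. c (w ! k)) * (cmod (coord n e w))\<^sup>2)"
      by (rule tensor_power_quadratic_form[OF A])
    also have "\<dots> \<le> (\<Sum>w\<in>frame_words n. ?m * (cmod (coord n e w))\<^sup>2)"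
    proof (rule sum_mono)
      fix w assume w: "w \<in> frame_words n"
      show "(\<Prod>k<n. c (w ! k)) * (cmod (coord n e w))\<^sup>2 \<le> ?m * (cmod (coord n e w))\<^sup>2"
      proof (cases "coord n e w = 0")
        case False
        have "(\<Prod>k<n. c (w ! k)) \<le> ?m"
          by (rule schur_weyl_space_weights[OF young c subsetD[OF FW e] w False])
        then show ?thesis by (intro mult_right_mono) auto
      qed simp
    qed
    also have "\<dots> = ?m * Re (tensor_cinner n e e)"
      unfolding sum_distrib_left[symmetric]
      using tensor_norm_coord[of e n] e F(3) by auto
    also have "\<dots> = ?m" using tensor.orthonormalD[OF F(4) e e] by simp
    finally show ?thesis .
  qed
  have "schur_weyl_prob A ns = (\<Sum>e\<in>F. Re (tensor_cinner n e (tensor_power n A e)))"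
    using schur_weyl_prob_orthonormal[of F ns A] F unfolding ns by blast
  also have "\<dots> \<le> (\<Sum>e\<in>F. ?m)" by (rule sum_mono[OF q])
  also have "\<dots> = real (cfun.dim ?W) * ?m" using F(6) by simp
  also have "\<dots> \<le> real ((n + 1) ^ (CARD('a) * CARD('a)) * cfun.dim (specht_module ns)) * ?m"
    using dim_schur_weyl_space_le[of ns, where 'a = 'a] m0 unfolding ns
    by (intro mult_right_mono) (auto simp del: of_nat_mult of_nat_power)
  also have "\<dots> = (real n + 1) ^ (CARD('a) * CARD('a)) * (?m * cfun.dim (specht_module ns))"
    by (simp add: mult_ac add.commute)
  finally show ?thesis .
qed

end

section \<open>Entropy optimization over probability vectors\<close>

text \<open>Used to read off, from a sorted vector, the size of its support and the multiplicity of
  its largest entry.\<close>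

lemma initial_segment:
  assumes "\<And>i j. i \<le> j \<Longrightarrow> j < d \<Longrightarrow> Q j \<Longrightarrow> Q i"
  shows "\<exists>m\<le>d. \<forall>i<d. Q i \<longleftrightarrow> i < (m :: nat)"
  using assms
proof (induction d)
  case (Suc d)
  show ?case
  proof (cases "Q d")
    case True
    then have "\<forall>i<Suc d. Q i" using Suc.prems[of _ d] by (simp add: less_Suc_eq_le)
    then show ?thesis by (intro exI[of _ "Suc d"]) auto
  next
    case False
    obtain m where "m \<le> d" "\<forall>i<d. Q i \<longleftrightarrow> i < m"
      using Suc.IH Suc.prems by (meson less_SucI)
    then show ?thesis using False by (intro exI[of _ m]) (auto simp: less_Suc_eq)
  qed
qed simp

locale sorted_distribution =
  fixes d r :: nat and p :: "nat \<Rightarrow> real"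
  assumes r: "1 \<le> r" "r \<le> d"
    and p_pos: "\<And>i. i < r \<Longrightarrow> 0 < p i"
    and p_zero: "\<And>i. r \<le> i \<Longrightarrow> i < d \<Longrightarrow> p i = 0"
    and p_sorted: "\<And>i j. i \<le> j \<Longrightarrow> j < d \<Longrightarrow> p j \<le> p i"
    and p_sum: "(\<Sum>i<d. p i) = 1"
begin

definition psi :: "real \<Rightarrow> real" where
  "psi s = log 2 (\<Sum>i<d. p i powr s)"

definition tilt :: "real \<Rightarrow> nat \<Rightarrow> real" where
  "tilt s i = p i powr s / (\<Sum>i<d. p i powr s)"

definition rate :: "real \<Rightarrow> real \<Rightarrow> real" where
  "rate s R = ((1 - s) * R - psi s) / s"

definition supported :: "(nat \<Rightarrow> real) \<Rightarrow> bool" where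
  "supported q \<longleftrightarrow> prob_vector d q \<and> (\<forall>i<d. r \<le> i \<longrightarrow> q i = 0)"

text \<open>Real-valued relative entropy with respect to \<open>p\<close> for vectors living on its
  support, split into entropy and a term linear in \<open>q\<close>.\<close>

definition divergence :: "(nat \<Rightarrow> real) \<Rightarrow> real" where
  "divergence q = - shannon_entropy d q - (\<Sum>i<r. q i * log 2 (p i))"

abbreviation entropy :: "(nat \<Rightarrow> real) \<Rightarrow> real" where
  "entropy \<equiv> shannon_entropy d"

lemma sum_support: "(\<And>i. r \<le> i \<Longrightarrow> i < d \<Longrightarrow> f i = 0) \<Longrightarrow> (\<Sum>i<d. f i) = (\<Sum>i<r. f i)"
  for f :: "nat \<Rightarrow> real"
  using r by (intro sum.mono_neutral_right) auto

lemma p_nonneg: "i < d \<Longrightarrow> 0 \<le> p i"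
  using p_pos[of i] p_zero[of i] by (cases "i < r") auto

lemma p_le_1: "i < d \<Longrightarrow> p i \<le> 1"
  using member_le_sum[of i "{..<d}" p] p_sum p_nonneg by auto

lemma supportedD:
  assumes "supported q"
  shows "i < d \<Longrightarrow> 0 \<le> q i" "(\<Sum>i<d. q i) = 1" "(\<Sum>i<r. q i) = 1" "r \<le> i \<Longrightarrow> i < d \<Longrightarrow> q i = 0"
  using assms sum_support[of q] by (auto simp: supported_def prob_vector_def)

lemma entropy_support: "supported q \<Longrightarrow> entropy q = - (\<Sum>i<r. q i * log 2 (q i))"
  unfolding shannon_entropy_def using sum_support[of "\<lambda>i. q i * log 2 (q i)"] supportedD(4) by simp

text \<open>From \<open>ln x \<le> x - 1\<close>. The reference \<open>w\<close> may be any positive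
  subnormalized vector: it is taken to be a tilted, a uniform or a mixed distribution.\<close>

lemma gibbs:
  assumes q: "supported q" and w: "\<And>i. i < r \<Longrightarrow> 0 < w i" "(\<Sum>i<r. w i) \<le> 1"
  shows "entropy q \<le> - (\<Sum>i<r. q i * log 2 (w i))"
proof -
  have "(q i - w i) / ln 2 \<le> q i * log 2 (q i) - q i * log 2 (w i)" if i: "i < r" for i
  proof (cases "q i = 0")
    case True
    then show ?thesis using w(1)[OF i] by simp
  next
    case False
    then have q0: "0 < q i" using supportedD(1)[OF q, of i] i r by auto
    have "ln (w i / q i) \<le> w i / q i - 1" using q0 w(1)[OF i] by (intro ln_le_minus_one) simp
    then have "q i * (ln (w i) - ln (q i)) \<le> q i * (w i / q i - 1)"
      using q0 w(1)[OF i] by (intro mult_left_mono) (auto simp: ln_div)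
    also have "\<dots> = w i - q i" using q0 by (simp add: field_simps)
    finally have "(q i - w i) / ln 2 \<le> (q i * ln (q i) - q i * ln (w i)) / ln 2"
      by (intro divide_right_mono) (auto simp: algebra_simps)
    then show ?thesis by (simp add: log_def diff_divide_distrib)
  qed
  then have "(\<Sum>i<r. (q i - w i) / ln 2) \<le> (\<Sum>i<r. q i * log 2 (q i) - q i * log 2 (w i))"
    by (intro sum_mono) auto
  moreover have "0 \<le> (\<Sum>i<r. (q i - w i) / ln 2)"
    unfolding sum_divide_distrib[symmetric] sum_subtractf using w(2) supportedD(3)[OF q] by simp
  ultimately show ?thesis unfolding entropy_support[OF q] sum_subtractf by simp
qed

lemma Z_support: "(\<Sum>i<d. p i powr s) = (\<Sum>i<r. p i powr s)"
  by (rule sum_support) (simp add: p_zero)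

lemma Z_pos: "0 < (\<Sum>i<d. p i powr s)"
proof -
  have "p i \<noteq> 0" if "i < r" for i using p_pos[OF that] by simp
  then show ?thesis
    unfolding Z_support by (intro sum_pos) (use r(1) in \<open>auto simp: lessThan_empty_iff\<close>)
qed

lemma tilt_supported: "supported (tilt s)"
  using Z_pos[of s] p_zero
  by (auto simp: supported_def prob_vector_def tilt_def simp flip: sum_divide_distrib)

lemma tilt_pos: "i < r \<Longrightarrow> 0 < tilt s i"
  using Z_pos[of s] p_pos[of i] by (simp add: tilt_def)

lemma tilt_1: "i < d \<Longrightarrow> tilt 1 i = p i"
  using p_sum p_nonneg by (simp add: tilt_def)

lemma log_tilt: "i < r \<Longrightarrow> log 2 (tilt s i) = s * log 2 (p i) - psi s"
  using Z_pos[of s] p_pos[of i] by (simp add: tilt_def psi_def log_divide log_powr)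

lemma cross_entropy_tilt:
  assumes "supported q"
  shows "(\<Sum>i<r. q i * log 2 (tilt s i)) = s * (\<Sum>i<r. q i * log 2 (p i)) - psi s"
proof -
  have "(\<Sum>i<r. q i * log 2 (tilt s i)) = (\<Sum>i<r. s * (q i * log 2 (p i)) - psi s * q i)"
    by (rule sum.cong) (auto simp: log_tilt algebra_simps)
  then show ?thesis
    using supportedD(3)[OF assms] by (simp add: sum_subtractf sum_distrib_left[symmetric])
qed

lemma divergence_ge_rate:
  assumes q: "supported q" and s: "0 < s"
  shows "rate s (entropy q) \<le> divergence q"
proof -
  have "entropy q \<le> - (\<Sum>i<r. q i * log 2 (tilt s i))"
    using q tilt_pos supportedD(3)[OF tilt_supported] by (intro gibbs) auto
  then have "(1 - s) * entropy q - psi s \<le> s * divergence q"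
    unfolding cross_entropy_tilt[OF q] divergence_def by (simp add: algebra_simps)
  then show ?thesis using s unfolding rate_def by (simp add: divide_le_eq mult.commute)
qed

lemma divergence_tilt:
  assumes s: "0 < s"
  shows "divergence (tilt s) = rate s (entropy (tilt s))"
proof -
  have "entropy (tilt s) = - (\<Sum>i<r. tilt s i * log 2 (tilt s i))"
    by (rule entropy_support[OF tilt_supported])
  then have "(1 - s) * entropy (tilt s) - psi s = s * divergence (tilt s)"
    unfolding cross_entropy_tilt[OF tilt_supported] divergence_def by (simp add: algebra_simps)
  then show ?thesis using s unfolding rate_def by (simp add: field_simps)
qed

lemma rel_entropy_supported:
  assumes q: "supported q"
  shows "rel_entropy d q p = ereal (divergence q)"
proof -
  have "\<not> (\<exists>i<d. 0 < q i \<and> p i = 0)"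
    using supportedD(4)[OF q] p_pos by (metis less_irrefl linorder_not_less)
  moreover have "(\<Sum>i<d. q i * log 2 (q i / p i)) = (\<Sum>i<r. q i * log 2 (q i / p i))"
    using supportedD(4)[OF q] by (intro sum_support) simp
  moreover have "(\<Sum>i<r. q i * log 2 (q i / p i)) = (\<Sum>i<r. q i * log 2 (q i) - q i * log 2 (p i))"
  proof (rule sum.cong[OF refl])
    fix i assume "i \<in> {..<r}"
    then have "0 < p i" "0 \<le> q i" using p_pos supportedD(1)[OF q] r by auto
    then show "q i * log 2 (q i / p i) = q i * log 2 (q i) - q i * log 2 (p i)"
      by (cases "q i = 0") (auto simp: log_divide algebra_simps)
  qed
  ultimately show ?thesis
    by (simp add: rel_entropy_def divergence_def entropy_support[OF q] sum_subtractf)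
qed

lemma rel_entropy_unsupported:
  assumes "prob_vector d q" "\<not> supported q"
  shows "rel_entropy d q p = \<infinity>"
proof -
  obtain i where "i < d" "r \<le> i" "q i \<noteq> 0" using assms by (auto simp: supported_def)
  then have "0 < q i \<and> p i = 0" using assms(1) p_zero by (auto simp: prob_vector_def less_le)
  then show ?thesis using \<open>i < d\<close> by (auto simp: rel_entropy_def)
qed

text \<open>Weak duality for both regimes at once: the factor \<open>1 - s\<close> in the hypothesis
  makes it an upper entropy bound for s > 1 and a lower one for s < 1.\<close>

lemma rate_le_rel_entropy:
  assumes q: "prob_vector d q" and s: "0 < s" and R: "(1 - s) * R \<le> (1 - s) * entropy q"
  shows "ereal (rate s R) \<le> rel_entropy d q p"
proof (cases "supported q")
  case True
  have "rate s R \<le> rate s (entropy q)" unfolding rate_def using s R by (intro divide_right_mono) auto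
  also have "\<dots> \<le> divergence q" by (rule divergence_ge_rate[OF True s])
  finally show ?thesis by (simp add: rel_entropy_supported[OF True])
qed (simp add: rel_entropy_unsupported[OF q])

lemma tilt_sorted:
  assumes "0 \<le> s" "i \<le> j" "j < d"
  shows "tilt s j \<le> tilt s i"
  unfolding tilt_def using assms p_sorted[OF assms(2,3)] p_nonneg[OF assms(3)] Z_pos[of s]
  by (intro divide_right_mono powr_mono2) auto

lemma continuous_tilt: "i < r \<Longrightarrow> continuous_on UNIV (\<lambda>s. tilt s i)"
  unfolding tilt_def Z_support using p_pos Z_pos[unfolded Z_support]
  by (intro continuous_intros) (auto simp: less_imp_neq[symmetric])

lemma continuous_entropy_tilt: "continuous_on UNIV (\<lambda>s. entropy (tilt s))"
proof -
  have eq: "entropy (tilt s) = - (\<Sum>i<r. tilt s i * log 2 (tilt s i))" for s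
    by (rule entropy_support[OF tilt_supported])
  show ?thesis unfolding eq
    using continuous_tilt tilt_pos by (intro continuous_intros) (auto simp: less_imp_neq[symmetric])
qed

lemma entropy_p: "entropy p = entropy (tilt 1)"
  unfolding shannon_entropy_def using tilt_1 by (intro arg_cong[of _ _ uminus] sum.cong) auto

lemma tilt_0: "i < r \<Longrightarrow> tilt 0 i = 1 / r"
proof -
  assume i: "i < r"
  have "(\<Sum>i<d. p i powr 0) = (\<Sum>i<r. 1)"
    unfolding Z_support by (rule sum.cong) (auto dest: p_pos)
  then show ?thesis using i p_pos[OF i] by (simp add: tilt_def)
qed

lemma entropy_tilt_0: "entropy (tilt 0) = log 2 r"
proof -
  have "entropy (tilt 0) = - (\<Sum>i<r. (1 / r) * log 2 (1 / r))"
    unfolding entropy_support[OF tilt_supported] by (simp add: tilt_0)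
  then show ?thesis using r by (simp add: log_divide)
qed

lemma entropy_le_log:
  assumes "supported q"
  shows "entropy q \<le> log 2 r"
proof -
  have "entropy q \<le> - (\<Sum>i<r. q i * log 2 (1 / r))"
    using r by (intro gibbs[OF assms]) auto
  also have "\<dots> = log 2 r"
    unfolding sum_distrib_right[symmetric] supportedD(3)[OF assms] using r by (simp add: log_divide)
  finally show ?thesis .
qed

text \<open>Replaces every nonzero eigenvalue by the largest one. It is sharp enough both for large
  \<open>s\<close>, where \<open>log 2 r / s\<close> vanishes, and for small \<open>s\<close>, where
  \<open>psi s \<le> log 2 r\<close> matters.\<close>

lemma psi_le: "0 \<le> s \<Longrightarrow> psi s \<le> log 2 r + s * log 2 (p 0)"
proof -
  assume s: "0 \<le> s"
  have "(\<Sum>i<d. p i powr s) \<le> (\<Sum>i<r. p 0 powr s)"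
    unfolding Z_support using s p_pos p_sorted r by (intro sum_mono powr_mono2) (auto intro: less_imp_le)
  then have "psi s \<le> log 2 (r * p 0 powr s)"
    unfolding psi_def using Z_pos[of s] by (intro log_mono) auto
  also have "\<dots> = log 2 r + s * log 2 (p 0)"
    using p_pos[of 0] r by (simp add: log_mult_pos log_powr)
  finally show ?thesis .
qed

text \<open>For s \<ge> 1 the entropy of \<open>tilt s\<close> varies continuously from that of
  \<open>p\<close> towards that of the uniform distribution on the top eigenspace. If it falls to
  \<open>R\<close>, the intermediate value theorem selects a tilt. Otherwise \<open>R\<close> is at
  most the limiting entropy and is realized inside the top eigenspace; the matching
  \<open>rate\<close> is then only approached as \<open>s\<close> grows.\<close>

lemma low_rate_optimizer:
  assumes R: "0 \<le> R" "R \<le> entropy p"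
  obtains q where "supported q" "\<And>i j. i \<le> j \<Longrightarrow> j < d \<Longrightarrow> q j \<le> q i" "entropy q = R"
    "\<And>\<epsilon>. 0 < \<epsilon> \<Longrightarrow> \<exists>s\<ge>1. divergence q \<le> rate s R + \<epsilon>"
proof (cases "\<exists>s\<ge>1. entropy (tilt s) \<le> R")
  case True
  then obtain s1 where s1: "1 \<le> s1" "entropy (tilt s1) \<le> R" by blast
  obtain s where s: "1 \<le> s" "s \<le> s1" "entropy (tilt s) = R"
    using IVT2'[of "\<lambda>s. entropy (tilt s)" s1 R 1] s1 R entropy_p
      continuous_on_subset[OF continuous_entropy_tilt] by auto
  show ?thesis
  proof (rule that[of "tilt s"])
    show "\<exists>s'\<ge>1. divergence (tilt s) \<le> rate s' R + \<epsilon>" if "0 < \<epsilon>" for \<epsilon>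
      using divergence_tilt[of s] s that by (intro exI[of _ s]) auto
  qed (use s tilt_supported tilt_sorted in auto)
next
  case False
  have "p i = p 0" if "i \<le> j" "j < r" "p j = p 0" for i j
    using that p_sorted[of i j] p_sorted[of 0 i] r by auto
  \<comment> \<open>\<open>m\<close> is the multiplicity of the largest eigenvalue.\<close>
  then obtain m where m': "m \<le> r" "\<forall>i<r. p i = p 0 \<longleftrightarrow> i < m"
    using initial_segment[of r "\<lambda>i. p i = p 0"] by blast
  have m: "1 \<le> m" "m \<le> r" "\<And>i. i < r \<Longrightarrow> p i = p 0 \<longleftrightarrow> i < m"
    using m'(2)[rule_format, of 0] m' r(1) by auto
  \<comment> \<open>Sorted interpolation between the point mass at 0, of entropy 0, and the uniform
    distribution on the first \<open>m\<close> indices.\<close>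
  define mix where "mix t i = (if i < m then t / m + (if i = 0 then 1 - t else 0) else 0)" for t :: real and i :: nat
  have sum_m: "(\<Sum>i<n. f i) = (\<Sum>i<m. f i)" if "m \<le> n" "\<And>i. m \<le> i \<Longrightarrow> f i = 0" for f :: "nat \<Rightarrow> real" and n
    using that by (intro sum.mono_neutral_right) auto
  have mix_sum: "(\<Sum>i<m. mix t i) = 1" for t
    using m(1) by (simp add: mix_def sum.distrib)
  have mix_supp: "supported (mix t)" if "0 \<le> t" "t \<le> 1" for t
    using that m r mix_sum[of t] sum_m[of d "mix t"]
    by (auto simp: supported_def prob_vector_def mix_def)
  have lim: "((\<lambda>s. tilt s i) \<longlongrightarrow> mix 1 i) at_top" if i: "i < d" for i
  proof -
    have pw: "((\<lambda>s. (p j / p 0) powr s) \<longlongrightarrow> (if j < m then 1 else 0)) at_top" if j: "j < d" for j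
    proof (cases "j < m")
      case True
      then have "p j / p 0 = 1" using m(2) m(3)[of j] p_pos[of 0] r by simp
      then show ?thesis using True by simp
    next
      case False
      show ?thesis
      proof (cases "j < r")
        case True
        then have "p j < p 0" using False m(3)[of j] p_sorted[of 0 j] j by (simp add: less_le)
        then have x: "0 < p j / p 0" "p j / p 0 < 1" using p_pos[OF True] by auto
        define c where "c = ln (p j / p 0)"
        have "c < 0" using x by (simp add: c_def)
        then have "((\<lambda>s. exp (s * c)) \<longlongrightarrow> 0) at_top" by real_asymp
        then have "((\<lambda>s. exp (s * ln (p j / p 0))) \<longlongrightarrow> 0) at_top" by (simp only: c_def)
        moreover have "p j \<noteq> 0" "p 0 \<noteq> 0" using x by auto
        ultimately show ?thesis using \<open>\<not> j < m\<close> by (simp add: powr_def)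
      next
        case False
        then show ?thesis using m j by (simp add: p_zero)
      qed
    qed
    have "((\<lambda>s. \<Sum>j<d. (p j / p 0) powr s) \<longlongrightarrow> (\<Sum>j<d. if j < m then 1 else 0)) at_top"
      using pw by (intro tendsto_sum) auto
    moreover have "(\<Sum>j<d. if j < m then 1 else 0) = real m"
      using sum_m[of d "\<lambda>j. if j < m then 1 else 0"] m r by simp
    ultimately have "((\<lambda>s. (p i / p 0) powr s / (\<Sum>j<d. (p j / p 0) powr s)) \<longlongrightarrow> (if i < m then 1 else 0) / real m) at_top"
      using pw[OF i] m(1) by (intro tendsto_divide) auto
    moreover have "(p i / p 0) powr s / (\<Sum>j<d. (p j / p 0) powr s) = tilt s i" for s
    proof -
      have "(p j / p 0) powr s = p j powr s / p 0 powr s" if "j < d" for j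
        using p_nonneg[OF that] p_nonneg[of 0] r by (intro powr_divide)
      then have "(\<Sum>j<d. (p j / p 0) powr s) = (\<Sum>j<d. p j powr s) / p 0 powr s"
        by (simp add: sum_divide_distrib)
      then show ?thesis
        using \<open>\<And>j. j < d \<Longrightarrow> (p j / p 0) powr s = p j powr s / p 0 powr s\<close>[OF i] p_pos[of 0] r
        by (simp add: tilt_def)
    qed
    moreover have "(if i < m then 1 else 0) / real m = mix 1 i" by (simp add: mix_def)
    ultimately show ?thesis by simp
  qed
  have "((\<lambda>s. entropy (tilt s)) \<longlongrightarrow> entropy (mix 1)) at_top"
    by (rule tendsto_shannon_entropy)
      (use lim supportedD(1)[OF tilt_supported] supportedD(1)[OF mix_supp[of 1]] in auto)
  moreover have "\<forall>\<^sub>F s in at_top. R \<le> entropy (tilt s)"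
    using eventually_ge_at_top[of 1] by eventually_elim (use False in force)
  ultimately have R1: "R \<le> entropy (mix 1)"
    by (intro tendsto_lowerbound) auto
  have R0: "entropy (mix 0) \<le> R"
  proof -
    have "(\<Sum>i<d. mix 0 i * log 2 (mix 0 i)) = 0" by (rule sum.neutral) (simp add: mix_def)
    then show ?thesis using R(1) by (simp add: shannon_entropy_def)
  qed
  have "continuous_on {0..1} (\<lambda>t. entropy (mix t))"
    unfolding continuous_on
  proof
    fix t :: real assume t: "t \<in> {0..1}"
    have "((\<lambda>t. mix t i) \<longlongrightarrow> mix t i) (at t within {0..1})" for i
      unfolding mix_def using m(1) by (cases "i < m"; cases "i = 0") (auto intro!: tendsto_intros)
    moreover have "\<forall>\<^sub>F t in at t within {0..1}. \<forall>i<d. 0 \<le> mix t i"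
      unfolding eventually_at_topological using supportedD(1)[OF mix_supp]
      by (intro exI[of _ UNIV]) auto
    ultimately show "((\<lambda>t. entropy (mix t)) \<longlongrightarrow> entropy (mix t)) (at t within {0..1})"
      using supportedD(1)[OF mix_supp] t by (intro tendsto_shannon_entropy) auto
  qed
  then obtain t where t: "0 \<le> t" "t \<le> 1" "entropy (mix t) = R"
    using IVT'[of "\<lambda>t. entropy (mix t)" 0 R 1] R0 R1 by auto
  have D: "divergence (mix t) = - R - log 2 (p 0)"
  proof -
    have "(\<Sum>i<r. mix t i * log 2 (p i)) = (\<Sum>i<m. mix t i * log 2 (p i))"
      by (rule sum_m) (use m in \<open>auto simp: mix_def\<close>)
    also have "\<dots> = (\<Sum>i<m. mix t i * log 2 (p 0))"
    proof (rule sum.cong[OF refl])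
      fix i assume "i \<in> {..<m}"
      then have "p i = p 0" using m(2) m(3)[of i] by simp
      then show "mix t i * log 2 (p i) = mix t i * log 2 (p 0)" by simp
    qed
    also have "\<dots> = log 2 (p 0)" using mix_sum by (simp flip: sum_distrib_right)
    finally show ?thesis unfolding divergence_def t(3) by simp
  qed
  show ?thesis
  proof (rule that[of "mix t"])
    show "supported (mix t)" using mix_supp t by blast
    show "entropy (mix t) = R" by (rule t)
    show "mix t j \<le> mix t i" if "i \<le> j" "j < d" for i j
      using that t by (auto simp: mix_def)
    fix \<epsilon> :: real assume e: "0 < \<epsilon>"
    \<comment> \<open>By \<open>psi_le\<close>, the gap between the divergence and
      \<open>rate s R\<close> is at most \<open>log 2 r / s\<close>, which this choice brings below
      \<epsilon>.\<close>
    define s where "s = max 1 (log 2 r / \<epsilon>)"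
    have s: "1 \<le> s" "log 2 r / s \<le> \<epsilon>"
    proof -
      show "1 \<le> s" by (simp add: s_def)
      have "log 2 r / \<epsilon> \<le> s" by (simp add: s_def)
      then show "log 2 r / s \<le> \<epsilon>" using e \<open>1 \<le> s\<close> by (simp add: field_simps)
    qed
    have "rate s R = R / s - R - psi s / s" using s by (simp add: rate_def field_simps)
    moreover have "psi s / s \<le> log 2 r / s + log 2 (p 0)"
      using psi_le[of s] s by (simp add: field_simps)
    moreover have "0 \<le> R / s" using R s by simp
    ultimately have "divergence (mix t) \<le> rate s R + \<epsilon>" unfolding D using s(2) by linarith
    then show "\<exists>s\<ge>1. divergence (mix t) \<le> rate s R + \<epsilon>" using s(1) by blast
  qed
qed

text \<open>Decreasing \<open>s\<close> from 1 to 0 takes the entropy of the tilt from that of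
  \<open>p\<close> to \<open>log 2 r\<close>, so some tilt has entropy \<open>R\<close>. Only
  \<open>s = 0\<close> lies outside the range of \<open>rate\<close>; it is approached from the
  right.\<close>

lemma high_rate_optimizer:
  assumes R: "entropy p \<le> R" "R \<le> log 2 r"
  obtains q where "supported q" "\<And>i j. i \<le> j \<Longrightarrow> j < d \<Longrightarrow> q j \<le> q i" "entropy q = R"
    "\<And>\<epsilon>. 0 < \<epsilon> \<Longrightarrow> \<exists>s>0. s \<le> 1 \<and> divergence q \<le> rate s R + \<epsilon>"
proof -
  obtain s where s: "0 \<le> s" "s \<le> 1" "entropy (tilt s) = R"
    using IVT2'[of "\<lambda>s. entropy (tilt s)" 1 R 0] R entropy_p entropy_tilt_0
      continuous_on_subset[OF continuous_entropy_tilt] by auto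
  have "\<exists>s'>0. s' \<le> 1 \<and> divergence (tilt s) \<le> rate s' R + \<epsilon>" if e: "0 < \<epsilon>" for \<epsilon>
  proof (cases "s = 0")
    case False
    then show ?thesis using divergence_tilt[of s] s e by (intro exI[of _ s]) auto
  next
    case True
    then have Rr: "R = log 2 r" using s entropy_tilt_0 by simp
    have "continuous_on UNIV (\<lambda>s. divergence (tilt s))"
      unfolding divergence_def
      by (intro continuous_intros continuous_entropy_tilt) (simp add: continuous_tilt)
    then have "(\<lambda>s. divergence (tilt s)) \<midarrow>0\<rightarrow> divergence (tilt 0)"
      by (simp add: continuous_on_def)
    then have "((\<lambda>s. divergence (tilt s)) \<longlongrightarrow> divergence (tilt 0)) (at_right 0)"
      using at_le[of "{0<..}" UNIV "0 :: real"] tendsto_mono by blast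
    then have "\<forall>\<^sub>F s in at_right 0. divergence (tilt 0) - \<epsilon> < divergence (tilt s)"
      using e by (intro order_tendstoD) auto
    moreover have "\<forall>\<^sub>F s in at_right (0 :: real). s \<in> {0<..<1}"
      by (rule eventually_at_right_real) simp
    ultimately have "\<forall>\<^sub>F s in at_right 0. divergence (tilt 0) - \<epsilon> < divergence (tilt s) \<and> s \<in> {0<..<1}"
      by (rule eventually_conj)
    then obtain s' where s': "divergence (tilt 0) - \<epsilon> < divergence (tilt s')" "0 < s'" "s' < 1"
      using eventually_happens'[OF trivial_limit_at_right_real] by (metis (no_types, lifting) greaterThanLessThan_iff)
    \<comment> \<open>\<open>rate s'\<close> is nondecreasing in the entropy argument for s' \<le>
      1, and \<open>R\<close> is the maximal entropy here.\<close>
    have "rate s' (entropy (tilt s')) \<le> rate s' R"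
      unfolding rate_def Rr using s' entropy_le_log[OF tilt_supported]
      by (intro divide_right_mono diff_right_mono mult_left_mono) auto
    then have "divergence (tilt s) \<le> rate s' R + \<epsilon>"
      using s' divergence_tilt[of s'] True by simp
    then show ?thesis using s' by (intro exI[of _ s']) auto
  qed
  then show ?thesis using that[of "tilt s"] s tilt_supported tilt_sorted by blast
qed

text \<open>Since \<open>psi s \<le> log 2 r\<close> for s \<ge> 0, one has
  \<open>rate s R \<ge> (R - log 2 r) / s - R\<close>, which diverges as \<open>s\<close> decreases
  to 0.\<close>

lemma rate_unbounded:
  assumes R: "log 2 r < R"
  shows "\<exists>s>0. s \<le> 1 \<and> x \<le> rate s R"
proof -
  \<comment> \<open>Chosen so that \<open>s * (x + R) \<le> R - log 2 r\<close>; the inner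
    \<open>max 1\<close> covers the case of small or negative \<open>x + R\<close>.\<close>
  define s where "s = min 1 ((R - log 2 r) / (max 1 (x + R)))"
  have s: "0 < s" "s \<le> 1" using R by (auto simp: s_def)
  have "s * (x + R) \<le> s * max 1 (x + R)" using s by (intro mult_left_mono) auto
  also have "\<dots> \<le> (R - log 2 r) / max 1 (x + R) * max 1 (x + R)"
    unfolding s_def by (intro mult_right_mono) auto
  also have "\<dots> = R - log 2 r" by simp
  finally have "s * (x + R) \<le> R - log 2 r" .
  moreover have "psi s \<le> log 2 r"
  proof -
    have "s * log 2 (p 0) \<le> 0"
      using s p_pos[of 0] p_le_1[of 0] r by (intro mult_nonneg_nonpos) auto
    then show ?thesis using psi_le[of s] s by linarith
  qed
  ultimately have "x * s \<le> (1 - s) * R - psi s" by (simp add: algebra_simps)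
  then have "x \<le> rate s R" unfolding rate_def using s by (simp add: le_divide_eq)
  then show ?thesis using s by blast
qed

text \<open>The slope in \<open>R\<close> is \<open>-(1 - 1/s)\<close>, bounded by 1 in absolute
  value for all s \<ge> 1, so lowering the target entropy slightly costs little uniformly in
  \<open>s\<close>.\<close>

lemma rate_lipschitz:
  assumes "1 \<le> s" "R' \<le> R"
  shows "rate s R' \<le> rate s R + (R - R')"
proof -
  have "rate s R' = rate s R + (1 - 1 / s) * (R - R')"
    using assms by (simp add: rate_def field_simps)
  moreover have "(1 - 1 / s) * (R - R') \<le> 1 * (R - R')"
    using assms by (intro mult_right_mono) auto
  ultimately show ?thesis by simp
qed

text \<open>Strict positivity comes from the Hellinger lower bound on the divergence.\<close>

lemma divergence_pos:
  assumes q: "supported q" and ne: "entropy q \<noteq> entropy p"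
  shows "0 < divergence q"
proof -
  have "\<exists>i<r. q i \<noteq> p i"
  proof (rule ccontr)
    assume "\<not> ?thesis"
    then have "q i = p i" if "i < d" for i
      using that supportedD(4)[OF q] p_zero by (cases "i < r") auto
    then show False using ne by (simp add: shannon_entropy_def)
  qed
  then obtain i0 where i0: "i0 < r" "q i0 \<noteq> p i0" by blast
  have q0: "0 \<le> q i" if "i < r" for i using supportedD(1)[OF q] that r by auto
  \<comment> \<open>Pointwise Hellinger bound, from
    \<open>ln x = 2 ln (sqrt x) \<le> 2 (sqrt x - 1)\<close>; the linear term
    \<open>q i - p i\<close> cancels on summation.\<close>
  have bound: "((sqrt (q i) - sqrt (p i))\<^sup>2 + (q i - p i)) / ln 2 \<le> q i * log 2 (q i) - q i * log 2 (p i)"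
    if i: "i < r" for i
  proof (cases "q i = 0")
    case True
    then show ?thesis using p_pos[OF i] by simp
  next
    case False
    then have qi: "0 < q i" using q0[OF i] by simp
    note pi = p_pos[OF i]
    have "ln (p i / q i) = 2 * ln (sqrt (p i / q i))" using qi pi by (simp add: ln_sqrt)
    also have "\<dots> \<le> 2 * (sqrt (p i / q i) - 1)"
      using qi pi by (intro mult_left_mono ln_le_minus_one) auto
    finally have "q i * ln (p i / q i) \<le> q i * (2 * (sqrt (p i / q i) - 1))"
      using qi by (intro mult_left_mono) auto
    also have "\<dots> = 2 * sqrt (q i) * sqrt (p i) - 2 * q i"
    proof -
      have "q i * sqrt (p i / q i) = sqrt (q i) * sqrt (p i)"
        using qi by (simp add: real_sqrt_divide field_simps)
      then show ?thesis by (simp add: algebra_simps)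
    qed
    also have "\<dots> = - ((sqrt (q i) - sqrt (p i))\<^sup>2 + (q i - p i))"
      using qi pi by (simp add: power2_diff)
    finally have "(sqrt (q i) - sqrt (p i))\<^sup>2 + (q i - p i) \<le> q i * ln (q i) - q i * ln (p i)"
      using qi pi by (simp add: ln_div algebra_simps)
    then have "((sqrt (q i) - sqrt (p i))\<^sup>2 + (q i - p i)) / ln 2 \<le> (q i * ln (q i) - q i * ln (p i)) / ln 2"
      by (intro divide_right_mono) auto
    then show ?thesis by (simp add: log_def diff_divide_distrib)
  qed
  have "0 < (\<Sum>i<r. (sqrt (q i) - sqrt (p i))\<^sup>2)"
    using i0 q0 p_pos by (intro sum_pos2[of _ i0]) auto
  moreover have "(\<Sum>i<r. p i) = 1" using sum_support[of p] p_zero p_sum by simp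
  ultimately have "0 < (\<Sum>i<r. (sqrt (q i) - sqrt (p i))\<^sup>2 + (q i - p i)) / ln 2"
    using supportedD(3)[OF q] by (simp add: sum.distrib sum_subtractf)
  also have "\<dots> \<le> (\<Sum>i<r. q i * log 2 (q i) - q i * log 2 (p i))"
    unfolding sum_divide_distrib using bound by (intro sum_mono) auto
  also have "\<dots> = divergence q"
    by (simp add: divergence_def entropy_support[OF q] sum_subtractf)
  finally show ?thesis .
qed

text \<open>Mixing with the uniform distribution on the support: concavity of the entropy makes it
  strictly larger, convexity of the divergence keeps the cost small.\<close>

lemma entropy_increasing_mixture:
  assumes q: "supported q" and lt: "entropy q < log 2 r" and e: "0 < \<epsilon>"
    and sorted: "\<And>i j. i \<le> j \<Longrightarrow> j < d \<Longrightarrow> q j \<le> q i"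
  obtains q' where "supported q'" "\<And>i j. i \<le> j \<Longrightarrow> j < d \<Longrightarrow> q' j \<le> q' i"
    "entropy q < entropy q'" "divergence q' \<le> divergence q + \<epsilon>"
proof -
  let ?u = "tilt 0"
  \<comment> \<open>Bounds the change \<open>t * (divergence ?u - divergence q)\<close> by
    \<epsilon>; the added 1 keeps the denominator positive.\<close>
  define t where "t = min 1 (\<epsilon> / (1 + \<bar>divergence ?u - divergence q\<bar>))"
  have t: "0 < t" "t \<le> 1" using e by (auto simp: t_def intro: divide_pos_pos)
  define q' where "q' i = (1 - t) * q i + t * ?u i" for i
  note u = supportedD[OF tilt_supported[of 0]]
  have q': "supported q'"
    using supportedD[OF q] u t
    by (auto simp: supported_def prob_vector_def q'_def sum.distrib simp flip: sum_distrib_left)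
  have pos: "0 < q' i" if "i < r" for i
    unfolding q'_def using supportedD(1)[OF q, of i] tilt_pos[OF that, of 0] t that r
    by (intro add_nonneg_pos mult_nonneg_nonneg mult_pos_pos) auto
  \<comment> \<open>Gibbs against the mixture itself, applied to both components, gives concavity of
    the entropy.\<close>
  have g: "entropy x \<le> - (\<Sum>i<r. x i * log 2 (q' i))" if "supported x" for x
    by (rule gibbs[OF that pos]) (simp_all add: supportedD(3)[OF q'])
  have lin: "(\<Sum>i<r. q' i * f i) = (1 - t) * (\<Sum>i<r. q i * f i) + t * (\<Sum>i<r. ?u i * f i)" for f
  proof -
    have "(\<Sum>i<r. q' i * f i) = (\<Sum>i<r. (1 - t) * (q i * f i) + t * (?u i * f i))"
      by (rule sum.cong) (auto simp: q'_def algebra_simps)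
    then show ?thesis by (simp only: sum.distrib sum_distrib_left)
  qed
  have H: "(1 - t) * entropy q + t * entropy ?u \<le> entropy q'"
  proof -
    have "(1 - t) * entropy q + t * entropy ?u \<le>
        (1 - t) * (- (\<Sum>i<r. q i * log 2 (q' i))) + t * (- (\<Sum>i<r. ?u i * log 2 (q' i)))"
      using t g[OF q] g[OF tilt_supported] by (intro add_mono mult_left_mono) auto
    also have "\<dots> = entropy q'" unfolding entropy_support[OF q'] lin by (simp add: algebra_simps)
    finally show ?thesis .
  qed
  have "divergence q' \<le> (1 - t) * divergence q + t * divergence ?u"
    using H unfolding divergence_def lin by (simp add: algebra_simps)
  also have "\<dots> = divergence q + t * (divergence ?u - divergence q)" by (simp add: algebra_simps)
  also have "\<dots> \<le> divergence q + \<epsilon>"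
  proof -
    let ?D = "divergence ?u - divergence q"
    have "t * ?D \<le> t * (1 + \<bar>?D\<bar>)" using t by (intro mult_left_mono) auto
    also have "\<dots> \<le> \<epsilon> / (1 + \<bar>?D\<bar>) * (1 + \<bar>?D\<bar>)" unfolding t_def by (intro mult_right_mono) auto
    also have "\<dots> = \<epsilon>" by simp
    finally show ?thesis by simp
  qed
  finally have D: "divergence q' \<le> divergence q + \<epsilon>" .
  have "0 < t * (log 2 r - entropy q)" using t lt by simp
  then have "entropy q < entropy q'" using H unfolding entropy_tilt_0 by (simp add: algebra_simps)
  moreover have "q' j \<le> q' i" if "i \<le> j" "j < d" for i j
    unfolding q'_def using sorted[OF that] tilt_sorted[OF _ that, of 0] t
    by (intro add_mono mult_left_mono) auto
  ultimately show ?thesis using that q' D by blast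
qed

end

section \<open>Exponents of the concentration protocol\<close>

text \<open>Asking for \<open>v\<close> strictly above \<open>x\<close> leaves room for the
  polynomial factor, whose contribution \<open>k log (n + 1) / n\<close> tends to 0. If
  \<open>E\<close> is infinite, \<open>up\<close> is vacuous; if \<open>S n\<close> vanishes, the
  exponent is infinite and the lower bound holds trivially.\<close>

lemma exponent_tendsto:
  fixes S :: "nat \<Rightarrow> real" and E :: ereal
  assumes nonneg: "\<And>n. 0 \<le> S n"
    and low: "\<And>x :: real. ereal x < E \<Longrightarrow> \<exists>v>x. \<forall>\<^sub>F n in sequentially. S n \<le> (real n + 1) ^ k * 2 powr (- (real n * v))"
    and up: "\<And>x :: real. E < ereal x \<Longrightarrow> \<forall>\<^sub>F n in sequentially. 2 powr (- (real n * x)) \<le> S n"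
  shows "(\<lambda>n. ereal (1 / real n) * neg_log2 (S n)) \<longlonglongrightarrow> E"
proof (rule order_tendstoI)
  fix a assume "a < E"
  then obtain x where x: "a < ereal x" "ereal x < E" using ereal_dense2 by blast
  then obtain v where v: "x < v" "\<forall>\<^sub>F n in sequentially. S n \<le> (real n + 1) ^ k * 2 powr (- (real n * v))"
    using low by blast
  have "(\<lambda>n. real k * log 2 (real n + 1) / real n) \<longlonglongrightarrow> 0"
    unfolding log_def by real_asymp
  then have "\<forall>\<^sub>F n in sequentially. real k * log 2 (real n + 1) / real n < v - x"
    using v(1) by (intro order_tendstoD) auto
  with v(2) show "\<forall>\<^sub>F n in sequentially. a < ereal (1 / real n) * neg_log2 (S n)"
    using eventually_gt_at_top[of 0]
  proof eventually_elim
    case (elim n)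
    show ?case
    proof (cases "S n = 0")
      case True
      then have "ereal (1 / real n) * neg_log2 (S n) = \<infinity>" using elim by (simp add: neg_log2_def)
      moreover have "a < \<infinity>" using x(1) by (cases a) auto
      ultimately show ?thesis by simp
    next
      case False
      then have "0 < S n" using nonneg[of n] by simp
      then have "log 2 (S n) \<le> log 2 ((real n + 1) ^ k * 2 powr (- (n * v)))"
        using elim by (intro log_mono) auto
      also have "\<dots> = real k * log 2 (real n + 1) - n * v"
        by (subst log_mult_pos) (auto simp: log_nat_power)
      finally have "(n * v - real k * log 2 (real n + 1)) / n \<le> - log 2 (S n) / n"
        by (intro divide_right_mono) auto
      moreover have "(n * v - real k * log 2 (real n + 1)) / n = v - real k * log 2 (real n + 1) / n"
        using elim by (simp add: diff_divide_distrib)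
      ultimately have "x < - log 2 (S n) / n" using elim by linarith
      then show ?thesis using False x(1) by (simp add: neg_log2_def less_trans[of a "ereal x"])
    qed
  qed
next
  fix b assume "E < b"
  then obtain x where x: "E < ereal x" "ereal x < b" using ereal_dense2 by blast
  from up[OF x(1)] show "\<forall>\<^sub>F n in sequentially. ereal (1 / real n) * neg_log2 (S n) < b"
    using eventually_gt_at_top[of 0]
  proof eventually_elim
    case (elim n)
    have "0 < (2 :: real) powr (- (n * x))" by simp
    then have S: "0 < S n" using elim by linarith
    have "log 2 (2 powr (- (n * x))) \<le> log 2 (S n)" using elim by (intro log_mono) auto
    then have "- log 2 (S n) \<le> x * real n" by (simp add: mult.commute)
    then have "- log 2 (S n) / n \<le> x" using elim by (subst pos_divide_le_eq) auto
    then show ?case using S x(2) by (auto simp: neg_log2_def intro: le_less_trans[of _ "ereal x"])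
  qed
qed

text \<open>The sorted word of the shape is a ballot sequence. Positivity is what permits logarithms
  of the dimension.\<close>

lemma dim_specht_pos:
  assumes "ns \<in> young_indices d n"
  shows "0 < cfun.dim (specht_module ns)"
proof -
  have ns: "length ns = d" and mono: "\<And>i j. i < j \<Longrightarrow> j < d \<Longrightarrow> ns ! j \<le> ns ! i"
    using assms by (auto simp: young_indices_def sorted_wrt_iff_nth_less)
  let ?w = "sorted_list_of_multiset (shape_content ns)"
  have w: "?w \<in> shape_words ns" by (simp add: shape_words_iff)
  have "ballot ?w"
    by (rule ballot_sorted) (use count_shape_word[OF w] mono ns in auto)
  then have "{w \<in> shape_words ns. ballot w} \<noteq> {}" using w by blast
  then have "0 < card {w \<in> shape_words ns. ballot w}" by (simp add: card_gt_0_iff)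
  then show ?thesis using card_ballot_le_dim_specht[of ns] by linarith
qed

lemma card_young_indices_le: "card (young_indices d n) \<le> (n + 1) ^ d"
  and finite_young_indices: "finite (young_indices d n)"
proof -
  have sub: "young_indices d n \<subseteq> {xs. set xs \<subseteq> {..n} \<and> length xs = d}"
    by (auto simp: young_indices_def dest: member_le_sum_list)
  have fin: "finite {xs. set xs \<subseteq> {..n} \<and> length xs = d}" by (rule finite_lists_length_eq) simp
  show "finite (young_indices d n)" by (rule finite_subset[OF sub fin])
  have "card (young_indices d n) \<le> card {xs. set xs \<subseteq> {..n} \<and> length xs = d}"
    by (rule card_mono[OF fin sub])
  then show "card (young_indices d n) \<le> (n + 1) ^ d" by (simp add: card_lists_length_eq)
qed

section \<open>From weights and multiplicities of shapes to the exponents\<close>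

context sorted_distribution
begin

abbreviation multiplicity :: "nat list \<Rightarrow> real" where
  "multiplicity ns \<equiv> real (cfun.dim (specht_module ns))"

abbreviation weight :: "nat list \<Rightarrow> real" where
  "weight ns \<equiv> (\<Prod>i<d. p i ^ (ns ! i))"

lemma weight_nonneg: "0 \<le> weight ns"
  using p_nonneg by (intro prod_nonneg) auto

text \<open>The factor \<open>s - 1\<close> in the hypothesis lets the same estimate serve small
  dimensions with s \<ge> 1 and large dimensions with s \<le> 1.\<close>

lemma weight_multiplicity_le:
  assumes young: "ns \<in> young_indices d n" and s: "0 < s"
    and R: "(s - 1) * log 2 (multiplicity ns) \<le> (s - 1) * (n * R)"
  shows "weight ns * multiplicity ns \<le> 2 powr (- (n * rate s R))"
proof (cases "weight ns = 0")
  case False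
  have ns: "length ns = d" "sum_list ns = n" using young by (auto simp: young_indices_def)
  have w: "0 < weight ns"
    by (rule order.not_eq_order_implies_strict[OF False[symmetric] weight_nonneg])
  have wp: "0 < weight ns powr s" using w by (intro powr_gt_zero[THEN iffD2]) linarith
  have f: "0 < multiplicity ns" using dim_specht_pos[OF young] by simp
  have pw: "(\<Prod>i<d. (p i powr s) ^ (ns ! i)) = weight ns powr s"
  proof -
    have "(\<Prod>i<d. (p i powr s) ^ (ns ! i)) = (\<Prod>i<d. (p i ^ (ns ! i)) powr s)"
    proof (rule prod.cong[OF refl])
      fix i assume i: "i \<in> {..<d}"
      show "(p i powr s) ^ (ns ! i) = (p i ^ (ns ! i)) powr s"
      proof (cases "p i = 0")
        case True
        \<comment> \<open>A shape of nonzero weight has no cells in rows of zero eigenvalue, so both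
          sides are an empty power.\<close>
        have "ns ! i = 0"
        proof (rule ccontr)
          assume "ns ! i \<noteq> 0"
          then have "weight ns = 0" using True i by (intro prod_zero bexI[of _ i]) auto
          then show False using w by linarith
        qed
        then show ?thesis by simp
      next
        case False
        then have "0 < p i" using p_nonneg[of i] i by simp
        then show ?thesis by (simp add: powr_powr mult.commute flip: powr_realpow)
      qed
    qed
    then show ?thesis using p_nonneg by (simp add: prod_powr_distrib)
  qed
  have "multiplicity ns * weight ns powr s \<le> card (shape_words ns) * weight ns powr s"
    using dim_specht_le[of ns] by (intro mult_right_mono) auto
  also have "\<dots> \<le> (\<Sum>i<d. p i powr s) ^ n"
    using card_shape_words_le[of ns "\<lambda>i. p i powr s"] ns pw by simp
  finally have "log 2 (multiplicity ns * weight ns powr s) \<le> log 2 ((\<Sum>i<d. p i powr s) ^ n)"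
    using f wp by (intro log_mono mult_pos_pos) auto
  then have "log 2 (multiplicity ns) + s * log 2 (weight ns) \<le> n * psi s"
    using f wp Z_pos[of s] by (simp only: log_mult_pos log_powr log_nat_power psi_def)
  then have "s * (log 2 (weight ns) + log 2 (multiplicity ns)) \<le> n * psi s + (s - 1) * log 2 (multiplicity ns)"
    by (simp add: algebra_simps)
  also have "\<dots> \<le> n * psi s + (s - 1) * (n * R)" using R by simp
  also have "\<dots> = s * (- (n * rate s R))"
    using s by (simp add: rate_def field_simps)
  finally have "log 2 (weight ns) + log 2 (multiplicity ns) \<le> - (n * rate s R)"
    by (rule mult_left_le_imp_le[OF _ s])
  then have "log 2 (weight ns * multiplicity ns) \<le> - (n * rate s R)"
    using w f by (simp add: log_mult_pos)
  then show ?thesis using w f by (simp add: log_le_iff)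
next
  case True
  show ?thesis unfolding True by simp
qed

lemma shapes_near_distribution:
  assumes q: "supported q" and sorted: "\<And>i j. i \<le> j \<Longrightarrow> j < d \<Longrightarrow> q j \<le> q i" and \<delta>: "0 < \<delta>"
  shows "\<forall>\<^sub>F n in sequentially. \<exists>ns\<in>young_indices d n.
    log 2 (multiplicity ns) \<le> n * (entropy q + \<delta>) \<and> n * (entropy q - \<delta>) \<le> log 2 (multiplicity ns) \<and>
    2 powr (- (n * (divergence q + \<delta>))) \<le> weight ns * multiplicity ns"
proof -
  note qD = supportedD[OF q]
  \<comment> \<open>The support of \<open>q\<close> may be smaller than that of \<open>p\<close>.
    Shapes get no cells outside it, so logarithms of \<open>q i\<close> are only taken where they
    are meaningful.\<close>
  obtain r' where r': "r' \<le> d" "\<And>i. i < d \<Longrightarrow> 0 < q i \<longleftrightarrow> i < r'"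
    using initial_segment[of d "\<lambda>i. 0 < q i"] sorted less_le_trans by meson
  have qz: "q i = 0" if "r' \<le> i" "i < d" for i using r'(2)[of i] qD(1)[of i] that by auto
  have r'r: "r' \<le> r"
  proof (rule ccontr)
    assume "\<not> r' \<le> r"
    then have "0 < q r" "r < d" using r'(1) r'(2)[of r] by auto
    then show False using qD(4)[of r] by simp
  qed
  have r'1: "1 \<le> r'"
  proof (rule ccontr)
    assume "\<not> 1 \<le> r'"
    then have "(\<Sum>i<d. q i) = 0" using qz by simp
    then show False using qD(2) by simp
  qed
  \<comment> \<open>Dominates the coefficients of both linear errors, so that shapes within
    \<open>\<delta> / C\<close> of \<open>q\<close> are off by at most \<delta> in each
    exponent.\<close>
  define C where "C = 1 + (\<Sum>i<r'. \<bar>log 2 (q i)\<bar>) + (\<Sum>i<r'. \<bar>log 2 (p i)\<bar>)"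
  have C: "1 \<le> C" "(\<Sum>i<r'. \<bar>log 2 (q i)\<bar>) \<le> C" "1 + (\<Sum>i<r'. \<bar>log 2 (p i)\<bar>) \<le> C"
    by (auto simp: C_def intro!: add_nonneg_nonneg sum_nonneg)
  define \<epsilon> where "\<epsilon> = \<delta> / C"
  have \<epsilon>: "0 < \<epsilon>" "\<epsilon> * C = \<delta>" using \<delta> C(1) by (auto simp: \<epsilon>_def)
  have "\<epsilon> * 1 \<le> \<epsilon> * C" using C(1) \<epsilon>(1) by (intro mult_left_mono) auto
  then have \<epsilon>\<delta>: "\<epsilon> \<le> \<delta>" using \<epsilon>(2) by simp
  have q_prob: "prob_vector d q" using q by (simp add: supported_def)
  have sumr': "(\<Sum>i<r. q i * g i) = (\<Sum>i<r'. q i * g i)" for g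
    using r'r r qz by (intro sum.mono_neutral_right) auto
  have "\<forall>\<^sub>F n in sequentially. \<exists>ns\<in>young_indices d n. (\<forall>i<d. r' \<le> i \<longrightarrow> ns ! i = 0) \<and>
    (\<forall>i<d. \<bar>ns ! i / n - q i\<bar> \<le> \<epsilon>) \<and> n * (entropy q - \<epsilon>) \<le> log 2 (multiplicity ns)"
    using sorted qz by (intro approximating_shapes[OF q_prob _ r'1 r'(1) _ \<epsilon>(1)]) blast+
  then show ?thesis
    using eventually_gt_at_top[of 0]
  proof eventually_elim
    case (elim n)
    then obtain ns where ns: "ns \<in> young_indices d n" "\<And>i. i < d \<Longrightarrow> r' \<le> i \<Longrightarrow> ns ! i = 0"
      "\<And>i. i < d \<Longrightarrow> \<bar>real (ns ! i) / n - q i\<bar> \<le> \<epsilon>"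
      "n * (entropy q - \<epsilon>) \<le> log 2 (multiplicity ns)" by blast
    have len: "length ns = d" "sum_list ns = n" using ns(1) by (auto simp: young_indices_def)
    have f: "0 < multiplicity ns" using dim_specht_pos[OF ns(1)] by simp
    have lin: "\<bar>(\<Sum>i<r'. ns ! i * g i) - n * (\<Sum>i<r'. q i * g i)\<bar> \<le> n * (\<epsilon> * (\<Sum>i<r'. \<bar>g i\<bar>))"
      for g :: "nat \<Rightarrow> real"
    proof -
      have "(\<Sum>i<r'. ns ! i * g i) - n * (\<Sum>i<r'. q i * g i) = (\<Sum>i<r'. n * ((ns ! i / n - q i) * g i))"
        using elim by (simp add: sum_distrib_left algebra_simps sum_subtractf)
      also have "\<bar>\<dots>\<bar> \<le> (\<Sum>i<r'. \<bar>n * ((ns ! i / n - q i) * g i)\<bar>)" by (rule sum_abs)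
      also have "\<dots> \<le> (\<Sum>i<r'. n * (\<epsilon> * \<bar>g i\<bar>))"
        unfolding abs_mult using ns(3) r'(1) \<epsilon>(1) by (intro sum_mono mult_mono) auto
      finally show ?thesis by (simp add: sum_distrib_left)
    qed
    have logprod: "log 2 (\<Prod>i<d. x i ^ (ns ! i)) = (\<Sum>i<r'. ns ! i * log 2 (x i))" "0 < (\<Prod>i<d. x i ^ (ns ! i))"
      if x: "\<And>i. i < r' \<Longrightarrow> 0 < x i" for x :: "nat \<Rightarrow> real"
    proof -
      have eq: "(\<Prod>i<d. x i ^ (ns ! i)) = (\<Prod>i<r'. x i ^ (ns ! i))"
        using r'(1) ns(2) by (intro prod.mono_neutral_right) auto
      have nz: "x i \<noteq> 0" if "i < r'" for i using x[OF that] by simp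
      show "0 < (\<Prod>i<d. x i ^ (ns ! i))" unfolding eq using x by (intro prod_pos) auto
      have "ln (\<Prod>i<r'. x i ^ (ns ! i)) = (\<Sum>i<r'. ln (x i ^ (ns ! i)))"
        using x nz by (intro ln_prod) auto
      then have "log 2 (\<Prod>i<r'. x i ^ (ns ! i)) = (\<Sum>i<r'. log 2 (x i ^ (ns ! i)))"
        by (simp add: log_def sum_divide_distrib)
      also have "\<dots> = (\<Sum>i<r'. ns ! i * log 2 (x i))"
        using x by (intro sum.cong refl log_nat_power) (auto intro: less_imp_le)
      finally show "log 2 (\<Prod>i<d. x i ^ (ns ! i)) = (\<Sum>i<r'. ns ! i * log 2 (x i))" unfolding eq .
    qed
    have q0: "0 < q i" "0 < p i" if "i < r'" for i using r' r'r that p_pos by auto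
    have up: "log 2 (multiplicity ns) \<le> n * (entropy q + \<delta>)"
    proof -
      \<comment> \<open>All words of this shape are equally likely under independent letters drawn
        from \<open>q\<close>, so their number is at most the inverse of that probability.\<close>
      have "multiplicity ns * (\<Prod>i<d. q i ^ (ns ! i)) \<le> card (shape_words ns) * (\<Prod>i<d. q i ^ (ns ! i))"
        using dim_specht_le[of ns] logprod(2)[of q] q0 by (intro mult_right_mono) auto
      also have "\<dots> \<le> 1" using card_shape_words_le[of ns q] len qD(1,2) by simp
      finally have "log 2 (multiplicity ns * (\<Prod>i<d. q i ^ (ns ! i))) \<le> log 2 1"
        using f logprod(2)[of q] q0 by (intro log_mono) auto
      then have "log 2 (multiplicity ns) \<le> - (\<Sum>i<r'. ns ! i * log 2 (q i))"
        using f logprod[of q] q0 by (simp add: log_mult_pos)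
      also have "\<dots> \<le> - (n * (\<Sum>i<r'. q i * log 2 (q i))) + n * (\<epsilon> * (\<Sum>i<r'. \<bar>log 2 (q i)\<bar>))"
        using lin[of "\<lambda>i. log 2 (q i)"] by linarith
      also have "\<dots> \<le> - (n * (\<Sum>i<r'. q i * log 2 (q i))) + n * \<delta>"
        using C(2) \<epsilon> by (intro add_left_mono mult_left_mono) (auto simp flip: \<epsilon>(2))
      also have "\<dots> = n * (entropy q + \<delta>)"
        using entropy_support[OF q] sumr'[of "\<lambda>i. log 2 (q i)"] by (simp add: algebra_simps)
      finally show ?thesis .
    qed
    have down: "n * (entropy q - \<delta>) \<le> log 2 (multiplicity ns)"
    proof -
      have "n * (entropy q - \<delta>) \<le> n * (entropy q - \<epsilon>)" using \<epsilon>\<delta> by (intro mult_left_mono) auto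
      then show ?thesis using ns(4) by linarith
    qed
    have "2 powr (- (n * (divergence q + \<delta>))) \<le> weight ns * multiplicity ns"
    proof -
      have "- (n * (divergence q + \<delta>)) = n * (entropy q + (\<Sum>i<r'. q i * log 2 (p i)) - \<epsilon> * C)"
        unfolding divergence_def sumr' \<epsilon>(2) by (simp add: algebra_simps)
      also have "\<dots> \<le> n * (entropy q + (\<Sum>i<r'. q i * log 2 (p i)) - \<epsilon> * (1 + (\<Sum>i<r'. \<bar>log 2 (p i)\<bar>)))"
        using C(3) \<epsilon>(1) by (intro mult_left_mono diff_left_mono) auto
      also have "\<dots> = n * (entropy q - \<epsilon>) + (n * (\<Sum>i<r'. q i * log 2 (p i)) - n * (\<epsilon> * (\<Sum>i<r'. \<bar>log 2 (p i)\<bar>)))"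
        by (simp add: algebra_simps)
      also have "\<dots> \<le> log 2 (multiplicity ns) + (\<Sum>i<r'. ns ! i * log 2 (p i))"
        using lin[of "\<lambda>i. log 2 (p i)"] ns(4) by linarith
      also have "\<dots> = log 2 (weight ns * multiplicity ns)"
        using f logprod[of p] q0 by (simp add: log_mult_pos)
      finally have "2 powr (- (n * (divergence q + \<delta>))) \<le> 2 powr log 2 (weight ns * multiplicity ns)"
        by simp
      then show ?thesis using f logprod(2)[of p] q0 by (simp add: powr_log_cancel)
    qed
    then show ?case using ns(1) up down by blast
  qed
qed

lemma duality_low:
  assumes R: "0 \<le> R" "R \<le> entropy p"
  shows "(INF q \<in> {q. prob_vector d q \<and> entropy q \<le> R}. rel_entropy d q p) = (SUP s \<in> {1..}. ereal (rate s R))"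
proof (rule antisym)
  obtain q where q: "supported q" "entropy q = R"
    "\<And>\<epsilon>. 0 < \<epsilon> \<Longrightarrow> \<exists>s\<ge>1. divergence q \<le> rate s R + \<epsilon>"
    using low_rate_optimizer[OF R] by metis
  have "(INF q \<in> {q. prob_vector d q \<and> entropy q \<le> R}. rel_entropy d q p) \<le> ereal (divergence q)"
    unfolding rel_entropy_supported[OF q(1), symmetric]
    by (rule INF_lower) (use q in \<open>auto simp: supported_def\<close>)
  also have "\<dots> \<le> (SUP s \<in> {1..}. ereal (rate s R))"
  proof (rule ereal_le_epsilon2)
    fix e :: real assume "0 < e"
    then obtain s where s: "1 \<le> s" "divergence q \<le> rate s R + e" using q(3) by blast
    have "ereal (divergence q) \<le> ereal (rate s R) + ereal e" using s by simp
    also have "\<dots> \<le> (SUP s \<in> {1..}. ereal (rate s R)) + ereal e"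
      using s by (intro add_right_mono SUP_upper) auto
    finally show "ereal (divergence q) \<le> (SUP s \<in> {1..}. ereal (rate s R)) + ereal e" .
  qed
  finally show "(INF q \<in> {q. prob_vector d q \<and> entropy q \<le> R}. rel_entropy d q p) \<le> (SUP s \<in> {1..}. ereal (rate s R))" .
  show "(SUP s \<in> {1..}. ereal (rate s R)) \<le> (INF q \<in> {q. prob_vector d q \<and> entropy q \<le> R}. rel_entropy d q p)"
    by (intro SUP_least INF_greatest rate_le_rel_entropy) (auto intro: mult_left_mono_neg)
qed

text \<open>Up to \<open>log 2 r\<close> an optimizer attains equality. Beyond it the supremum is
  infinite, which makes the remaining inequality trivial.\<close>

lemma duality_high:
  assumes R: "entropy p \<le> R"
  shows "(INF q \<in> {q. prob_vector d q \<and> R \<le> entropy q}. rel_entropy d q p) = (SUP s \<in> {0<..1}. ereal (rate s R))"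
proof (rule antisym)
  show "(SUP s \<in> {0<..1}. ereal (rate s R)) \<le> (INF q \<in> {q. prob_vector d q \<and> R \<le> entropy q}. rel_entropy d q p)"
    by (intro SUP_least INF_greatest rate_le_rel_entropy) (auto intro: mult_left_mono)
  show "(INF q \<in> {q. prob_vector d q \<and> R \<le> entropy q}. rel_entropy d q p) \<le> (SUP s \<in> {0<..1}. ereal (rate s R))"
  proof (cases "R \<le> log 2 r")
    case True
    obtain q where q: "supported q" "entropy q = R"
      "\<And>\<epsilon>. 0 < \<epsilon> \<Longrightarrow> \<exists>s>0. s \<le> 1 \<and> divergence q \<le> rate s R + \<epsilon>"
      using high_rate_optimizer[OF R True] by metis
    have "(INF q \<in> {q. prob_vector d q \<and> R \<le> entropy q}. rel_entropy d q p) \<le> ereal (divergence q)"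
      unfolding rel_entropy_supported[OF q(1), symmetric]
      by (rule INF_lower) (use q in \<open>auto simp: supported_def\<close>)
    also have "\<dots> \<le> (SUP s \<in> {0<..1}. ereal (rate s R))"
    proof (rule ereal_le_epsilon2)
      fix e :: real assume "0 < e"
      then obtain s where s: "0 < s" "s \<le> 1" "divergence q \<le> rate s R + e" using q(3) by blast
      have "ereal (divergence q) \<le> ereal (rate s R) + ereal e" using s by simp
      also have "\<dots> \<le> (SUP s \<in> {0<..1}. ereal (rate s R)) + ereal e"
        using s by (intro add_right_mono SUP_upper) auto
      finally show "ereal (divergence q) \<le> (SUP s \<in> {0<..1}. ereal (rate s R)) + ereal e" .
    qed
    finally show ?thesis .
  next
    case False
    have "(SUP s \<in> {0<..1}. ereal (rate s R)) = \<infinity>"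
    proof (rule ereal_top)
      fix B
      obtain s where "0 < s" "s \<le> 1" "B \<le> rate s R" using rate_unbounded[of R B] False by auto
      then show "ereal B \<le> (SUP s \<in> {0<..1}. ereal (rate s R))"
        by (intro SUP_upper2[of s]) auto
    qed
    then show ?thesis by simp
  qed
qed

text \<open>The optimizer at \<open>R\<close> has entropy different from that of \<open>p\<close>,
  hence positive divergence; half of that serves as the slack.\<close>

lemma low_rate_sup_pos:
  assumes R: "0 \<le> R" "R < entropy p"
  shows "0 < (SUP s \<in> {1..}. ereal (rate s R))"
proof -
  obtain q where q: "supported q" "entropy q = R"
    "\<And>\<epsilon>. 0 < \<epsilon> \<Longrightarrow> \<exists>s\<ge>1. divergence q \<le> rate s R + \<epsilon>"
    using low_rate_optimizer[of R] R by (metis less_imp_le)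
  have D: "0 < divergence q" using divergence_pos[OF q(1)] q(2) R by simp
  then obtain s where s: "1 \<le> s" "divergence q \<le> rate s R + divergence q / 2" using q(3) half_gt_zero by blast
  then have "0 < ereal (rate s R)" using D by simp
  also have "\<dots> \<le> (SUP s \<in> {1..}. ereal (rate s R))" using s by (intro SUP_upper) auto
  finally show ?thesis .
qed

text \<open>\<open>P\<close> stands for the outcome probabilities. Only the two-sided comparison
  with weight times multiplicity enters, which separates the asymptotics from the representation
  theory.\<close>

context
  fixes P :: "nat list \<Rightarrow> real" and k :: nat
  assumes P_ge: "\<And>n ns. ns \<in> young_indices d n \<Longrightarrow> weight ns * multiplicity ns \<le> P ns"
    and P_le: "\<And>n ns. ns \<in> young_indices d n \<Longrightarrow> P ns \<le> (real n + 1) ^ k * (weight ns * multiplicity ns)"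
begin

lemma P_nonneg: "ns \<in> young_indices d n \<Longrightarrow> 0 \<le> P ns"
  using P_ge[of ns n] weight_nonneg[of ns] by (meson mult_nonneg_nonneg of_nat_0_le_iff order_trans)

lemma sum_P_le:
  assumes s: "0 < s" and Q: "\<And>ns. ns \<in> young_indices d n \<Longrightarrow> Q ns \<Longrightarrow>
    (s - 1) * log 2 (multiplicity ns) \<le> (s - 1) * (n * R)"
  shows "(\<Sum>ns | ns \<in> young_indices d n \<and> Q ns. P ns) \<le> (real n + 1) ^ (d + k) * 2 powr (- (n * rate s R))"
proof -
  have "(\<Sum>ns | ns \<in> young_indices d n \<and> Q ns. P ns) \<le>
      (\<Sum>ns | ns \<in> young_indices d n \<and> Q ns. (real n + 1) ^ k * 2 powr (- (n * rate s R)))"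
  proof (rule sum_mono)
    fix ns assume ns: "ns \<in> {ns. ns \<in> young_indices d n \<and> Q ns}"
    then have "weight ns * multiplicity ns \<le> 2 powr (- (n * rate s R))"
      using weight_multiplicity_le[OF _ s Q] by blast
    then have "(real n + 1) ^ k * (weight ns * multiplicity ns) \<le> (real n + 1) ^ k * 2 powr (- (n * rate s R))"
      by (intro mult_left_mono) auto
    moreover have "P ns \<le> (real n + 1) ^ k * (weight ns * multiplicity ns)" using P_le[of ns n] ns by blast
    ultimately show "P ns \<le> (real n + 1) ^ k * 2 powr (- (n * rate s R))" by linarith
  qed
  also have "\<dots> = card {ns. ns \<in> young_indices d n \<and> Q ns} * ((real n + 1) ^ k * 2 powr (- (n * rate s R)))"
    by simp
  also have "\<dots> \<le> (real n + 1) ^ d * ((real n + 1) ^ k * 2 powr (- (n * rate s R)))"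
  proof (rule mult_right_mono)
    have "card {ns. ns \<in> young_indices d n \<and> Q ns} \<le> card (young_indices d n)"
      by (rule card_mono[OF finite_young_indices]) auto
    also have "\<dots> \<le> (n + 1) ^ d" by (rule card_young_indices_le)
    finally have "real (card {ns. ns \<in> young_indices d n \<and> Q ns}) \<le> real ((n + 1) ^ d)" by (rule of_nat_mono)
    then show "real (card {ns. ns \<in> young_indices d n \<and> Q ns}) \<le> (real n + 1) ^ d"
      by (simp add: add.commute)
  qed simp
  finally show ?thesis by (simp add: power_add mult.assoc)
qed

lemma sum_P_ge:
  assumes "ns \<in> young_indices d n" "Q ns" "x \<le> weight ns * multiplicity ns"
  shows "x \<le> (\<Sum>ns | ns \<in> young_indices d n \<and> Q ns. P ns)"
proof -
  have "x \<le> P ns" using P_ge[OF assms(1)] assms(3) by linarith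
  also have "\<dots> \<le> (\<Sum>ns | ns \<in> young_indices d n \<and> Q ns. P ns)"
    using assms P_nonneg finite_young_indices by (intro member_le_sum) auto
  finally show ?thesis .
qed

lemma sum_P_ge_exponent:
  assumes q: "supported q" "\<And>i j. i \<le> j \<Longrightarrow> j < d \<Longrightarrow> q j \<le> q i" and \<delta>: "0 < \<delta>" and x: "divergence q + \<delta> \<le> x"
    and Q: "\<And>n ns. ns \<in> young_indices d n \<Longrightarrow> log 2 (multiplicity ns) \<le> n * (entropy q + \<delta>) \<Longrightarrow>
      n * (entropy q - \<delta>) \<le> log 2 (multiplicity ns) \<Longrightarrow> Q n ns"
  shows "\<forall>\<^sub>F n in sequentially. 2 powr (- (real n * x)) \<le> (\<Sum>ns | ns \<in> young_indices d n \<and> Q n ns. P ns)"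
proof -
  have "\<forall>\<^sub>F n in sequentially. \<exists>ns\<in>young_indices d n.
      log 2 (multiplicity ns) \<le> n * (entropy q + \<delta>) \<and> n * (entropy q - \<delta>) \<le> log 2 (multiplicity ns) \<and>
      2 powr (- (n * (divergence q + \<delta>))) \<le> weight ns * multiplicity ns"
    using q(2) by (intro shapes_near_distribution[OF q(1) _ \<delta>]) blast
  then show ?thesis
  proof eventually_elim
    case (elim n)
    then obtain ns where ns: "ns \<in> young_indices d n" "Q n ns"
      "2 powr (- (n * (divergence q + \<delta>))) \<le> weight ns * multiplicity ns" using Q by blast
    have "n * (divergence q + \<delta>) \<le> n * x" using x by (intro mult_left_mono) auto
    then have "(2 :: real) powr (- (n * x)) \<le> 2 powr (- (n * (divergence q + \<delta>)))"
      by (intro powr_mono) auto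
    then have "2 powr (- (real n * x)) \<le> weight ns * multiplicity ns" using ns(3) by (rule order_trans)
    then show ?case by (rule sum_P_ge[of ns n "Q n", OF ns(1,2)])
  qed
qed

text \<open>For R > 0 the target entropy is lowered to \<open>R'\<close>, so that the approximate
  dimension of the shapes stays below \<open>2^(nR)\<close>. At R = 0 there is no room below, and a
  shape of dimension exactly 1 is exhibited.\<close>

lemma limit_low:
  assumes R: "0 \<le> R" "R \<le> entropy p"
  shows "(\<lambda>n. ereal (1 / real n) * neg_log2 (\<Sum>ns | ns \<in> young_indices d n \<and>
      multiplicity ns \<le> 2 powr (real n * R). P ns)) \<longlonglongrightarrow> (SUP s \<in> {1..}. ereal (rate s R))"
proof (rule exponent_tendsto[where k = "d + k"])
  show "0 \<le> (\<Sum>ns | ns \<in> young_indices d n \<and> multiplicity ns \<le> 2 powr (real n * R). P ns)" for n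
    by (intro sum_nonneg) (auto intro: P_nonneg)
next
  fix x assume "ereal x < (SUP s \<in> {1..}. ereal (rate s R))"
  then obtain s where s: "1 \<le> s" "x < rate s R" by (auto simp: less_SUP_iff)
  have "(\<Sum>ns | ns \<in> young_indices d n \<and> multiplicity ns \<le> 2 powr (real n * R). P ns)
      \<le> (real n + 1) ^ (d + k) * 2 powr (- (n * rate s R))" for n
  proof (rule sum_P_le)
    fix ns assume "ns \<in> young_indices d n" "multiplicity ns \<le> 2 powr (real n * R)"
    then have "log 2 (multiplicity ns) \<le> n * R"
      using dim_specht_pos[of ns d n] by (simp add: log_le_iff)
    then show "(s - 1) * log 2 (multiplicity ns) \<le> (s - 1) * (n * R)"
      using s by (intro mult_left_mono) auto
  qed (use s in auto)
  then show "\<exists>v>x. \<forall>\<^sub>F n in sequentially. (\<Sum>ns | ns \<in> young_indices d n \<and> multiplicity ns \<le> 2 powr (real n * R). P ns)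
      \<le> (real n + 1) ^ (d + k) * 2 powr (- (real n * v))"
    using s by (intro exI[of _ "rate s R"]) auto
next
  fix x assume x: "(SUP s \<in> {1..}. ereal (rate s R)) < ereal x"
  then obtain y where y: "(SUP s \<in> {1..}. ereal (rate s R)) < ereal y" "y < x"
    using ereal_dense2 by (metis less_ereal.simps(1))
  have rate_y: "rate s R < y" if "1 \<le> s" for s
    using y(1) that by (metis SUP_lessD atLeast_iff less_ereal.simps(1))
  \<comment> \<open>Three shares: the slack of the optimizer, the change of rate from
    \<open>R\<close> to \<open>R'\<close>, and the approximation by shapes.\<close>
  define \<delta> where "\<delta> = (x - y) / 3"
  have \<delta>: "0 < \<delta>" "x = y + 3 * \<delta>" using y(2) by (auto simp: \<delta>_def field_simps)
  show "\<forall>\<^sub>F n in sequentially. 2 powr (- (n * x)) \<le>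
      (\<Sum>ns | ns \<in> young_indices d n \<and> multiplicity ns \<le> 2 powr (real n * R). P ns)"
  proof (cases "R = 0")
    case False
    \<comment> \<open>\<open>max 0\<close> keeps the target admissible for the optimizer; the gap
      \<open>R - R'\<close> is the tolerance allowed for the dimension.\<close>
    define R' where "R' = max 0 (R - \<delta>)"
    have R': "0 \<le> R'" "R' < R" "R - R' \<le> \<delta>" using False R(1) \<delta>(1) by (auto simp: R'_def)
    have R'p: "R' \<le> entropy p" using R R' by linarith
    obtain q where q: "supported q" "\<And>i j. i \<le> j \<Longrightarrow> j < d \<Longrightarrow> q j \<le> q i" "entropy q = R'"
      "\<And>\<epsilon>. 0 < \<epsilon> \<Longrightarrow> \<exists>s\<ge>1. divergence q \<le> rate s R' + \<epsilon>"
      by (rule low_rate_optimizer[OF R'(1) R'p]) (rule that)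
    obtain s where s: "1 \<le> s" "divergence q \<le> rate s R' + \<delta>" using q(4) \<delta>(1) by blast
    have D: "divergence q \<le> y + 2 * \<delta>"
      using s rate_lipschitz[OF s(1), of R' R] rate_y[OF s(1)] R' by linarith
    show ?thesis
    proof (rule sum_P_ge_exponent[OF q(1,2), where \<delta> = "min \<delta> (R - R')"])
      show "0 < min \<delta> (R - R')" "divergence q + min \<delta> (R - R') \<le> x" using \<delta> R' D by auto
      fix n ns assume ns: "ns \<in> young_indices d n"
        and f: "log 2 (multiplicity ns) \<le> n * (entropy q + min \<delta> (R - R'))"
      have "n * (entropy q + min \<delta> (R - R')) \<le> n * R" unfolding q(3) by (intro mult_left_mono) auto
      then show "multiplicity ns \<le> 2 powr (real n * R)"
        using f dim_specht_pos[OF ns] by (simp flip: log_le_iff)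
    qed
  next
    case True
    obtain q where q: "supported q" "entropy q = R"
      "\<And>\<epsilon>. 0 < \<epsilon> \<Longrightarrow> \<exists>s\<ge>1. divergence q \<le> rate s R + \<epsilon>"
      using low_rate_optimizer[OF R] by metis
    obtain s where s: "1 \<le> s" "divergence q \<le> rate s R + \<delta>" using q(3) \<delta>(1) by blast
    have "(\<Sum>i<r. q i * log 2 (p i)) \<le> (\<Sum>i<r. q i * log 2 (p 0))"
      using supportedD(1)[OF q(1)] p_pos p_sorted[of 0] r
      by (intro sum_mono mult_left_mono log_mono) auto
    also have "\<dots> = log 2 (p 0)" using supportedD(3)[OF q(1)] by (simp flip: sum_distrib_right)
    finally have "- log 2 (p 0) \<le> divergence q" unfolding divergence_def q(2) True by simp
    then have p0x: "- log 2 (p 0) \<le> x" using s rate_y[OF s(1)] \<delta> by linarith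
    have "2 powr (- (n * x)) \<le> (\<Sum>ns | ns \<in> young_indices d n \<and> multiplicity ns \<le> 2 powr (real n * R). P ns)" for n
    proof (rule sum_P_ge)
      \<comment> \<open>The one-row shape, whose probability is at least \<open>p 0 ^ n\<close>.
        This matches the exponent, since every distribution of entropy 0 has divergence at least
        \<open>- log 2 (p 0)\<close>.\<close>
      let ?ns = "n # replicate (d - 1) 0"
      have nth: "?ns ! i = (if i = 0 then n else 0)" if "i < d" for i
        using that by (cases i) auto
      have "sorted_wrt (\<ge>) (replicate m (0 :: nat))" for m by (induction m) auto
      then show ns: "?ns \<in> young_indices d n" using r by (auto simp: young_indices_def)
      have single: "(\<Prod>i<d. g i ^ (?ns ! i)) = g 0 ^ n" for g :: "nat \<Rightarrow> real"
      proof -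
        have "(\<Prod>i<d. g i ^ (?ns ! i)) = (\<Prod>i<d. if i = 0 then g 0 ^ n else 1)"
          by (rule prod.cong) (auto simp: nth)
        then show ?thesis using r by simp
      qed
      \<comment> \<open>Multinomial bound at the indicator of the letter 0: the only word of this
        shape is constant.\<close>
      have "real (card (shape_words ?ns)) \<le> 1"
        using card_shape_words_le[of ?ns "\<lambda>i. if i = 0 then 1 else 0"] single[of "\<lambda>i. if i = 0 then 1 else 0"] r
        by simp
      then have "multiplicity ?ns \<le> 1" using dim_specht_le[of ?ns] by linarith
      then show "multiplicity ?ns \<le> 2 powr (real n * R)" using True by simp
      have "1 \<le> multiplicity ?ns" using dim_specht_pos[OF ns] by simp
      then have "p 0 ^ n * 1 \<le> weight ?ns * multiplicity ?ns"
        unfolding single using p_pos[of 0] r by (intro mult_left_mono) auto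
      moreover have "2 powr (- (n * x)) \<le> p 0 ^ n"
      proof -
        have p0: "0 < p 0" using p_pos r by simp
        have "2 powr (- (n * x)) \<le> 2 powr (n * log 2 (p 0))"
        proof (rule powr_mono)
          have "n * (- log 2 (p 0)) \<le> n * x" using p0x by (intro mult_left_mono) auto
          then show "- (n * x) \<le> n * log 2 (p 0)" by simp
        qed simp
        also have "\<dots> = p 0 ^ n"
        proof -
          have "n * log 2 (p 0) = log 2 (p 0 ^ n)" using p0 by (simp add: log_nat_power)
          then show ?thesis using p0 by (simp add: powr_log_cancel)
        qed
        finally show ?thesis .
      qed
      ultimately show "2 powr (- (n * x)) \<le> weight ?ns * multiplicity ?ns" by simp
    qed
    then show ?thesis by simp
  qed
qed

text \<open>Mixing with the uniform distribution pushes the entropy of the optimizer strictly above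
  \<open>R\<close>, so that approximating shapes satisfy the threshold. At
  \<open>R = log 2 r\<close> no larger entropy exists; there \<open>excl\<close> leaves only r =
  1.\<close>

lemma limit_high:
  assumes R: "0 \<le> R" "entropy p \<le> R" and excl: "R \<noteq> log 2 r \<or> r = 1"
  shows "(\<lambda>n. ereal (1 / real n) * neg_log2 (\<Sum>ns | ns \<in> young_indices d n \<and>
      multiplicity ns \<ge> 2 powr (real n * R). P ns)) \<longlonglongrightarrow> (SUP s \<in> {0<..1}. ereal (rate s R))"
proof (rule exponent_tendsto[where k = "d + k"])
  show "0 \<le> (\<Sum>ns | ns \<in> young_indices d n \<and> multiplicity ns \<ge> 2 powr (real n * R). P ns)" for n
    by (intro sum_nonneg) (auto intro: P_nonneg)
next
  fix x assume "ereal x < (SUP s \<in> {0<..1}. ereal (rate s R))"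
  then obtain s where s: "0 < s" "s \<le> 1" "x < rate s R" by (auto simp: less_SUP_iff)
  have "(\<Sum>ns | ns \<in> young_indices d n \<and> multiplicity ns \<ge> 2 powr (real n * R). P ns)
      \<le> (real n + 1) ^ (d + k) * 2 powr (- (n * rate s R))" for n
  proof (rule sum_P_le)
    fix ns assume "ns \<in> young_indices d n" "2 powr (real n * R) \<le> multiplicity ns"
    then have "n * R \<le> log 2 (multiplicity ns)"
      using dim_specht_pos[of ns d n] by (simp add: le_log_iff)
    then show "(s - 1) * log 2 (multiplicity ns) \<le> (s - 1) * (n * R)"
      using s by (intro mult_left_mono_neg) auto
  qed (use s in auto)
  then show "\<exists>v>x. \<forall>\<^sub>F n in sequentially. (\<Sum>ns | ns \<in> young_indices d n \<and> multiplicity ns \<ge> 2 powr (real n * R). P ns)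
      \<le> (real n + 1) ^ (d + k) * 2 powr (- (real n * v))"
    using s by (intro exI[of _ "rate s R"]) auto
next
  fix x assume x: "(SUP s \<in> {0<..1}. ereal (rate s R)) < ereal x"
  then obtain y where y: "(SUP s \<in> {0<..1}. ereal (rate s R)) < ereal y" "y < x"
    using ereal_dense2 by (metis less_ereal.simps(1))
  have rate_y: "rate s R < y" if "0 < s" "s \<le> 1" for s
    using y(1) that by (metis SUP_lessD greaterThanAtMost_iff less_ereal.simps(1))
  define \<delta> where "\<delta> = (x - y) / 3"
  have \<delta>: "0 < \<delta>" "x = y + 3 * \<delta>" using y(2) by (auto simp: \<delta>_def field_simps)
  \<comment> \<open>A finite bound \<open>x\<close> on the supremum rules out rates beyond the
    maximal entropy.\<close>
  have Rr: "R \<le> log 2 r"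
  proof (rule ccontr)
    assume "\<not> R \<le> log 2 r"
    then obtain s where "0 < s" "s \<le> 1" "y \<le> rate s R" using rate_unbounded[of R y] by auto
    then show False using rate_y[of s] by simp
  qed
  obtain q where q: "supported q" "\<And>i j. i \<le> j \<Longrightarrow> j < d \<Longrightarrow> q j \<le> q i" "entropy q = R"
    "\<And>\<epsilon>. 0 < \<epsilon> \<Longrightarrow> \<exists>s>0. s \<le> 1 \<and> divergence q \<le> rate s R + \<epsilon>"
    by (rule high_rate_optimizer[OF R(2) Rr]) (rule that)
  obtain s where s: "0 < s" "s \<le> 1" "divergence q \<le> rate s R + \<delta>" using q(4) \<delta>(1) by blast
  have D: "divergence q \<le> y + \<delta>" using s rate_y[OF s(1,2)] by linarith
  show "\<forall>\<^sub>F n in sequentially. 2 powr (- (n * x)) \<le>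
      (\<Sum>ns | ns \<in> young_indices d n \<and> multiplicity ns \<ge> 2 powr (real n * R). P ns)"
  proof (cases "R = log 2 r")
    case True
    \<comment> \<open>The threshold is now 1, so every shape belongs to the event and no margin is
      required.\<close>
    then have "R = 0" using excl by simp
    show ?thesis
    proof (rule sum_P_ge_exponent[OF q(1,2) \<delta>(1)])
      show "divergence q + \<delta> \<le> x" using D \<delta> by simp
      fix n ns assume "ns \<in> young_indices d n"
      then show "multiplicity ns \<ge> 2 powr (real n * R)"
        using dim_specht_pos[of ns d n] \<open>R = 0\<close> by simp
    qed
  next
    case False
    then have lt: "entropy q < log 2 r" using Rr q(3) by simp
    obtain q' where q': "supported q'" "\<And>i j. i \<le> j \<Longrightarrow> j < d \<Longrightarrow> q' j \<le> q' i"
      "entropy q < entropy q'" "divergence q' \<le> divergence q + \<delta>"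
      by (rule entropy_increasing_mixture[OF q(1) lt \<delta>(1) q(2)]) (assumption | rule that)+
    have Rq': "R < entropy q'" using q'(3) q(3) by simp
    show ?thesis
    proof (rule sum_P_ge_exponent[OF q'(1,2), where \<delta> = "min \<delta> (entropy q' - R)"])
      show "0 < min \<delta> (entropy q' - R)" "divergence q' + min \<delta> (entropy q' - R) \<le> x"
        using \<delta> q'(4) Rq' D by auto
      fix n ns assume ns: "ns \<in> young_indices d n"
        and f: "n * (entropy q' - min \<delta> (entropy q' - R)) \<le> log 2 (multiplicity ns)"
      have "n * R \<le> n * (entropy q' - min \<delta> (entropy q' - R))" by (intro mult_left_mono) auto
      then show "multiplicity ns \<ge> 2 powr (real n * R)"
        using f dim_specht_pos[OF ns] by (simp flip: le_log_iff)
    qed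
  qed
qed

end

end

theorem theorem3:
  fixes \<phi> :: "complex ^ ('a::finite \<times> 'b::finite)"
    and \<rho> :: "complex ^ 'a ^ 'a"
    and p :: "nat \<Rightarrow> real"
    and R :: real
  assumes "CARD('a) = CARD('b)"
    and "norm \<phi> = 1"
    and "\<rho> = reduced_state \<phi>"
    and "eigenvalue_vector \<rho> p"
    and "0 \<le> R"
  shows
    "(R \<le> vn_entropy \<rho> \<longrightarrow>
       (\<lambda>n. ereal (1 / real n) * neg_log2 (\<Sum>ns | ns \<in> young_indices CARD('a) n \<and>
              real (cfun.dim (specht_module ns)) \<le> 2 powr (real n * R). schur_weyl_prob \<rho> ns))
         \<longlonglongrightarrow> (INF q \<in> {q. prob_vector CARD('a) q \<and> shannon_entropy CARD('a) q \<le> R}.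
               rel_entropy CARD('a) q p) \<and>
       (INF q \<in> {q. prob_vector CARD('a) q \<and> shannon_entropy CARD('a) q \<le> R}.
               rel_entropy CARD('a) q p)
         = (SUP s \<in> {1..}. ereal (((1 - s) * R - log_trace_power \<rho> s) / s)))
     \<and>
     (R \<ge> vn_entropy \<rho> \<longrightarrow>
       (R \<noteq> log 2 (real (rank \<rho>)) \<or> rank \<rho> = 1 \<longrightarrow>
       (\<lambda>n. ereal (1 / real n) * neg_log2 (\<Sum>ns | ns \<in> young_indices CARD('a) n \<and>
              real (cfun.dim (specht_module ns)) \<ge> 2 powr (real n * R). schur_weyl_prob \<rho> ns))
         \<longlonglongrightarrow> (INF q \<in> {q. prob_vector CARD('a) q \<and> shannon_entropy CARD('a) q \<ge> R}.
               rel_entropy CARD('a) q p)) \<and>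
       (INF q \<in> {q. prob_vector CARD('a) q \<and> shannon_entropy CARD('a) q \<ge> R}.
               rel_entropy CARD('a) q p)
         = (SUP s \<in> {0<..1}. ereal (((1 - s) * R - log_trace_power \<rho> s) / s)))
     \<and>
     (R < vn_entropy \<rho> \<longrightarrow>
       (SUP s \<in> {1..}. ereal (((1 - s) * R - log_trace_power \<rho> s) / s)) > 0)"
proof -
  let ?d = "CARD('a)"
  have herm: "hermitian \<rho>" unfolding assms(3) by (rule hermitian_reduced_state)
  have pv: "prob_vector ?d p"
    using prob_vector_eigenvalues assms(2-4) by blast
  have p0: "\<And>i. i < ?d \<Longrightarrow> 0 \<le> p i" and p1: "(\<Sum>i<?d. p i) = 1"
    using pv by (auto simp: prob_vector_def)
  have sorted: "\<And>i j. i \<le> j \<Longrightarrow> j < ?d \<Longrightarrow> p j \<le> p i"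
    using assms(4) by (auto simp: eigenvalue_vector_def)
  obtain u :: "nat \<Rightarrow> complex ^ 'a" where u:
    "\<And>i j. i < ?d \<Longrightarrow> j < ?d \<Longrightarrow> (\<Sum>a\<in>UNIV. cnj (u i $ a) * u j $ a) = (if i = j then 1 else 0)"
    "\<And>a b. (\<Sum>i<?d. u i $ a * cnj (u i $ b)) = (if a = b then 1 else 0)"
    "\<And>a b. (\<Sum>i<?d. of_real (p i) * (u i $ a * cnj (u i $ b))) = \<rho> $ a $ b"
    "\<And>i. i < ?d \<Longrightarrow> \<rho> *v u i = complex_of_real (p i) *s u i"
    by (rule spectral_decomposition[OF assms(4) herm]) blast
  interpret unitary_frame u by (unfold_locales; rule u)
  obtain r where supp: "r \<le> ?d" "\<And>i. i < ?d \<Longrightarrow> 0 < p i \<longleftrightarrow> i < r"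
    using initial_segment[of ?d "\<lambda>i. 0 < p i"] sorted less_le_trans by meson
  have pz: "p i = 0" if "r \<le> i" "i < ?d" for i using supp(2)[OF that(2)] p0[OF that(2)] that(1) by simp
  have r1: "1 \<le> r"
  proof (rule ccontr)
    assume "\<not> 1 \<le> r"
    then have "(\<Sum>i<?d. p i) = 0" using pz by simp
    then show False using p1 by simp
  qed
  interpret sorted_distribution ?d r p
  proof
    show "1 \<le> r" "r \<le> ?d" by (rule r1, rule supp(1))
    show "0 < p i" if "i < r" for i using supp(2)[of i] supp(1) that by simp
  qed (fact pz sorted p1)+
  have nz: "p i \<noteq> 0 \<longleftrightarrow> i < r" if "i < ?d" for i
    using supp(2)[OF that] p0[OF that] by linarith
  have "{i. i < ?d \<and> p i \<noteq> 0} = {..<r}"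
  proof (intro set_eqI)
    fix i show "i \<in> {i. i < ?d \<and> p i \<noteq> 0} \<longleftrightarrow> i \<in> {..<r}"
      using nz[of i] supp(1) by (cases "i < ?d") auto
  qed
  then have rank: "rank \<rho> = r"
    using rank_eq_card_nonzero[OF assms(4) herm] by simp
  have H: "vn_entropy \<rho> = shannon_entropy ?d p" by (rule vn_entropy_eq_shannon[OF assms(4)])
  have rate: "((1 - s) * R - log_trace_power \<rho> s) / s = rate s R" for s
    unfolding rate_def psi_def log_trace_power_eq[OF assms(4)] ..
  have P_ge: "(\<Prod>i<?d. p i ^ (ns ! i)) * real (cfun.dim (specht_module ns)) \<le> schur_weyl_prob \<rho> ns"
    if "ns \<in> young_indices ?d n" for n ns
    using that by (intro schur_weyl_prob_ge u(3) p0) (auto simp: young_indices_def)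
  have P_le: "schur_weyl_prob \<rho> ns \<le>
      (real n + 1) ^ (?d * ?d) * ((\<Prod>i<?d. p i ^ (ns ! i)) * real (cfun.dim (specht_module ns)))"
    if "ns \<in> young_indices ?d n" for n ns
    using that by (intro schur_weyl_prob_le u(3) p0 sorted)
  show ?thesis
    unfolding H rate rank
  proof (intro conjI impI)
    let ?low = "INF q \<in> {q. prob_vector ?d q \<and> shannon_entropy ?d q \<le> R}. rel_entropy ?d q p"
    assume h: "R \<le> shannon_entropy ?d p"
    show dual: "?low = (SUP s \<in> {1..}. ereal (rate s R))" by (rule duality_low[OF assms(5) h])
    show "(\<lambda>n. ereal (1 / real n) * neg_log2 (\<Sum>ns | ns \<in> young_indices ?d n \<and>
        real (cfun.dim (specht_module ns)) \<le> 2 powr (real n * R). schur_weyl_prob \<rho> ns)) \<longlonglongrightarrow> ?low"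
      unfolding dual by (rule limit_low[OF P_ge P_le assms(5) h])
  next
    let ?high = "INF q \<in> {q. prob_vector ?d q \<and> R \<le> shannon_entropy ?d q}. rel_entropy ?d q p"
    assume h: "shannon_entropy ?d p \<le> R"
    show dual: "?high = (SUP s \<in> {0<..1}. ereal (rate s R))" by (rule duality_high[OF h])
    assume e: "R \<noteq> log 2 (real r) \<or> r = 1"
    show "(\<lambda>n. ereal (1 / real n) * neg_log2 (\<Sum>ns | ns \<in> young_indices ?d n \<and>
        2 powr (real n * R) \<le> real (cfun.dim (specht_module ns)). schur_weyl_prob \<rho> ns)) \<longlonglongrightarrow> ?high"
      unfolding dual by (rule limit_high[OF P_ge P_le assms(5) h e])
  next
    assume "R < shannon_entropy ?d p"
    then show "0 < (SUP s \<in> {1..}. ereal (rate s R))" by (rule low_rate_sup_pos[OF assms(5)])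
  qed
qed

end
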